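(* Let $\Omega\subset\mathbb R^N$ be a bounded open set with boundary diagonal $d=\{(x,x):x\in\partial\Omega\}$. Let $\kappa_n$ ($n\in\mathbb N$) and $\kappa$ be finite Borel measures on $\partial\Omega$, and let $\theta_n$ ($n\in\mathbb N$) and $\theta$ be finite symmetric Borel (Radon) measures on $(\partial\Omega\times\partial\Omega)\setminus d$, such that the pairs $(\kappa_n,\theta_n)$, $n\in\mathbb N$, and $(\kappa,\theta)$ are admissible. Assume that the sequence $(\kappa_n,\theta_n)_n$ is monotone and that $(\kappa_n,\theta_n)\to(\kappa,\theta)$ vaguely. Then $\Delta_{\kappa_n,\theta_n}\to\Delta_{\kappa,\theta}$ in the strong resolvent sense as $n\to\infty$.
   Context: All measures are positive. Monotone means that $(\kappa_n)$ and $(\theta_n)$ are both increasing or both decreasing in $n$ (setwise). $(\kappa_n,\theta_n)\to(\kappa,\theta)$ vaguely means $\kappa_n\to\kappa$ vaguely on $\partial\Omega$ and $\theta_n\to\theta$ vaguely on $(\partial\Omega\times\partial\Omega)\setminus d$. $C_c(\overline\Omega)$ is the space of continuous real-valued functions with compact support in $\overline\Omega$. For a Borel measure $\kappa$ on $\partial\Omega$ and a symmetric Radon measure $\theta$ on $(\partial\Omega\times\partial\Omega)\setminus d$, the form $\mathcal E_{\kappa,\theta}$ has domain $$E=\Big\{u\in H^1(\Omega)\cap C_c(\overline\Omega):\int_{\partial\Omega}|u|^2\,d\kappa+\int_{(\partial\Omega\times\partial\Omega)\setminus d}(u(x)-u(y))^2\,d\theta(x,y)<\infty\Big\}$$ and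 is given by $$\mathcal E_{\kappa,\theta}(u,v)=\int_\Omega\nabla u\cdot\nabla v\,dx+\int_{\partial\Omega}uv\,d\kappa+\int_{(\partial\Omega\times\partial\Omega)\setminus d}(u(x)-u(y))(v(x)-v(y))\,d\theta(x,y).$$ $\widetilde H^1(\Omega)$ is the closure of $H^1(\Omega)\cap C_c(\overline\Omega)$ in $H^1(\Omega)$. The relative capacity of $A\subset\overline\Omega$ is $$\mathrm{Cap}_{\overline\Omega}(A)=\inf\{\|u\|_{H^1(\Omega)}: u\in\widetilde H^1(\Omega),\ \exists\,O\subset\mathbb R^N\text{ open},\ A\subset O,\ u\ge1\text{ a.e. on }\Omega\cap O\}.$$ $\hat\theta$ is the Borel measure on $\partial\Omega$ given by $\hat\theta(B)=\theta((B\times\partial\Omega)\setminus d)$. Let $$\Gamma_{\kappa,\theta}=\{z\in\partial\Omega:\exists r>0,\ \kappa(\partial\Omega\cap B(z,r))+\hat\theta(\partial\Omega\cap B(z,r))<\infty\}.$$ The pair $(\kappa,\theta)$ is admissible if for each Borel set $A\subset\Gamma_{\kappa,\theta}$, $\mathrm{Cap}_{\overline\Omega}(A)=0$ implies $(\kappa+\hat\theta)(A)=0$. When $(\kappa,\theta)$ is admissible the form $(\mathcal E_{\kappa,\theta},E)$ is closable in $L^2(\Omega)$; its closure is denoted by the same symbol, with domain $\mathfrak D$. The operator $-\Delta_{\kappa,\theta}$ is the self-adjoint operator on $L^2(\Omega)$ associated with the closure: $D(\Delta_{\kappa,\theta})=\{u\in\mathfrak D:\exists v\in L^2(\Omega),\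 \mathcal E_{\kappa,\theta}(u,\varphi)=(v,\varphi)_{L^2(\Omega)}\ \forall\varphi\in\mathfrak D\}$, $\Delta_{\kappa,\theta}u=-v$. *)

theory Defs
  imports "HOL-Analysis.Analysis"
begin

text \<open>
  The Hilbert space \<open>L\<^sup>2(\<Omega>)\<close> is represented by its square integrable representatives
  (real, complex or vector valued), compared through the seminorm \<open>L2_norm\<close>; elements of
  \<open>L\<^sup>2(\<Omega>)\<close> are these functions up to equality almost everywhere on \<open>\<Omega>\<close>. Values outside
  \<open>\<Omega>\<close> (or outside \<open>closure \<Omega>\<close> for functions continuous up to the boundary) are irrelevant.
\<close>

definition L2 :: "'a::euclidean_space set \<Rightarrow> ('a \<Rightarrow> 'b::euclidean_space) set" where
  "L2 \<Omega> = {u \<in> borel_measurable (lebesgue_on \<Omega>). integrable (lebesgue_on \<Omega>) (\<lambda>x. (norm (u x))\<^sup>2)}"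

definition L2_norm :: "'a::euclidean_space set \<Rightarrow> ('a \<Rightarrow> 'b::euclidean_space) \<Rightarrow> real" where
  "L2_norm \<Omega> u = sqrt (LINT x|lebesgue_on \<Omega>. (norm (u x))\<^sup>2)"

definition L2_inner :: "'a::euclidean_space set \<Rightarrow> ('a \<Rightarrow> 'b::euclidean_space) \<Rightarrow> ('a \<Rightarrow> 'b) \<Rightarrow> real" where
  "L2_inner \<Omega> u v = (LINT x|lebesgue_on \<Omega>. u x \<bullet> v x)"

subsection \<open>Sobolev space\<close>

text \<open>\<open>f\<close> is \<open>k\<close> times continuously differentiable on the whole space.\<close>

primrec C_k :: "nat \<Rightarrow> ('a::euclidean_space \<Rightarrow> real) \<Rightarrow> bool" where
  "C_k 0 f \<longleftrightarrow> continuous_on UNIV f"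
| "C_k (Suc k) f \<longleftrightarrow>
     f differentiable_on UNIV \<and> (\<forall>b\<in>Basis. C_k k (\<lambda>x. frechet_derivative f (at x) b))"

definition test_functions :: "'a::euclidean_space set \<Rightarrow> ('a \<Rightarrow> real) set" where
  "test_functions \<Omega> =
     {\<phi>. (\<forall>k. C_k k \<phi>) \<and> compact (closure {x. \<phi> x \<noteq> 0}) \<and> closure {x. \<phi> x \<noteq> 0} \<subseteq> \<Omega>}"

definition is_weak_gradient :: "'a::euclidean_space set \<Rightarrow> ('a \<Rightarrow> real) \<Rightarrow> ('a \<Rightarrow> 'a) \<Rightarrow> bool" where
  "is_weak_gradient \<Omega> u g \<longleftrightarrow>
     (\<forall>\<phi>\<in>test_functions \<Omega>. \<forall>b\<in>Basis.
        (LINT x|lebesgue_on \<Omega>. u x * frechet_derivative \<phi> (at x) b)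
          = - (LINT x|lebesgue_on \<Omega>. (g x \<bullet> b) * \<phi> x))"

definition H1 :: "'a::euclidean_space set \<Rightarrow> ('a \<Rightarrow> real) set" where
  "H1 \<Omega> = {u \<in> L2 \<Omega>. \<exists>g\<in>L2 \<Omega>. is_weak_gradient \<Omega> u g}"

definition weak_gradient :: "'a::euclidean_space set \<Rightarrow> ('a \<Rightarrow> real) \<Rightarrow> 'a \<Rightarrow> 'a" where
  "weak_gradient \<Omega> u = (SOME g. g \<in> L2 \<Omega> \<and> is_weak_gradient \<Omega> u g)"

definition H1_norm :: "'a::euclidean_space set \<Rightarrow> ('a \<Rightarrow> real) \<Rightarrow> real" where
  "H1_norm \<Omega> u = sqrt ((L2_norm \<Omega> u)\<^sup>2 + (L2_norm \<Omega> (weak_gradient \<Omega> u))\<^sup>2)"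

definition C_c :: "'a::topological_space set \<Rightarrow> ('a \<Rightarrow> real) set" where
  "C_c X = {f. continuous_on X f \<and> (\<exists>K. compact K \<and> K \<subseteq> X \<and> (\<forall>x\<in>X - K. f x = 0))}"

definition H1_tilde :: "'a::euclidean_space set \<Rightarrow> ('a \<Rightarrow> real) set" where
  "H1_tilde \<Omega> =
     {u \<in> H1 \<Omega>. \<forall>\<epsilon>>0. \<exists>v \<in> H1 \<Omega> \<inter> C_c (closure \<Omega>). H1_norm \<Omega> (\<lambda>x. u x - v x) < \<epsilon>}"

definition Cap :: "'a::euclidean_space set \<Rightarrow> 'a set \<Rightarrow> ennreal" where
  "Cap \<Omega> A = Inf {ennreal (H1_norm \<Omega> u) | u.
     u \<in> H1_tilde \<Omega> \<and> (\<exists>U. open U \<and> A \<subseteq> U \<and> (AE x in lebesgue_on (\<Omega> \<inter> U). 1 \<le> u x))}"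

subsection \<open>Measures on the boundary\<close>

definition offdiag :: "'a::euclidean_space set \<Rightarrow> ('a \<times> 'a) set" where
  "offdiag \<Omega> = frontier \<Omega> \<times> frontier \<Omega> - {(x, x) | x. x \<in> frontier \<Omega>}"

definition borel_measure_on :: "'b::topological_space set \<Rightarrow> 'b measure \<Rightarrow> bool" where
  "borel_measure_on X \<mu> \<longleftrightarrow> space \<mu> = X \<and> sets \<mu> = sets (restrict_space borel X)"

definition symmetric_measure :: "('a \<times> 'a) measure \<Rightarrow> bool" where
  "symmetric_measure \<theta> \<longleftrightarrow> (\<forall>B\<in>sets \<theta>. emeasure \<theta> (prod.swap ` B) = emeasure \<theta> B)"

text \<open>
  Image of \<open>\<theta>\<close> under the first projection: since the space of \<open>\<theta>\<close> is \<open>offdiag \<Omega>\<close>, its value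
  at \<open>B\<close> is \<open>\<theta>\<close> of \<open>B \<times> frontier \<Omega>\<close> without the diagonal.
\<close>

definition theta_hat :: "'a::euclidean_space set \<Rightarrow> ('a \<times> 'a) measure \<Rightarrow> 'a measure" where
  "theta_hat \<Omega> \<theta> = distr \<theta> (restrict_space borel (frontier \<Omega>)) fst"

definition Gamma_set :: "'a::euclidean_space set \<Rightarrow> 'a measure \<Rightarrow> ('a \<times> 'a) measure \<Rightarrow> 'a set" where
  "Gamma_set \<Omega> \<kappa> \<theta> = {z \<in> frontier \<Omega>. \<exists>r>0.
     emeasure \<kappa> (frontier \<Omega> \<inter> ball z r) + emeasure (theta_hat \<Omega> \<theta>) (frontier \<Omega> \<inter> ball z r) < \<infinity>}"

definition admissible :: "'a::euclidean_space set \<Rightarrow> 'a measure \<Rightarrow> ('a \<times> 'a) measure \<Rightarrow> bool" where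
  "admissible \<Omega> \<kappa> \<theta> \<longleftrightarrow>
     (\<forall>A\<in>sets borel. A \<subseteq> Gamma_set \<Omega> \<kappa> \<theta> \<longrightarrow> Cap \<Omega> A = 0 \<longrightarrow>
        emeasure \<kappa> A + emeasure (theta_hat \<Omega> \<theta>) A = 0)"

definition setwise_increasing :: "(nat \<Rightarrow> 'b measure) \<Rightarrow> bool" where
  "setwise_increasing \<mu> \<longleftrightarrow>
     (\<forall>m n. m \<le> n \<longrightarrow> (\<forall>B\<in>sets (\<mu> m). emeasure (\<mu> m) B \<le> emeasure (\<mu> n) B))"

definition setwise_decreasing :: "(nat \<Rightarrow> 'b measure) \<Rightarrow> bool" where
  "setwise_decreasing \<mu> \<longleftrightarrow>
     (\<forall>m n. m \<le> n \<longrightarrow> (\<forall>B\<in>sets (\<mu> m). emeasure (\<mu> n) B \<le> emeasure (\<mu> m) B))"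

definition vague_conv :: "'b::topological_space set \<Rightarrow> (nat \<Rightarrow> 'b measure) \<Rightarrow> 'b measure \<Rightarrow> bool" where
  "vague_conv X \<mu>n \<mu> \<longleftrightarrow> (\<forall>f\<in>C_c X. (\<lambda>n. LINT x|\<mu>n n. f x) \<longlonglongrightarrow> (LINT x|\<mu>. f x))"

subsection \<open>The form, its closure and the associated operator\<close>

definition form_dom :: "'a::euclidean_space set \<Rightarrow> 'a measure \<Rightarrow> ('a \<times> 'a) measure \<Rightarrow> ('a \<Rightarrow> real) set" where
  "form_dom \<Omega> \<kappa> \<theta> = {u \<in> H1 \<Omega> \<inter> C_c (closure \<Omega>).
     (\<integral>\<^sup>+ x. ennreal (\<bar>u x\<bar>\<^sup>2) \<partial>\<kappa>) + (\<integral>\<^sup>+ p. ennreal ((u (fst p) - u (snd p))\<^sup>2) \<partial>\<theta>) < \<infinity>}"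

definition form ::
    "'a::euclidean_space set \<Rightarrow> 'a measure \<Rightarrow> ('a \<times> 'a) measure \<Rightarrow> ('a \<Rightarrow> real) \<Rightarrow> ('a \<Rightarrow> real) \<Rightarrow> real" where
  "form \<Omega> \<kappa> \<theta> u v =
     L2_inner \<Omega> (weak_gradient \<Omega> u) (weak_gradient \<Omega> v)
     + (LINT x|\<kappa>. u x * v x)
     + (LINT p|\<theta>. (u (fst p) - u (snd p)) * (v (fst p) - v (snd p)))"

text \<open>
  \<open>s\<close> is a sequence in the domain \<open>D\<close>, Cauchy for the form \<open>q\<close>, that converges to \<open>u\<close> in
  \<open>L\<^sup>2(\<Omega>)\<close>. The closure of a closable form \<open>q\<close> has as domain the \<open>u\<close> possessing such a sequence,
  and its values are the limits of the values of \<open>q\<close>; closability is what makes these limits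
  independent of the approximating sequences, so that the definite description below is proper.
\<close>

definition approximates ::
    "'a::euclidean_space set \<Rightarrow> ('a \<Rightarrow> real) set \<Rightarrow> (('a \<Rightarrow> real) \<Rightarrow> ('a \<Rightarrow> real) \<Rightarrow> real)
      \<Rightarrow> (nat \<Rightarrow> 'a \<Rightarrow> real) \<Rightarrow> ('a \<Rightarrow> real) \<Rightarrow> bool" where
  "approximates \<Omega> D q s u \<longleftrightarrow>
     (\<forall>k. s k \<in> D)
     \<and> (\<forall>\<epsilon>>0. \<exists>M. \<forall>m\<ge>M. \<forall>n\<ge>M. q (\<lambda>x. s m x - s n x) (\<lambda>x. s m x - s n x) < \<epsilon>)
     \<and> (\<lambda>k. L2_norm \<Omega> (\<lambda>x. s k x - u x)) \<longlonglongrightarrow> 0"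

definition closure_dom :: "'a::euclidean_space set \<Rightarrow> 'a measure \<Rightarrow> ('a \<times> 'a) measure \<Rightarrow> ('a \<Rightarrow> real) set" where
  "closure_dom \<Omega> \<kappa> \<theta> =
     {u \<in> L2 \<Omega>. \<exists>s. approximates \<Omega> (form_dom \<Omega> \<kappa> \<theta>) (form \<Omega> \<kappa> \<theta>) s u}"

definition closure_form ::
    "'a::euclidean_space set \<Rightarrow> 'a measure \<Rightarrow> ('a \<times> 'a) measure \<Rightarrow> ('a \<Rightarrow> real) \<Rightarrow> ('a \<Rightarrow> real) \<Rightarrow> real" where
  "closure_form \<Omega> \<kappa> \<theta> u v = (THE c. \<forall>s t.
     approximates \<Omega> (form_dom \<Omega> \<kappa> \<theta>) (form \<Omega> \<kappa> \<theta>) s u \<longrightarrow>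
     approximates \<Omega> (form_dom \<Omega> \<kappa> \<theta>) (form \<Omega> \<kappa> \<theta>) t v \<longrightarrow>
     (\<lambda>k. form \<Omega> \<kappa> \<theta> (s k) (t k)) \<longlonglongrightarrow> c)"

text \<open>
  Operators in \<open>L\<^sup>2(\<Omega>)\<close> are given by their graphs, as relations between representatives.
\<close>

definition Laplacian ::
    "'a::euclidean_space set \<Rightarrow> 'a measure \<Rightarrow> ('a \<times> 'a) measure \<Rightarrow> (('a \<Rightarrow> real) \<times> ('a \<Rightarrow> real)) set" where
  "Laplacian \<Omega> \<kappa> \<theta> = {(u, (\<lambda>x. - v x)) | u v.
     u \<in> closure_dom \<Omega> \<kappa> \<theta> \<and> v \<in> L2 \<Omega> \<and>
     (\<forall>\<phi>\<in>closure_dom \<Omega> \<kappa> \<theta>. closure_form \<Omega> \<kappa> \<theta> u \<phi> = L2_inner \<Omega> v \<phi>)}"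

subsection \<open>Strong resolvent convergence\<close>

text \<open>
  Resolvents at complex points refer to the complexification \<open>u + \<i> v \<mapsto> A u + \<i> A v\<close> of \<open>A\<close>.
\<close>

definition complexification ::
    "(('a \<Rightarrow> real) \<times> ('a \<Rightarrow> real)) set \<Rightarrow> (('a \<Rightarrow> complex) \<times> ('a \<Rightarrow> complex)) set" where
  "complexification A =
     {(u, w). (\<lambda>x. Re (u x), \<lambda>x. Re (w x)) \<in> A \<and> (\<lambda>x. Im (u x), \<lambda>x. Im (w x)) \<in> A}"

text \<open>\<open>u\<close> solves \<open>(z - A) u = f\<close> in \<open>L\<^sup>2(\<Omega>)\<close>.\<close>

definition resolvent_eq ::
    "'a::euclidean_space set \<Rightarrow> (('a \<Rightarrow> real) \<times> ('a \<Rightarrow> real)) set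
      \<Rightarrow> complex \<Rightarrow> ('a \<Rightarrow> complex) \<Rightarrow> ('a \<Rightarrow> complex) \<Rightarrow> bool" where
  "resolvent_eq \<Omega> A z f u \<longleftrightarrow>
     (\<exists>w. (u, w) \<in> complexification A \<and> (AE x in lebesgue_on \<Omega>. z * u x - w x = f x))"

definition in_resolvent_set ::
    "'a::euclidean_space set \<Rightarrow> (('a \<Rightarrow> real) \<times> ('a \<Rightarrow> real)) set \<Rightarrow> complex \<Rightarrow> bool" where
  "in_resolvent_set \<Omega> A z \<longleftrightarrow>
     (\<forall>f\<in>L2 \<Omega>. \<exists>u. resolvent_eq \<Omega> A z f u)
     \<and> (\<forall>f\<in>L2 \<Omega>. \<forall>u v. resolvent_eq \<Omega> A z f u \<longrightarrow> resolvent_eq \<Omega> A z f v \<longrightarrow>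
          (AE x in lebesgue_on \<Omega>. u x = v x))
     \<and> (\<exists>C. \<forall>f\<in>L2 \<Omega>. \<forall>u. resolvent_eq \<Omega> A z f u \<longrightarrow> L2_norm \<Omega> u \<le> C * L2_norm \<Omega> f)"

definition resolvent ::
    "'a::euclidean_space set \<Rightarrow> (('a \<Rightarrow> real) \<times> ('a \<Rightarrow> real)) set
      \<Rightarrow> complex \<Rightarrow> ('a \<Rightarrow> complex) \<Rightarrow> 'a \<Rightarrow> complex" where
  "resolvent \<Omega> A z f = (SOME u. resolvent_eq \<Omega> A z f u)"

text \<open>
  Strong resolvent convergence of self-adjoint operators bounded above by \<open>0\<close>: strong convergence
  of the resolvents at every point of \<open>\<complex>\<close> outside the half-line \<open>(-\<infinity>, 0]\<close>. This comprises both
  usual conventions, all non-real \<open>z\<close> (general self-adjoint operators) and all real \<open>z > 0\<close>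
  (semibounded operators on a real Hilbert space). That these points belong to the resolvent
  sets is part of the definition, so that no unspecified value of \<open>resolvent\<close> is involved.
\<close>

definition strong_resolvent_conv ::
    "'a::euclidean_space set \<Rightarrow> (nat \<Rightarrow> (('a \<Rightarrow> real) \<times> ('a \<Rightarrow> real)) set)
      \<Rightarrow> (('a \<Rightarrow> real) \<times> ('a \<Rightarrow> real)) set \<Rightarrow> bool" where
  "strong_resolvent_conv \<Omega> An A \<longleftrightarrow>
     (\<forall>z. z \<notin> \<real>\<^sub>\<le>\<^sub>0 \<longrightarrow>
        (\<forall>n. in_resolvent_set \<Omega> (An n) z) \<and> in_resolvent_set \<Omega> A z \<and>
        (\<forall>f\<in>L2 \<Omega>. (\<lambda>n. L2_norm \<Omega> (\<lambda>x. resolvent \<Omega> (An n) z f x - resolvent \<Omega> A z f x))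
           \<longlonglongrightarrow> 0))"

end

(*
  On the common core H^1 \<inter> C of all the forms, the resolvent at r > 0 is obtained by minimising
  J(v) = E(v,v) + r |v|^2 - 2 (f,v), and any near-minimiser of J is close to the resolvent. So it
  suffices that the minima converge. This is immediate for decreasing forms. For increasing forms,
  near-minimisers of the n-th functional are truncated by a smooth contraction with values in
  [-B, B]: this does not increase the forms, changes the near-minimisers little in L^2, and
  exchanging (kappa_n, theta_n) for (kappa, theta) then costs at most B^2 times the missing mass,
  which tends to 0. Complex points are reached from r = |z| by a contraction argument.

  Admissibility enters only through closability: a sequence of the core that tends to 0 rapidly in
  H^1 tends to 0 outside a set of relative capacity 0. The competitor for the capacity is a series
  of smooth majorants sqrt(u^2 + e^2), so a chain rule is needed; for continuous u it is proved by
  difference quotients.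
*)
theory Submission
  imports Defs
begin

text \<open>The delicate point is the order of choices for increasing forms. Near-minimisers are
  bounded, but with sup bounds that may grow with n, so an error B^2 * (missing mass) is useless if
  B follows n. The remedy: near-minimisers form a Cauchy sequence in L2, because with increasing
  functionals a later near-minimiser also nearly minimises the earlier ones in the limit. A
  truncation fitted to one member thus changes all later ones little in L2, and B is fixed before n
  tends to infinity.

  Total masses must converge, although vague convergence tests compactly supported functions only
  and the space of pairs is not compact near the diagonal; monotonicity supplies the tightness.

  The common core exists because the measures are finite and continuous functions on the compact
  closure are bounded. Truncation is by an arctangent and not by clipping, since the chain rule is
  proved for C1 functions.

  The choice r = |z| makes the fixed point map at z a contraction: its rate is |sin (arg z / 2)|,
  which is 1 only on the excluded half-line.\<close>

lemma quadratic_nonneg_imp_discriminant: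
  fixes a b c :: real
  assumes nn: "\<And>t. 0 \<le> a + 2 * t * b + t\<^sup>2 * c" and c: "0 \<le> c"
  shows "b\<^sup>2 \<le> a * c"
proof (cases "c = 0")
  case True
  have "b = 0"
  proof (rule ccontr)
    assume "b \<noteq> 0"
    then show False
      \<comment> \<open>At this t the expression, affine because c = 0, takes the value -1.\<close>
      using nn[of "- (a + 1) / (2 * b)"] True by (simp add: field_simps)
  qed
  then show ?thesis using True by simp
next
  case False
  then have "c > 0" using c by simp
  have "0 \<le> (a + 2 * (- b / c) * b + (- b / c)\<^sup>2 * c) * c"
    using nn[of "- b / c"] c by (intro mult_nonneg_nonneg) auto
  also have "\<dots> = a * c - b\<^sup>2"
    using \<open>c > 0\<close> by (simp add: field_simps power2_eq_square)
  finally show ?thesis by simp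
qed

section \<open>The space of square integrable functions\<close>

lemma L2_measurable [measurable_dest]: "u \<in> L2 \<Omega> \<Longrightarrow> u \<in> borel_measurable (lebesgue_on \<Omega>)"
  and L2_integrable_norm_sq: "u \<in> L2 \<Omega> \<Longrightarrow> integrable (lebesgue_on \<Omega>) (\<lambda>x. (norm (u x))\<^sup>2)"
  by (auto simp: L2_def)

lemma L2_integrable_inner:
  assumes "u \<in> L2 \<Omega>" "v \<in> L2 \<Omega>"
  shows "integrable (lebesgue_on \<Omega>) (\<lambda>x. u x \<bullet> v x)"
proof (rule Bochner_Integration.integrable_bound)
  show "integrable (lebesgue_on \<Omega>) (\<lambda>x. (norm (u x))\<^sup>2 + (norm (v x))\<^sup>2)"
    using assms L2_integrable_norm_sq by (intro Bochner_Integration.integrable_add) auto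
  show "(\<lambda>x. u x \<bullet> v x) \<in> borel_measurable (lebesgue_on \<Omega>)"
    using assms by measurable
  have "norm (u x \<bullet> v x) \<le> (norm (u x))\<^sup>2 + (norm (v x))\<^sup>2" for x
  proof -
    have "norm (u x \<bullet> v x) \<le> norm (u x) * norm (v x)"
      using Cauchy_Schwarz_ineq2 by auto
    also have "\<dots> \<le> (norm (u x))\<^sup>2 + (norm (v x))\<^sup>2"
      using sum_squares_bound[of "norm (u x)" "norm (v x)"]
        mult_nonneg_nonneg[OF norm_ge_zero[of "u x"] norm_ge_zero[of "v x"]] by linarith
    finally show ?thesis .
  qed
  then show "AE x in lebesgue_on \<Omega>. norm (u x \<bullet> v x) \<le> norm ((norm (u x))\<^sup>2 + (norm (v x))\<^sup>2)"
    by (intro always_eventually) (simp add: abs_of_nonneg)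
qed

lemma L2_add [simp, intro]:
  assumes "u \<in> L2 \<Omega>" "v \<in> L2 \<Omega>" shows "(\<lambda>x. u x + v x) \<in> L2 \<Omega>"
proof -
  have "integrable (lebesgue_on \<Omega>) (\<lambda>x. (norm (u x))\<^sup>2 + 2 * (u x \<bullet> v x) + (norm (v x))\<^sup>2)"
    using assms by (intro Bochner_Integration.integrable_add integrable_mult_right
        L2_integrable_inner L2_integrable_norm_sq) auto
  then have "integrable (lebesgue_on \<Omega>) (\<lambda>x. (norm (u x + v x))\<^sup>2)"
    by (simp add: power2_norm_eq_inner algebra_simps inner_commute)
  then show ?thesis using assms by (auto simp: L2_def)
qed

lemma L2_scaleR [simp, intro]:
  assumes "u \<in> L2 \<Omega>" shows "(\<lambda>x. c *\<^sub>R u x) \<in> L2 \<Omega>"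
  using assms by (auto simp: L2_def power_mult_distrib)

lemma L2_cmult [simp, intro]:
  fixes u :: "'a::euclidean_space \<Rightarrow> real"
  assumes "u \<in> L2 \<Omega>" shows "(\<lambda>x. c * u x) \<in> L2 \<Omega>"
  using L2_scaleR[OF assms, of c] by simp

lemma L2_minus [simp, intro]: "u \<in> L2 \<Omega> \<Longrightarrow> (\<lambda>x. - u x) \<in> L2 \<Omega>"
  using L2_scaleR[of u \<Omega> "-1"] by simp

lemma L2_diff [simp, intro]:
  assumes "u \<in> L2 \<Omega>" "v \<in> L2 \<Omega>" shows "(\<lambda>x. u x - v x) \<in> L2 \<Omega>"
  using L2_add[OF assms(1) L2_minus[OF assms(2)]] by simp

lemma L2_zero [simp, intro]: "(\<lambda>x. 0) \<in> L2 \<Omega>"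
  by (simp add: L2_def)

lemma L2_inner_commute: "L2_inner \<Omega> u v = L2_inner \<Omega> v u"
  by (simp add: L2_inner_def inner_commute)

lemma L2_inner_add_left:
  "u \<in> L2 \<Omega> \<Longrightarrow> v \<in> L2 \<Omega> \<Longrightarrow> w \<in> L2 \<Omega> \<Longrightarrow>
    L2_inner \<Omega> (\<lambda>x. u x + v x) w = L2_inner \<Omega> u w + L2_inner \<Omega> v w"
  by (simp add: L2_inner_def inner_add_left L2_integrable_inner)

lemma L2_inner_diff_left:
  "u \<in> L2 \<Omega> \<Longrightarrow> v \<in> L2 \<Omega> \<Longrightarrow> w \<in> L2 \<Omega> \<Longrightarrow>
    L2_inner \<Omega> (\<lambda>x. u x - v x) w = L2_inner \<Omega> u w - L2_inner \<Omega> v w"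
  by (simp add: L2_inner_def inner_diff_left L2_integrable_inner)

lemma L2_inner_add_right:
  "u \<in> L2 \<Omega> \<Longrightarrow> v \<in> L2 \<Omega> \<Longrightarrow> w \<in> L2 \<Omega> \<Longrightarrow>
    L2_inner \<Omega> w (\<lambda>x. u x + v x) = L2_inner \<Omega> w u + L2_inner \<Omega> w v"
  by (simp add: L2_inner_def inner_add_right L2_integrable_inner)

lemma L2_inner_diff_right:
  "u \<in> L2 \<Omega> \<Longrightarrow> v \<in> L2 \<Omega> \<Longrightarrow> w \<in> L2 \<Omega> \<Longrightarrow>
    L2_inner \<Omega> w (\<lambda>x. u x - v x) = L2_inner \<Omega> w u - L2_inner \<Omega> w v"
  by (simp add: L2_inner_def inner_diff_right L2_integrable_inner)

lemma L2_inner_scaleR_left: "L2_inner \<Omega> (\<lambda>x. c *\<^sub>R u x) v = c * L2_inner \<Omega> u v"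
  by (simp add: L2_inner_def)

lemma L2_inner_scaleR_right: "L2_inner \<Omega> v (\<lambda>x. c *\<^sub>R u x) = c * L2_inner \<Omega> v u"
  by (simp add: L2_inner_def)

lemma L2_inner_cmult_left:
  fixes u v :: "'a::euclidean_space \<Rightarrow> real"
  shows "L2_inner \<Omega> (\<lambda>x. c * u x) v = c * L2_inner \<Omega> u v"
  using L2_inner_scaleR_left[of \<Omega> c u v] by simp

lemma L2_inner_cmult_right:
  fixes u v :: "'a::euclidean_space \<Rightarrow> real"
  shows "L2_inner \<Omega> v (\<lambda>x. c * u x) = c * L2_inner \<Omega> v u"
  using L2_inner_scaleR_right[of \<Omega> v c u] by simp

lemma L2_inner_minus_left: "L2_inner \<Omega> (\<lambda>x. - u x) v = - L2_inner \<Omega> u v"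
  by (simp add: L2_inner_def)

lemma L2_inner_minus_right: "L2_inner \<Omega> v (\<lambda>x. - u x) = - L2_inner \<Omega> v u"
  by (simp add: L2_inner_def)

lemmas L2_inner_simps = L2_inner_add_left L2_inner_add_right L2_inner_diff_left L2_inner_diff_right
  L2_inner_scaleR_left L2_inner_scaleR_right L2_inner_cmult_left L2_inner_cmult_right
  L2_inner_minus_left L2_inner_minus_right

lemma L2_inner_cong_AE:
  assumes "u \<in> L2 \<Omega>" "u' \<in> L2 \<Omega>" "v \<in> L2 \<Omega>" "v' \<in> L2 \<Omega>"
    "AE x in lebesgue_on \<Omega>. u x = u' x" "AE x in lebesgue_on \<Omega>. v x = v' x"
  shows "L2_inner \<Omega> u v = L2_inner \<Omega> u' v'"
proof -
  have [measurable]: "u \<in> borel_measurable (lebesgue_on \<Omega>)" "u' \<in> borel_measurable (lebesgue_on \<Omega>)"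
    "v \<in> borel_measurable (lebesgue_on \<Omega>)" "v' \<in> borel_measurable (lebesgue_on \<Omega>)"
    using assms by (auto simp: L2_def)
  show ?thesis unfolding L2_inner_def
    by (rule integral_cong_AE) (use assms(5,6) in auto)
qed

lemma L2_inner_self_nonneg [simp]: "0 \<le> L2_inner \<Omega> u u"
  by (simp add: L2_inner_def)

lemma L2_norm_nonneg [simp]: "0 \<le> L2_norm \<Omega> u"
  by (simp add: L2_norm_def)

lemma L2_norm_sq: "(L2_norm \<Omega> u)\<^sup>2 = L2_inner \<Omega> u u"
  by (simp add: L2_norm_def L2_inner_def power2_norm_eq_inner)

lemma L2_norm_scaleR: "L2_norm \<Omega> (\<lambda>x. c *\<^sub>R u x) = \<bar>c\<bar> * L2_norm \<Omega> u"
  by (simp add: L2_norm_def power_mult_distrib real_sqrt_mult)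

lemma L2_norm_cmult:
  fixes u :: "'a::euclidean_space \<Rightarrow> real"
  shows "L2_norm \<Omega> (\<lambda>x. c * u x) = \<bar>c\<bar> * L2_norm \<Omega> u"
  using L2_norm_scaleR[of \<Omega> c u] by simp

lemma L2_norm_minus_commute: "L2_norm \<Omega> (\<lambda>x. u x - v x) = L2_norm \<Omega> (\<lambda>x. v x - u x)"
  by (simp add: L2_norm_def norm_minus_commute)

lemma L2_Cauchy_Schwarz:
  assumes "u \<in> L2 \<Omega>" "v \<in> L2 \<Omega>"
  shows "\<bar>L2_inner \<Omega> u v\<bar> \<le> L2_norm \<Omega> u * L2_norm \<Omega> v"
proof -
  have "0 \<le> L2_inner \<Omega> u u + 2 * t * L2_inner \<Omega> u v + t\<^sup>2 * L2_inner \<Omega> v v" for t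
  proof -
    have "0 \<le> L2_inner \<Omega> (\<lambda>x. u x + t *\<^sub>R v x) (\<lambda>x. u x + t *\<^sub>R v x)" by simp
    also have "\<dots> = L2_inner \<Omega> u u + 2 * t * L2_inner \<Omega> u v + t\<^sup>2 * L2_inner \<Omega> v v"
      using assms by (simp add: L2_inner_simps L2_inner_commute[of \<Omega> v u] algebra_simps power2_eq_square)
    finally show ?thesis .
  qed
  then have "(L2_inner \<Omega> u v)\<^sup>2 \<le> L2_inner \<Omega> u u * L2_inner \<Omega> v v"
    by (intro quadratic_nonneg_imp_discriminant) auto
  also have "\<dots> = (L2_norm \<Omega> u * L2_norm \<Omega> v)\<^sup>2"
    by (simp add: power_mult_distrib L2_norm_sq)
  finally show ?thesis
    by (simp add: abs_le_square_iff[symmetric])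
qed

lemma L2_norm_add_le:
  assumes "u \<in> L2 \<Omega>" "v \<in> L2 \<Omega>"
  shows "L2_norm \<Omega> (\<lambda>x. u x + v x) \<le> L2_norm \<Omega> u + L2_norm \<Omega> v"
proof (rule power2_le_imp_le)
  have "(L2_norm \<Omega> (\<lambda>x. u x + v x))\<^sup>2 = L2_inner \<Omega> u u + 2 * L2_inner \<Omega> u v + L2_inner \<Omega> v v"
    using assms by (simp add: L2_norm_sq L2_inner_simps L2_inner_commute[of \<Omega> v u])
  also have "\<dots> \<le> (L2_norm \<Omega> u)\<^sup>2 + 2 * (L2_norm \<Omega> u * L2_norm \<Omega> v) + (L2_norm \<Omega> v)\<^sup>2"
    using L2_Cauchy_Schwarz[OF assms] by (simp add: L2_norm_sq)
  finally show "(L2_norm \<Omega> (\<lambda>x. u x + v x))\<^sup>2 \<le> (L2_norm \<Omega> u + L2_norm \<Omega> v)\<^sup>2"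
    by (simp add: power2_sum)
qed simp

lemma L2_norm_triangle3:
  assumes "u \<in> L2 \<Omega>" "v \<in> L2 \<Omega>" "w \<in> L2 \<Omega>"
  shows "L2_norm \<Omega> (\<lambda>x. u x - w x) \<le> L2_norm \<Omega> (\<lambda>x. u x - v x) + L2_norm \<Omega> (\<lambda>x. v x - w x)"
  using L2_norm_add_le[of "\<lambda>x. u x - v x" \<Omega> "\<lambda>x. v x - w x"] assms by simp

lemma L2_norm_triangle_diff:
  assumes "u \<in> L2 \<Omega>" "v \<in> L2 \<Omega>"
  shows "\<bar>L2_norm \<Omega> u - L2_norm \<Omega> v\<bar> \<le> L2_norm \<Omega> (\<lambda>x. u x - v x)"
  using L2_norm_add_le[of "\<lambda>x. u x - v x" \<Omega> v] L2_norm_add_le[of "\<lambda>x. v x - u x" \<Omega> u] assms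
  by (simp add: L2_norm_minus_commute[of \<Omega> v u])

lemma L2_norm_cong_AE:
  assumes "u \<in> borel_measurable (lebesgue_on \<Omega>)" "v \<in> borel_measurable (lebesgue_on \<Omega>)"
    "AE x in lebesgue_on \<Omega>. u x = v x"
  shows "L2_norm \<Omega> u = L2_norm \<Omega> v"
proof -
  note [measurable] = assms(1,2)
  show ?thesis unfolding L2_norm_def
    by (rule arg_cong[where f=sqrt], rule integral_cong_AE) (use assms(3) in auto)
qed

lemma L2_norm_eq_0_iff:
  assumes "u \<in> L2 \<Omega>"
  shows "L2_norm \<Omega> u = 0 \<longleftrightarrow> (AE x in lebesgue_on \<Omega>. u x = 0)"
  using integral_nonneg_eq_0_iff_AE[OF L2_integrable_norm_sq[OF assms]]
  by (simp add: L2_norm_def)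

lemma L2_norm_diff_eq_0_iff:
  assumes "u \<in> L2 \<Omega>" "v \<in> L2 \<Omega>"
  shows "L2_norm \<Omega> (\<lambda>x. u x - v x) = 0 \<longleftrightarrow> (AE x in lebesgue_on \<Omega>. u x = v x)"
  using L2_norm_eq_0_iff[of "\<lambda>x. u x - v x" \<Omega>] assms by simp

lemma L2_norm_mono_AE:
  assumes "u \<in> L2 \<Omega>" "v \<in> L2 \<Omega>" "AE x in lebesgue_on \<Omega>. norm (u x) \<le> norm (v x)"
  shows "L2_norm \<Omega> u \<le> L2_norm \<Omega> v"
  unfolding L2_norm_def using assms
  by (intro real_sqrt_le_mono integral_mono_AE L2_integrable_norm_sq) (auto elim!: eventually_mono)

lemma L2_bound:
  assumes "v \<in> L2 \<Omega>" "u \<in> borel_measurable (lebesgue_on \<Omega>)" "AE x in lebesgue_on \<Omega>. norm (u x) \<le> norm (v x)"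
  shows "u \<in> L2 \<Omega>"
proof -
  note [measurable] = assms(2)
  have "integrable (lebesgue_on \<Omega>) (\<lambda>x. (norm (u x))\<^sup>2)"
    by (rule Bochner_Integration.integrable_bound[OF L2_integrable_norm_sq[OF assms(1)]])
       (use assms(3) in \<open>auto elim!: eventually_mono\<close>)
  then show ?thesis using assms(2) by (simp add: L2_def)
qed

lemma L2_inner_tendsto:
  assumes "\<And>k. s k \<in> L2 \<Omega>" "u \<in> L2 \<Omega>" "\<And>k. t k \<in> L2 \<Omega>" "v \<in> L2 \<Omega>"
    "(\<lambda>k. L2_norm \<Omega> (\<lambda>x. s k x - u x)) \<longlonglongrightarrow> 0"
    "(\<lambda>k. L2_norm \<Omega> (\<lambda>x. t k x - v x)) \<longlonglongrightarrow> 0"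
  shows "(\<lambda>k. L2_inner \<Omega> (s k) (t k)) \<longlonglongrightarrow> L2_inner \<Omega> u v"
proof -
  have eq: "L2_inner \<Omega> (s k) (t k) - L2_inner \<Omega> u v =
      L2_inner \<Omega> (\<lambda>x. s k x - u x) (\<lambda>x. t k x - v x)
      + (L2_inner \<Omega> (\<lambda>x. s k x - u x) v + L2_inner \<Omega> u (\<lambda>x. t k x - v x))" for k
    using assms by (simp add: L2_inner_simps)
  have "(\<lambda>k. L2_norm \<Omega> (\<lambda>x. s k x - u x) * L2_norm \<Omega> (\<lambda>x. t k x - v x)
      + (L2_norm \<Omega> (\<lambda>x. s k x - u x) * L2_norm \<Omega> v + L2_norm \<Omega> u * L2_norm \<Omega> (\<lambda>x. t k x - v x)))
      \<longlonglongrightarrow> 0 * 0 + (0 * L2_norm \<Omega> v + L2_norm \<Omega> u * 0)"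
    using assms(5,6) by (intro tendsto_intros)
  then have lim: "(\<lambda>k. L2_norm \<Omega> (\<lambda>x. s k x - u x) * L2_norm \<Omega> (\<lambda>x. t k x - v x)
      + (L2_norm \<Omega> (\<lambda>x. s k x - u x) * L2_norm \<Omega> v + L2_norm \<Omega> u * L2_norm \<Omega> (\<lambda>x. t k x - v x)))
      \<longlonglongrightarrow> 0" by simp
  have le: "\<bar>L2_inner \<Omega> (s k) (t k) - L2_inner \<Omega> u v\<bar>
      \<le> L2_norm \<Omega> (\<lambda>x. s k x - u x) * L2_norm \<Omega> (\<lambda>x. t k x - v x)
      + (L2_norm \<Omega> (\<lambda>x. s k x - u x) * L2_norm \<Omega> v + L2_norm \<Omega> u * L2_norm \<Omega> (\<lambda>x. t k x - v x))" for k
    unfolding eq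
    using L2_Cauchy_Schwarz[of "\<lambda>x. s k x - u x" \<Omega> "\<lambda>x. t k x - v x"]
      L2_Cauchy_Schwarz[of "\<lambda>x. s k x - u x" \<Omega> v] L2_Cauchy_Schwarz[of u \<Omega> "\<lambda>x. t k x - v x"] assms(1-4)
    by auto
  have "(\<lambda>k. L2_inner \<Omega> (s k) (t k) - L2_inner \<Omega> u v) \<longlonglongrightarrow> 0"
    by (rule Lim_null_comparison[OF _ lim]) (simp add: le)
  then show ?thesis by (simp add: LIM_zero_iff)
qed

lemma L2_norm_tendsto:
  assumes "\<And>k. s k \<in> L2 \<Omega>" "u \<in> L2 \<Omega>" "(\<lambda>k. L2_norm \<Omega> (\<lambda>x. s k x - u x)) \<longlonglongrightarrow> 0"
  shows "(\<lambda>k. L2_norm \<Omega> (s k)) \<longlonglongrightarrow> L2_norm \<Omega> u"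
proof -
  have "(\<lambda>k. L2_norm \<Omega> (s k) - L2_norm \<Omega> u) \<longlonglongrightarrow> 0"
    using assms by (intro Lim_null_comparison[OF _ assms(3)]) (auto intro!: always_eventually L2_norm_triangle_diff)
  then show ?thesis by (simp add: LIM_zero_iff)
qed

text \<open>Riesz--Fischer: consecutive differences of a rapid subsequence satisfy
  \<open>\<Sum>k. 4\<^sup>k \<bar>d\<^sub>k\<bar>\<^sup>2 < \<infinity>\<close> almost everywhere, hence the subsequence converges there.\<close>

lemma L2_complete:
  fixes s :: "nat \<Rightarrow> 'a::euclidean_space \<Rightarrow> 'b::euclidean_space"
  assumes sL: "\<And>k. s k \<in> L2 \<Omega>"
    and cauchy: "\<And>e. e > 0 \<Longrightarrow> \<exists>M. \<forall>m\<ge>M. \<forall>n\<ge>M. L2_norm \<Omega> (\<lambda>x. s m x - s n x) < e"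
  obtains u where "u \<in> L2 \<Omega>" "(\<lambda>k. L2_norm \<Omega> (\<lambda>x. s k x - u x)) \<longlonglongrightarrow> 0"
proof -
  let ?M = "lebesgue_on \<Omega>"
  have [measurable]: "\<And>k. s k \<in> borel_measurable ?M" using sL by (rule L2_measurable)
  obtain M where M: "\<And>e m n. e > 0 \<Longrightarrow> m \<ge> M e \<Longrightarrow> n \<ge> M e \<Longrightarrow> L2_norm \<Omega> (\<lambda>x. s m x - s n x) < e"
    using cauchy by metis
  \<comment> \<open>\<open>M\<close> is a choice function for the Cauchy condition. The entry
    \<open>Suc a\<close> forces strict growth, the other one makes the k-th difference smaller than
    \<open>(1/4) ^ k\<close>.\<close>
  define r where "r = rec_nat (M 1) (\<lambda>k a. max (Suc a) (M ((1/4) ^ Suc k)))"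
  have r_Suc: "r (Suc k) = max (Suc (r k)) (M ((1/4) ^ Suc k))" for k by (simp add: r_def)
  have r_mono: "strict_mono r" unfolding strict_mono_Suc_iff using r_Suc by (metis lessI less_max_iff_disj)
  have r_ge: "r k \<ge> M ((1/4) ^ k)" for k
    by (cases k) (simp_all add: r_def)
  define d where "d k x = s (r (Suc k)) x - s (r k) x" for k x
  have [measurable]: "\<And>k. d k \<in> borel_measurable ?M" unfolding d_def by measurable
  have dL: "d k \<in> L2 \<Omega>" for k unfolding d_def using sL by auto
  \<comment> \<open>After multiplication by the weight \<open>4 ^ k\<close> the summable
    \<open>(1/4) ^ k\<close> remains; conversely, at a point where the weighted series converges its
    terms are bounded, which makes the differences of order \<open>(1/2) ^ k\<close>.\<close>
  have d_small: "L2_inner \<Omega> (d k) (d k) \<le> (1/16) ^ k" for k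
  proof -
    have "L2_norm \<Omega> (d k) < (1/4) ^ k" unfolding d_def
      using r_ge[of k] strict_monoD[OF r_mono, of k "Suc k"] by (intro M) auto
    then have "(L2_norm \<Omega> (d k))\<^sup>2 \<le> ((1/4) ^ k)\<^sup>2" by (intro power_mono) auto
    also have "\<dots> = (1/16) ^ k" by (simp add: power2_eq_square power_mult_distrib[symmetric])
    finally show ?thesis by (simp add: L2_norm_sq)
  qed
  have "(\<integral>\<^sup>+x. (\<Sum>k. ennreal (4 ^ k * (norm (d k x))\<^sup>2)) \<partial>?M) = (\<Sum>k. \<integral>\<^sup>+x. ennreal (4 ^ k * (norm (d k x))\<^sup>2) \<partial>?M)"
    by (rule nn_integral_suminf) measurable
  also have "\<dots> = (\<Sum>k. ennreal (4 ^ k * L2_inner \<Omega> (d k) (d k)))"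
  proof (rule arg_cong[where f=suminf], rule ext)
    fix k
    have "(\<integral>\<^sup>+x. ennreal (4 ^ k * (norm (d k x))\<^sup>2) \<partial>?M) = ennreal (LINT x|?M. 4 ^ k * (norm (d k x))\<^sup>2)"
      by (rule nn_integral_eq_integral) (auto intro!: integrable_mult_right L2_integrable_norm_sq dL)
    then show "(\<integral>\<^sup>+x. ennreal (4 ^ k * (norm (d k x))\<^sup>2) \<partial>?M) = ennreal (4 ^ k * L2_inner \<Omega> (d k) (d k))"
      by (simp add: L2_inner_def power2_norm_eq_inner)
  qed
  also have "\<dots> \<le> (\<Sum>k. ennreal ((1/4) ^ k))"
  proof (rule suminf_le)
    fix k
    have "4 ^ k * L2_inner \<Omega> (d k) (d k) \<le> 4 ^ k * (1/16) ^ k"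
      using d_small by (intro mult_left_mono) auto
    also have "\<dots> = (1/4) ^ k" by (simp add: power_mult_distrib[symmetric])
    finally show "ennreal (4 ^ k * L2_inner \<Omega> (d k) (d k)) \<le> ennreal ((1/4) ^ k)" by (rule ennreal_leI)
  qed auto
  also have "\<dots> < \<infinity>"
    by (subst suminf_ennreal2) (auto intro!: summable_geometric)
  finally have fin: "(\<integral>\<^sup>+x. (\<Sum>k. ennreal (4 ^ k * (norm (d k x))\<^sup>2)) \<partial>?M) \<noteq> \<infinity>" by simp
  have AE_fin: "AE x in ?M. (\<Sum>k. ennreal (4 ^ k * (norm (d k x))\<^sup>2)) \<noteq> \<infinity>"
    by (rule nn_integral_PInf_AE) (use fin in auto)
  have conv_x: "convergent (\<lambda>k. s (r k) x)" if "(\<Sum>k. ennreal (4 ^ k * (norm (d k x))\<^sup>2)) \<noteq> \<infinity>" for x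
  proof -
    have sm: "summable (\<lambda>k. 4 ^ k * (norm (d k x))\<^sup>2)"
      by (rule summable_suminf_not_top) (use that in auto)
    define C where "C = (\<Sum>k. 4 ^ k * (norm (d k x))\<^sup>2)"
    have le: "4 ^ k * (norm (d k x))\<^sup>2 \<le> C" for k
      unfolding C_def using sum_le_suminf[OF sm, of "{k}"] by auto
    have C0: "C \<ge> 0" by (rule order_trans[OF _ le[of 0]]) simp
    have "norm (d k x) \<le> sqrt C * (1/2) ^ k" for k
    proof (rule power2_le_imp_le)
      have "(2 ^ k * 2 ^ k) * (norm (d k x))\<^sup>2 \<le> C"
        using le[of k] by (simp add: power_mult_distrib[symmetric])
      then show "(norm (d k x))\<^sup>2 \<le> (sqrt C * (1/2) ^ k)\<^sup>2"
        using C0 by (simp add: power_mult_distrib power_divide power2_eq_square field_simps)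
    qed (use C0 in auto)
    then have "summable (\<lambda>k. d k x)"
      by (intro summable_comparison_test[of "\<lambda>k. d k x" "\<lambda>k. sqrt C * (1/2) ^ k"])
         (auto intro!: summable_mult summable_geometric)
    then have "convergent (\<lambda>n. \<Sum>k<n. d k x)" by (simp add: summable_iff_convergent)
    then have "convergent (\<lambda>n. (\<Sum>k<n. d k x) + s (r 0) x)" by (intro convergent_add convergent_const)
    moreover have "(\<Sum>k<n. d k x) + s (r 0) x = s (r n) x" for n
      by (induction n) (auto simp: d_def algebra_simps)
    ultimately show ?thesis by simp
  qed
  \<comment> \<open>The default 0 on the null set of divergence makes \<open>u\<close> measurable as
    a total function.\<close>
  define u where "u x = (if convergent (\<lambda>k. s (r k) x) then lim (\<lambda>k. s (r k) x) else 0)" for x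
  have AE_lim: "AE x in ?M. (\<lambda>k. s (r k) x) \<longlonglongrightarrow> u x"
    using AE_fin by eventually_elim (use conv_x in \<open>auto simp: u_def convergent_LIMSEQ_iff\<close>)
  have [measurable]: "u \<in> borel_measurable ?M"

  proof -
    have "(\<lambda>x. if Cauchy (\<lambda>k. s (r k) x) then lim (\<lambda>k. s (r k) x) else 0) \<in> borel_measurable ?M"
      using borel_measurable_lim_metric by measurable
    then show ?thesis by (simp add: u_def[abs_def] Cauchy_convergent_iff)
  qed
  \<comment> \<open>Fatou is applied along the subsequence \<open>r\<close>, while \<open>m\<close>
    runs through the full sequence; so the Cauchy bound becomes a bound on the distance of the full
    sequence to the limit.\<close>
  have fatou: "(\<integral>\<^sup>+x. ennreal ((norm (s m x - u x))\<^sup>2) \<partial>?M) \<le> ennreal (e\<^sup>2)" if e: "e > 0" and m: "m \<ge> M e" for e m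
  proof -
    have "(\<integral>\<^sup>+x. ennreal ((norm (s m x - u x))\<^sup>2) \<partial>?M) = (\<integral>\<^sup>+x. liminf (\<lambda>k. ennreal ((norm (s m x - s (r k) x))\<^sup>2)) \<partial>?M)"
    proof (rule nn_integral_cong_AE)
      show "AE x in ?M. ennreal ((norm (s m x - u x))\<^sup>2) = liminf (\<lambda>k. ennreal ((norm (s m x - s (r k) x))\<^sup>2))"
        using AE_lim
      proof eventually_elim
        case (elim x)
        have "(\<lambda>k. ennreal ((norm (s m x - s (r k) x))\<^sup>2)) \<longlonglongrightarrow> ennreal ((norm (s m x - u x))\<^sup>2)"
          by (intro tendsto_intros tendsto_ennrealI elim)
        then show ?case by (rule lim_imp_Liminf[OF sequentially_bot, symmetric])
      qed
    qed
    also have "\<dots> \<le> liminf (\<lambda>k. \<integral>\<^sup>+x. ennreal ((norm (s m x - s (r k) x))\<^sup>2) \<partial>?M)"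
      by (rule nn_integral_liminf) measurable
    also have "\<dots> \<le> ennreal (e\<^sup>2)"
    proof (rule Liminf_le)
      show "\<forall>\<^sub>F k in sequentially. (\<integral>\<^sup>+x. ennreal ((norm (s m x - s (r k) x))\<^sup>2) \<partial>?M) \<le> ennreal (e\<^sup>2)"
      proof (rule eventually_sequentiallyI[of "M e"])
        fix k assume "M e \<le> k"
        then have "M e \<le> r k" using strict_mono_imp_increasing[OF r_mono, of k] by simp
        then have "L2_norm \<Omega> (\<lambda>x. s m x - s (r k) x) < e" by (intro M e m)
        then have "(L2_norm \<Omega> (\<lambda>x. s m x - s (r k) x))\<^sup>2 \<le> e\<^sup>2" by (intro power_mono) auto
        then have "(LINT x|?M. (norm (s m x - s (r k) x))\<^sup>2) \<le> e\<^sup>2"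
          by (simp add: L2_norm_def)
        then show "(\<integral>\<^sup>+x. ennreal ((norm (s m x - s (r k) x))\<^sup>2) \<partial>?M) \<le> ennreal (e\<^sup>2)"
          by (subst nn_integral_eq_integral) (auto intro!: L2_integrable_norm_sq sL ennreal_leI)
      qed
    qed simp
    finally show ?thesis .
  qed
  have dif: "(\<lambda>x. s m x - u x) \<in> L2 \<Omega>" if "m \<ge> M 1" for m
  proof -
    have "(\<integral>\<^sup>+x. ennreal ((norm (s m x - u x))\<^sup>2) \<partial>?M) < \<infinity>"
      using fatou[of 1 m] that by (intro le_less_trans[OF fatou[of 1 m]]) auto
    then have "integrable ?M (\<lambda>x. (norm (s m x - u x))\<^sup>2)"
      by (intro integrableI_nonneg) auto
    then show ?thesis by (simp add: L2_def)
  qed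
  have uL: "u \<in> L2 \<Omega>"
    using L2_diff[OF sL[of "M 1"] dif[of "M 1"]] by simp
  have "(\<lambda>k. L2_norm \<Omega> (\<lambda>x. s k x - u x)) \<longlonglongrightarrow> 0"
  proof (rule LIMSEQ_I)
    fix e :: real assume "e > 0"
    have "L2_norm \<Omega> (\<lambda>x. s m x - u x) < e" if "m \<ge> M (e/2)" for m
    proof -
      have "ennreal (LINT x|?M. (norm (s m x - u x))\<^sup>2) \<le> ennreal ((e/2)\<^sup>2)"
        using fatou[of "e/2" m] that \<open>e > 0\<close> sL uL
        by (subst (asm) nn_integral_eq_integral) (auto intro!: L2_integrable_norm_sq)
      then have "(L2_norm \<Omega> (\<lambda>x. s m x - u x))\<^sup>2 \<le> (e/2)\<^sup>2"
        by (simp add: L2_norm_def ennreal_le_iff)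
      then have "L2_norm \<Omega> (\<lambda>x. s m x - u x) \<le> e/2"
        by (rule power2_le_imp_le) (use \<open>e > 0\<close> in simp)
      then show ?thesis using \<open>e > 0\<close> by simp
    qed
    then show "\<exists>no. \<forall>n\<ge>no. norm (L2_norm \<Omega> (\<lambda>x. s n x - u x) - 0) < e" by auto
  qed
  with uL show thesis by (rule that)
qed

section \<open>Test functions\<close>

lemma C_k_Suc_imp_C_k: "C_k (Suc k) f \<Longrightarrow> C_k k f"
proof (induction k arbitrary: f)
  case 0
  then show ?case by (auto intro: differentiable_imp_continuous_on)
next
  case (Suc k)
  from Suc.prems have "f differentiable_on UNIV"
    and "\<forall>b\<in>Basis. C_k (Suc k) (\<lambda>x. frechet_derivative f (at x) b)" by (metis C_k.simps(2))+
  then show ?case using Suc.IH by auto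
qed

text \<open>Inductions over the order of smoothness produce explicit derivatives; uniqueness of
  derivatives lets \<open>f'\<close> stand for the \<open>frechet_derivative\<close> in the
  definition.\<close>

lemma C_k_SucI:
  assumes "\<And>x. (f has_derivative f' x) (at x)" "\<And>b. b \<in> Basis \<Longrightarrow> C_k k (\<lambda>x. f' x b)"
  shows "C_k (Suc k) f"
proof -
  have "frechet_derivative f (at x) = f' x" for x
    using frechet_derivative_at[OF assms(1)] by simp
  then show ?thesis using assms
    by (auto simp: differentiable_on_def intro: differentiableI)
qed

lemma C_k_SucD:
  assumes "C_k (Suc k) f"
  shows "(f has_derivative frechet_derivative f (at x)) (at x)"
  using assms by (auto simp: differentiable_on_def frechet_derivative_works)

lemma C_k_const: "C_k k (\<lambda>x. c)"
proof (induction k arbitrary: c)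
  case (Suc k)
  show ?case by (rule C_k_SucI[where f'="\<lambda>x b. 0"]) (use Suc in auto)
qed simp

lemma C_k_add: "C_k k f \<Longrightarrow> C_k k g \<Longrightarrow> C_k k (\<lambda>x. f x + g x)"
proof (induction k arbitrary: f g)
  case 0 then show ?case by (auto intro: continuous_on_add)
next
  case (Suc k)
  have df: "\<And>x. (f has_derivative frechet_derivative f (at x)) (at x)"
    and dg: "\<And>x. (g has_derivative frechet_derivative g (at x)) (at x)" using Suc.prems C_k_SucD by blast+
  show ?case
    by (rule C_k_SucI[OF has_derivative_add[OF df dg]]) (use Suc in auto)
qed

lemma C_k_mult: "C_k k f \<Longrightarrow> C_k k g \<Longrightarrow> C_k k (\<lambda>x. f x * g x)"
proof (induction k arbitrary: f g)
  case 0 then show ?case by (auto intro: continuous_on_mult)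
next
  case (Suc k)
  have df: "\<And>x. (f has_derivative frechet_derivative f (at x)) (at x)"
    and dg: "\<And>x. (g has_derivative frechet_derivative g (at x)) (at x)" using Suc.prems C_k_SucD by blast+
  have "C_k k f" "C_k k g" using Suc.prems C_k_Suc_imp_C_k by blast+
  then show ?case
    by (intro C_k_SucI[OF has_derivative_mult[OF df dg]] C_k_add Suc.IH) (use Suc.prems in auto)
qed

lemma C_k_prod: "(\<And>i. i \<in> I \<Longrightarrow> C_k k (f i)) \<Longrightarrow> C_k k (\<lambda>x. \<Prod>i\<in>I. f i x)"
  by (induction I rule: infinite_finite_induct) (auto intro: C_k_const C_k_mult)

lemma C_k_bounded_linear:
  assumes "bounded_linear h" shows "C_k k h"
proof (cases k)
  case 0 then show ?thesis using assms by (simp add: linear_continuous_on)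
next
  case (Suc m)
  show ?thesis unfolding Suc
    by (rule C_k_SucI[OF bounded_linear.has_derivative[OF assms has_derivative_ident]]) (rule C_k_const)
qed

lemma C_k_real_polynomial_function: "real_polynomial_function p \<Longrightarrow> C_k k p"
  by (induction rule: real_polynomial_function.induct)
     (auto intro: C_k_bounded_linear C_k_const C_k_add C_k_mult)

lemma C_k_translate: "C_k k f \<Longrightarrow> C_k k (\<lambda>x. f (x + c))"
proof (induction k arbitrary: f)
  case 0
  then show ?case by (auto intro!: continuous_on_compose2[of UNIV f] continuous_intros)
next
  case (Suc k)
  have df: "\<And>x. (f has_derivative frechet_derivative f (at x)) (at x)" using Suc.prems C_k_SucD by blast
  have "((\<lambda>x. f (x + c)) has_derivative frechet_derivative f (at (x + c))) (at x)" for x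
    using has_derivative_compose[OF has_derivative_add[OF has_derivative_ident has_derivative_const[of c]] df]
    by simp
  then show ?case
    by (rule C_k_SucI) (use Suc in auto)
qed

section \<open>Flat functions built from exp(-1/t) and smooth bumps on boxes\<close>

definition exp_bump :: "real poly \<Rightarrow> real \<Rightarrow> real" where
  "exp_bump p t = (if t > 0 then poly p (inverse t) * exp (- inverse t) else 0)"

lemma poly_times_exp_minus_tendsto_0: "((\<lambda>x::real. poly p x * exp (- x)) \<longlongrightarrow> 0) at_top"
proof -
  have "((\<lambda>x::real. \<Sum>i\<le>degree p. coeff p i * (x ^ i / exp x)) \<longlongrightarrow> (\<Sum>i\<le>degree p. coeff p i * 0)) at_top"
    by (intro tendsto_intros tendsto_power_div_exp_0)
  then show ?thesis
    by (simp add: poly_altdef sum_distrib_right sum_divide_distrib exp_minus field_simps)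
qed

lemma exp_bump_at_0: "((\<lambda>h. exp_bump p h / h) \<longlongrightarrow> 0) (at 0)"
proof -
  \<comment> \<open>With x = 1/h the quotient on the right of 0 is x p(x) exp(-x), and
    \<open>pCons 0 p\<close> is the polynomial X p.\<close>
  have "((\<lambda>h. poly (pCons 0 p) (inverse h) * exp (- inverse h)) \<longlongrightarrow> 0) (at_right 0)"
    by (rule filterlim_compose[OF poly_times_exp_minus_tendsto_0 filterlim_inverse_at_top_right])
  then have r: "((\<lambda>h. exp_bump p h / h) \<longlongrightarrow> 0) (at_right 0)"
    by (rule Lim_transform_eventually)
       (auto simp: eventually_at_filter exp_bump_def field_simps)
  have "((\<lambda>h. exp_bump p h / h) \<longlongrightarrow> 0) (at_left 0)"
    by (rule Lim_transform_eventually[OF tendsto_const])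
       (auto simp: eventually_at_filter exp_bump_def)
  then show ?thesis using r by (simp add: filterlim_at_split)
qed

text \<open>For t > 0 the derivative of p(1/t) exp(-1/t) is (1/t)^2 (p(1/t) - p'(1/t)) exp(-1/t).
  The family is therefore closed under differentiation, and smoothness of all its members is a
  single induction with \<open>p\<close> arbitrary.\<close>

lemma exp_bump_has_derivative:
  "(exp_bump p has_real_derivative exp_bump ([:0, 0, 1:] * (p - pderiv p)) t) (at t)"
proof (cases "t = 0")
  case True
  then show ?thesis
    using exp_bump_at_0[of p] by (simp add: has_field_derivative_iff exp_bump_def)
next
  case False
  show ?thesis
  proof (cases "t > 0")
    case True
    have "((\<lambda>t. poly p (inverse t) * exp (- inverse t)) has_real_derivative
        exp_bump ([:0, 0, 1:] * (p - pderiv p)) t) (at t)"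
      using True by (auto intro!: derivative_eq_intros DERIV_chain'[OF _ poly_DERIV]
          simp: exp_bump_def field_simps power2_eq_square)
    moreover have "\<forall>\<^sub>F s in nhds t. poly p (inverse s) * exp (- inverse s) = exp_bump p s"
      using True eventually_nhds_in_open[of "{0<..}" t]
      by (auto elim!: eventually_mono simp: exp_bump_def)
    ultimately show ?thesis by (subst (asm) DERIV_cong_ev[OF refl _ refl])
  next
    case nonpos: False
    then have "t < 0" using False by simp
    then have "\<forall>\<^sub>F s in nhds t. 0 = exp_bump p s"
      using eventually_nhds_in_open[of "{..<0}" t] by (auto elim!: eventually_mono simp: exp_bump_def)
    then have "((\<lambda>s. 0) has_real_derivative exp_bump ([:0, 0, 1:] * (p - pderiv p)) t) (at t) \<longleftrightarrow> ?thesis"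
      by (rule DERIV_cong_ev[OF refl _ refl])
    then show ?thesis using \<open>t < 0\<close> by (simp add: exp_bump_def)
  qed
qed

lemma C_k_exp_bump: "C_k k (\<lambda>x. exp_bump p (c * (x \<bullet> v) + d))"
proof (induction k arbitrary: p)
  case 0
  have "continuous_on UNIV (exp_bump p)"
    using DERIV_isCont[OF exp_bump_has_derivative] by (simp add: continuous_on_eq_continuous_at)
  then show ?case by (auto intro!: continuous_on_compose2[of UNIV "exp_bump p"] continuous_intros)
next
  case (Suc k)
  have "((\<lambda>x. exp_bump p (c * (x \<bullet> v) + d)) has_derivative
      (\<lambda>b. exp_bump ([:0, 0, 1:] * (p - pderiv p)) (c * (x \<bullet> v) + d) * (c * (b \<bullet> v)))) (at x)" for x
    by (rule has_derivative_compose[OF _ exp_bump_has_derivative[unfolded has_field_derivative_def]])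
       (auto intro!: derivative_eq_intros)
  then show ?case
    by (rule C_k_SucI) (intro C_k_mult C_k_const Suc.IH)
qed

text \<open>\<open>c\<close> is a sharpness parameter: for t > 0 the factor exp(-1/(c t)) tends to 1
  as c grows, so these functions converge to the indicator of the open box without leaving
  [0, 1].\<close>

definition box_bump :: "real \<Rightarrow> 'a::euclidean_space \<Rightarrow> 'a \<Rightarrow> 'a \<Rightarrow> real" where
  "box_bump c a b x = (\<Prod>i\<in>Basis. exp_bump 1 (c * (x \<bullet> i - a \<bullet> i)) * exp_bump 1 (c * (b \<bullet> i - x \<bullet> i)))"

lemma C_k_box_bump: "C_k k (box_bump c a b)"
proof -
  have "box_bump c a b = (\<lambda>x. \<Prod>i\<in>Basis. exp_bump 1 (c * (x \<bullet> i) + - (c * (a \<bullet> i)))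
      * exp_bump 1 ((- c) * (x \<bullet> i) + c * (b \<bullet> i)))"
    by (intro ext) (simp add: box_bump_def algebra_simps)
  then show ?thesis by (simp only:) (intro C_k_prod C_k_mult C_k_exp_bump)
qed

lemma exp_bump_1_bounds: "0 \<le> exp_bump 1 t" "exp_bump 1 t \<le> 1"
  by (auto simp: exp_bump_def)

lemma box_bump_bounds: "0 \<le> box_bump c a b x" "box_bump c a b x \<le> 1"
  unfolding box_bump_def
  by (auto intro!: prod_nonneg prod_le_1 mult_nonneg_nonneg mult_le_one exp_bump_1_bounds)

lemma box_bump_outside:
  assumes "c > 0" "x \<notin> box a b" shows "box_bump c a b x = 0"
proof -
  obtain i where i: "i \<in> Basis" "\<not> (a \<bullet> i < x \<bullet> i \<and> x \<bullet> i < b \<bullet> i)"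
    using assms(2) by (auto simp: mem_box)
  then have "exp_bump 1 (c * (x \<bullet> i - a \<bullet> i)) * exp_bump 1 (c * (b \<bullet> i - x \<bullet> i)) = 0"
    using \<open>c > 0\<close> by (auto simp: exp_bump_def zero_less_mult_iff)
  then show ?thesis unfolding box_bump_def using i(1) by (intro prod_zero) auto
qed

lemma box_bump_tendsto: "(\<lambda>n. box_bump (real (Suc n)) a b x) \<longlonglongrightarrow> indicator (box a b) x"
proof (cases "x \<in> box a b")
  case True
  have lim: "(\<lambda>n. exp_bump 1 (real (Suc n) * t)) \<longlonglongrightarrow> 1" if "t > 0" for t
  proof -
    have "(\<lambda>n. exp (- inverse (real (Suc n)) * inverse t)) \<longlonglongrightarrow> exp (- 0 * inverse t)"
      by (intro tendsto_intros LIMSEQ_inverse_real_of_nat)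
    then show ?thesis using that by (simp add: exp_bump_def zero_less_mult_iff)
  qed
  have "(\<lambda>n. box_bump (real (Suc n)) a b x) \<longlonglongrightarrow> (\<Prod>i\<in>(Basis::'a set). 1 * 1)"
    unfolding box_bump_def
    by (intro tendsto_prod tendsto_mult lim) (use True in \<open>auto simp: mem_box\<close>)
  then show ?thesis using True by simp
next
  case False
  then show ?thesis by (simp add: box_bump_outside)
qed

lemma test_functionsI:
  assumes "\<And>k. C_k k \<phi>" "compact K" "K \<subseteq> \<Omega>" "\<And>x. x \<notin> K \<Longrightarrow> \<phi> x = 0"
  shows "\<phi> \<in> test_functions \<Omega>"
proof -
  have sub: "closure {x. \<phi> x \<noteq> 0} \<subseteq> K"
    using assms by (intro closure_minimal compact_imp_closed) auto
  then have "compact (closure {x. \<phi> x \<noteq> 0})"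
    using bounded_subset[OF compact_imp_bounded[OF assms(2)] sub] by (simp add: compact_eq_bounded_closed)
  then show ?thesis using assms sub by (auto simp: test_functions_def)
qed

lemma box_bump_test_function:
  assumes "c > 0" "cbox a b \<subseteq> \<Omega>" shows "box_bump c a b \<in> test_functions \<Omega>"
  using assms box_bump_outside[OF assms(1)] box_subset_cbox[of a b]
  by (intro test_functionsI[of _ "cbox a b"] C_k_box_bump compact_cbox) blast+

lemma test_function_props:
  assumes "\<phi> \<in> test_functions \<Omega>"
  shows "C_k k \<phi>"
    and "\<exists>K. compact K \<and> K \<subseteq> \<Omega> \<and> (\<forall>x. x \<notin> K \<longrightarrow> \<phi> x = 0)"
    and "continuous_on UNIV \<phi>"
    and "continuous_on UNIV (\<lambda>x. frechet_derivative \<phi> (at x) b)"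
    and "(\<phi> has_derivative frechet_derivative \<phi> (at x)) (at x)"
proof -
  have C: "C_k k \<phi>" for k using assms by (simp add: test_functions_def)
  show "C_k k \<phi>" by (rule C)
  show "\<exists>K. compact K \<and> K \<subseteq> \<Omega> \<and> (\<forall>x. x \<notin> K \<longrightarrow> \<phi> x = 0)"
    using assms closure_subset[of "{x. \<phi> x \<noteq> 0}"]
    by (intro exI[of _ "closure {x. \<phi> x \<noteq> 0}"]) (auto simp: test_functions_def)
  show "continuous_on UNIV \<phi>" using C[of 0] by simp
  show D: "(\<phi> has_derivative frechet_derivative \<phi> (at x)) (at x)" for x using C_k_SucD[OF C] .
  \<comment> \<open>\<open>C_k\<close> speaks of the basis directions only; the derivative in
    direction b is a fixed linear combination of those.\<close>
  have "continuous_on UNIV (\<lambda>x. \<Sum>i\<in>Basis. (b \<bullet> i) * frechet_derivative \<phi> (at x) i)"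
    using C[of "Suc 0"] by (intro continuous_intros) auto
  also have "(\<lambda>x. \<Sum>i\<in>Basis. (b \<bullet> i) * frechet_derivative \<phi> (at x) i) = (\<lambda>x. frechet_derivative \<phi> (at x) b)"
  proof
    fix x
    interpret linear "frechet_derivative \<phi> (at x)" using has_derivative_linear[OF D] .
    show "(\<Sum>i\<in>Basis. (b \<bullet> i) * frechet_derivative \<phi> (at x) i) = frechet_derivative \<phi> (at x) b"
      by (subst (2) euclidean_representation[of b, symmetric]) (simp add: sum scale)
  qed
  finally show "continuous_on UNIV (\<lambda>x. frechet_derivative \<phi> (at x) b)" .
qed

lemma test_function_derivative_outside:
  assumes "closed K" "\<And>x. x \<notin> K \<Longrightarrow> \<phi> x = 0" "x \<notin> K"
  shows "frechet_derivative \<phi> (at x) b = 0"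
proof -
  have "((\<lambda>x. 0) has_derivative (\<lambda>h. 0)) (at x)" by simp
  then have "(\<phi> has_derivative (\<lambda>h. 0)) (at x)"
    by (rule has_derivative_transform_within_open[of _ _ _ _ "- K"]) (use assms in auto)
  then show ?thesis by (metis frechet_derivative_at)
qed

lemma test_function_translate:
  assumes "\<phi> \<in> test_functions \<Omega>" "compact K" "K \<subseteq> \<Omega>" "\<And>x. \<phi> (x + c) \<noteq> 0 \<Longrightarrow> x \<in> K"
  shows "(\<lambda>x. \<phi> (x + c)) \<in> test_functions \<Omega>"
  using assms test_function_props(1)[OF assms(1)] by (intro test_functionsI[of _ K] C_k_translate) auto

lemma test_function_mult_polynomial:
  assumes "\<phi> \<in> test_functions \<Omega>" "real_polynomial_function p"
  shows "(\<lambda>x. p x * \<phi> x) \<in> test_functions \<Omega>"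
proof -
  obtain K where "compact K" "K \<subseteq> \<Omega>" "\<forall>x. x \<notin> K \<longrightarrow> \<phi> x = 0"
    using test_function_props(2)[OF assms(1)] by blast
  moreover have "C_k k (\<lambda>x. p x * \<phi> x)" for k
    by (intro C_k_mult C_k_real_polynomial_function assms(2) test_function_props(1)[OF assms(1)])
  ultimately show ?thesis
    by (intro test_functionsI[of _ K]) auto
qed

text \<open>Bumps converge boundedly to indicators, so f has integral 0 over every closed box inside
  \<open>\<Omega>\<close>. By Lebesgue differentiation the averages over small cubes at x converge
  to f x outside a negligible set.\<close>

theorem fundamental_lemma_variations:
  fixes f :: "'a::euclidean_space \<Rightarrow> real"
  assumes "open \<Omega>" and int: "integrable (lebesgue_on \<Omega>) f"
    and zero: "\<And>\<phi>. \<phi> \<in> test_functions \<Omega> \<Longrightarrow> (LINT x|lebesgue_on \<Omega>. f x * \<phi> x) = 0"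
  shows "AE x in lebesgue_on \<Omega>. f x = 0"
proof -
  have [measurable]: "\<Omega> \<in> sets lebesgue" using assms(1) by (simp add: borel_open)
  have [measurable]: "f \<in> borel_measurable (lebesgue_on \<Omega>)" using int by auto
  define g where "g x = (if x \<in> \<Omega> then f x else 0)" for x
  have gint: "g absolutely_integrable_on UNIV"
    using int unfolding g_def
    by (subst absolutely_integrable_restrict_UNIV) (simp add: set_integrable_def integrable_restrict_space scaleR_conv_of_real)
  have gcb: "g integrable_on cbox a b" for a b
    using gint by (meson absolutely_integrable_on_def integrable_on_subcbox subset_UNIV)
  have box0: "integral (cbox a b) g = 0" if sub: "cbox a b \<subseteq> \<Omega>" for a b
  proof -
    have lim: "(\<lambda>n. LINT x|lebesgue_on \<Omega>. f x * box_bump (real (Suc n)) a b x) \<longlonglongrightarrow>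
        (LINT x|lebesgue_on \<Omega>. f x * indicator (box a b) x)"
    proof (rule integral_dominated_convergence[where w="\<lambda>x. norm (f x)"])
      show "(\<lambda>x. f x * box_bump (real (Suc n)) a b x) \<in> borel_measurable (lebesgue_on \<Omega>)" for n
      proof -
        have "continuous_on UNIV (box_bump (real (Suc n)) a b)"
          using C_k_box_bump[of 0] by simp
        then have "box_bump (real (Suc n)) a b \<in> borel_measurable (lebesgue_on \<Omega>)"
          by (intro measurable_restrict_space1) (simp add: borel_measurable_continuous_onI measurable_completion)
        then show ?thesis by measurable
      qed
      show "AE x in lebesgue_on \<Omega>. (\<lambda>n. f x * box_bump (real (Suc n)) a b x) \<longlonglongrightarrow> f x * indicator (box a b) x"
        by (intro always_eventually allI tendsto_mult tendsto_const box_bump_tendsto)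
      show "AE x in lebesgue_on \<Omega>. norm (f x * box_bump (real (Suc n)) a b x) \<le> norm (f x)" for n
        by (auto intro!: always_eventually mult_left_le simp: abs_mult box_bump_bounds)
      show "(\<lambda>x. f x * indicator (box a b) x) \<in> borel_measurable (lebesgue_on \<Omega>)"
        by (intro borel_measurable_times borel_measurable_indicator')
           (auto simp: sets_restrict_space_iff Collect_conj_eq)
    qed (use int in auto)
    have "(LINT x|lebesgue_on \<Omega>. f x * indicator (box a b) x) = 0"
      using LIMSEQ_unique[OF lim] zero box_bump_test_function[OF _ sub] by simp
    moreover have "(LINT x|lebesgue_on \<Omega>. f x * indicator (box a b) x) = (LINT x:box a b|lebesgue. g x)"
      unfolding set_lebesgue_integral_def g_def
      by (subst integral_restrict_space) (auto intro!: Bochner_Integration.integral_cong simp: indicator_def)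
    moreover have "set_integrable lebesgue (box a b) g"
      by (rule set_integrable_subset[OF gint]) auto
    ultimately have "integral (box a b) g = 0"
      by (metis set_lebesgue_integral_eq_integral(2))
    then show ?thesis by (simp add: integral_open_interval)
  qed
  obtain N where N: "negligible N" and
    lim: "\<And>x e. x \<notin> N \<Longrightarrow> 0 < e \<Longrightarrow> \<exists>d>0. \<forall>h. 0 < h \<and> h < d \<longrightarrow>
      norm (integral (cbox x (x + h *\<^sub>R One)) g /\<^sub>R h ^ DIM('a) - g x) < e"
    using integrable_ccontinuous_explicit[OF gcb] by blast
  have "f x = 0" if "x \<in> \<Omega>" "x \<notin> N" for x
  proof (rule ccontr)
    assume "f x \<noteq> 0"
    then have e: "0 < \<bar>f x\<bar>" by simp
    obtain d where d: "d > 0" "\<And>h. 0 < h \<Longrightarrow> h < d \<Longrightarrow> norm (integral (cbox x (x + h *\<^sub>R One)) g /\<^sub>R h ^ DIM('a) - g x) < \<bar>f x\<bar>"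
      using lim[OF \<open>x \<notin> N\<close> e] by blast
    obtain r where r: "r > 0" "ball x r \<subseteq> \<Omega>" using \<open>x \<in> \<Omega>\<close> assms(1) open_contains_ball by blast
    \<comment> \<open>Relative to its corner x, a point of the cube of side h has 1-norm at most h
      times the dimension, so the cube stays inside the ball of radius r.\<close>
    define h where "h = min (d/2) (r / (2 * real DIM('a)))"
    have h: "0 < h" "h < d" "h * real DIM('a) < r"
      using d r by (auto simp: h_def min_def field_simps)
    have "cbox x (x + h *\<^sub>R One) \<subseteq> ball x r"
    proof
      fix y assume y: "y \<in> cbox x (x + h *\<^sub>R One)"
      have "norm (y - x) \<le> (\<Sum>i\<in>Basis. \<bar>(y - x) \<bullet> i\<bar>)" by (rule norm_le_l1)
      also have "\<dots> \<le> (\<Sum>i\<in>(Basis::'a set). h)"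
        using y by (intro sum_mono) (auto simp: mem_box inner_diff_left inner_add_left)
      also have "\<dots> < r" using h(3) by (simp add: mult.commute)
      finally show "y \<in> ball x r" by (simp add: dist_norm norm_minus_commute)
    qed
    then show False using d(2)[OF h(1,2)] box0 r(2) \<open>x \<in> \<Omega>\<close> \<open>f x \<noteq> 0\<close> by (simp add: g_def)
  qed
  then have "{x \<in> \<Omega>. f x \<noteq> 0} \<subseteq> N" by auto
  moreover have "N \<in> null_sets lebesgue" using N by (simp add: negligible_iff_null_sets)
  ultimately have "AE x in lebesgue. x \<in> \<Omega> \<longrightarrow> f x = 0"
    by (intro AE_I'[of N]) auto
  then show ?thesis by (simp add: AE_restrict_space_iff)
qed

section \<open>Weak gradients on bounded open sets\<close>

locale bounded_domain =
  fixes \<Omega> :: "'a::euclidean_space set"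
  assumes open_domain: "open \<Omega>" and bounded_domain: "bounded \<Omega>"
begin

lemma domain_lebesgue [measurable]: "\<Omega> \<in> sets lebesgue"
  using open_domain by (simp add: borel_open)

lemma finite_measure_domain: "finite_measure (lebesgue_on \<Omega>)"
  using lmeasurable_open[OF bounded_domain open_domain] finite_measure_lebesgue_on by blast

text \<open>This is the square root of the measure of \<open>\<Omega>\<close>: the factor by which a
  sup bound turns into an L2 bound.\<close>

definition vol :: real where "vol = L2_norm \<Omega> (\<lambda>x. 1::real)"

lemma vol_nonneg [simp]: "0 \<le> vol" by (simp add: vol_def)

lemma L2_const [simp, intro]: "(\<lambda>x. c :: 'b::euclidean_space) \<in> L2 \<Omega>"
  using finite_measure.integrable_const[OF finite_measure_domain] by (simp add: L2_def)

lemma L2_norm_const: "L2_norm \<Omega> (\<lambda>x. c :: real) = \<bar>c\<bar> * vol"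
  using L2_norm_scaleR[of \<Omega> c "\<lambda>x. 1::real"] by (simp add: vol_def)

lemma L2_bounded:
  fixes u :: "'a \<Rightarrow> real"
  assumes "u \<in> borel_measurable (lebesgue_on \<Omega>)" "\<And>x. x \<in> \<Omega> \<Longrightarrow> \<bar>u x\<bar> \<le> C"
  shows "u \<in> L2 \<Omega>" "L2_norm \<Omega> u \<le> \<bar>C\<bar> * vol"
proof -
  have AE: "AE x in lebesgue_on \<Omega>. norm (u x) \<le> norm C"
    using assms(2) by (intro AE_I2) (force simp: abs_le_iff)
  show u: "u \<in> L2 \<Omega>" by (rule L2_bound[OF L2_const assms(1) AE])
  show "L2_norm \<Omega> u \<le> \<bar>C\<bar> * vol"
    using L2_norm_mono_AE[OF u L2_const AE] by (simp add: L2_norm_const)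
qed

lemma L2_integrable:
  assumes "u \<in> L2 \<Omega>" shows "integrable (lebesgue_on \<Omega>) u"
proof (rule Bochner_Integration.integrable_bound)
  show "integrable (lebesgue_on \<Omega>) (\<lambda>x. 1 + (norm (u x))\<^sup>2)"
    by (intro Bochner_Integration.integrable_add finite_measure.integrable_const[OF finite_measure_domain]
        L2_integrable_norm_sq[OF assms])
  show "u \<in> borel_measurable (lebesgue_on \<Omega>)" using assms by (rule L2_measurable)
  have "norm (u x) \<le> norm (1 + (norm (u x))\<^sup>2)" for x
  proof -
    have "norm (u x) \<le> 1 + (norm (u x))\<^sup>2"
      using sum_squares_bound[of 1 "norm (u x)"] norm_ge_zero[of "u x"] unfolding one_power2 by linarith
    then show ?thesis by simp
  qed
  then show "AE x in lebesgue_on \<Omega>. norm (u x) \<le> norm (1 + (norm (u x))\<^sup>2)" by simp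
qed

lemma continuous_measurable:
  fixes u :: "'a \<Rightarrow> 'b::euclidean_space"
  assumes "continuous_on \<Omega> u" shows "u \<in> borel_measurable (lebesgue_on \<Omega>)"
  using assms by (rule continuous_imp_measurable_on_sets_lebesgue) simp

lemma L2_mult_bounded:
  fixes u :: "'a \<Rightarrow> 'b::euclidean_space"
  assumes "u \<in> L2 \<Omega>" "f \<in> borel_measurable (lebesgue_on \<Omega>)" "\<And>x. x \<in> \<Omega> \<Longrightarrow> \<bar>f x\<bar> \<le> C"
  shows "(\<lambda>x. f x *\<^sub>R u x) \<in> L2 \<Omega>" "L2_norm \<Omega> (\<lambda>x. f x *\<^sub>R u x) \<le> \<bar>C\<bar> * L2_norm \<Omega> u"
proof -
  note [measurable] = assms(2) L2_measurable[OF assms(1)]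
  have AE: "AE x in lebesgue_on \<Omega>. norm (f x *\<^sub>R u x) \<le> norm (C *\<^sub>R u x)"
    using assms(3) by (intro AE_I2) (force intro!: mult_right_mono)
  show u: "(\<lambda>x. f x *\<^sub>R u x) \<in> L2 \<Omega>" by (rule L2_bound[OF L2_scaleR[OF assms(1)] _ AE]) measurable
  show "L2_norm \<Omega> (\<lambda>x. f x *\<^sub>R u x) \<le> \<bar>C\<bar> * L2_norm \<Omega> u"
    using L2_norm_mono_AE[OF u L2_scaleR[OF assms(1)] AE] by (simp add: L2_norm_scaleR)
qed

lemma compactly_supported_bounded:
  fixes f :: "'a \<Rightarrow> real"
  assumes "continuous_on UNIV f" "compact K" "\<And>x. x \<notin> K \<Longrightarrow> f x = 0"
  shows "\<exists>B\<ge>0. \<forall>x. \<bar>f x\<bar> \<le> B"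
proof -
  have "compact (f ` K)" using assms by (intro compact_continuous_image continuous_on_subset[OF assms(1)]) auto
  then obtain B where B: "\<And>x. x \<in> K \<Longrightarrow> \<bar>f x\<bar> \<le> B"
    using compact_imp_bounded by (metis bounded_iff image_eqI real_norm_def)
  then show ?thesis using assms(3) by (intro exI[of _ "max 0 B"]) (metis abs_zero le_max_iff_disj order_refl)
qed

lemma test_function_bounded:
  fixes S :: "'a set"
  assumes "\<phi> \<in> test_functions S"
  shows "\<exists>B\<ge>0. \<forall>x. \<bar>\<phi> x\<bar> \<le> B" "\<exists>B\<ge>0. \<forall>x. \<bar>frechet_derivative \<phi> (at x) b\<bar> \<le> B"
proof -
  obtain K where K: "compact K" "\<And>x. x \<notin> K \<Longrightarrow> \<phi> x = 0"
    using test_function_props(2)[OF assms] by blast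
  show "\<exists>B\<ge>0. \<forall>x. \<bar>\<phi> x\<bar> \<le> B"
    by (rule compactly_supported_bounded[OF test_function_props(3)[OF assms] K(1)]) (rule K(2))
  show "\<exists>B\<ge>0. \<forall>x. \<bar>frechet_derivative \<phi> (at x) b\<bar> \<le> B"
    by (rule compactly_supported_bounded[OF test_function_props(4)[OF assms] K(1)],
        rule test_function_derivative_outside[OF compact_imp_closed[OF K(1)]]) (use K(2) in auto)
qed

lemma continuous_bounded_L2:
  fixes f :: "'a \<Rightarrow> real"
  assumes "continuous_on UNIV f" "\<exists>B\<ge>0. \<forall>x. \<bar>f x\<bar> \<le> B"
  shows "f \<in> L2 \<Omega>"
  using assms by (auto intro!: L2_bounded(1) continuous_measurable continuous_on_subset[OF assms(1)])

lemma test_function_L2: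
  fixes S :: "'a set"
  assumes "\<phi> \<in> test_functions S"
  shows "\<phi> \<in> L2 \<Omega>" "(\<lambda>x. frechet_derivative \<phi> (at x) b) \<in> L2 \<Omega>"
  using assms by (auto intro!: continuous_bounded_L2 test_function_bounded test_function_props)

lemma L2_component: "g \<in> L2 \<Omega> \<Longrightarrow> b \<in> Basis \<Longrightarrow> (\<lambda>x. g x \<bullet> b) \<in> L2 \<Omega>"
  by (rule L2_bound) (auto intro!: borel_measurable_inner L2_measurable AE_I2 Basis_le_norm)

lemma L2_norm_component_le:
  "g \<in> L2 \<Omega> \<Longrightarrow> b \<in> Basis \<Longrightarrow> L2_norm \<Omega> (\<lambda>x. g x \<bullet> b) \<le> L2_norm \<Omega> g"
  by (intro L2_norm_mono_AE L2_component) (auto intro!: Basis_le_norm)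

lemma is_weak_gradient_iff:
  "is_weak_gradient \<Omega> u g \<longleftrightarrow> (\<forall>\<phi>\<in>test_functions \<Omega>. \<forall>b\<in>Basis.
     L2_inner \<Omega> u (\<lambda>x. frechet_derivative \<phi> (at x) b) = - L2_inner \<Omega> (\<lambda>x. g x \<bullet> b) \<phi>)"
  by (simp add: is_weak_gradient_def L2_inner_def)

lemma is_weak_gradient_unique:
  assumes "g \<in> L2 \<Omega>" "h \<in> L2 \<Omega>" "is_weak_gradient \<Omega> u g" "is_weak_gradient \<Omega> u h"
  shows "AE x in lebesgue_on \<Omega>. g x = h x"
proof -
  have "AE x in lebesgue_on \<Omega>. g x \<bullet> b - h x \<bullet> b = 0" if b: "b \<in> Basis" for b
  proof (rule fundamental_lemma_variations[OF open_domain])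
    have L: "(\<lambda>x. g x \<bullet> b) \<in> L2 \<Omega>" "(\<lambda>x. h x \<bullet> b) \<in> L2 \<Omega>" using assms b by (auto intro: L2_component)
    then show "integrable (lebesgue_on \<Omega>) (\<lambda>x. g x \<bullet> b - h x \<bullet> b)" by (intro L2_integrable) auto
    fix \<phi> assume \<phi>: "\<phi> \<in> test_functions \<Omega>"
    have "L2_inner \<Omega> (\<lambda>x. g x \<bullet> b - h x \<bullet> b) \<phi> = 0"
      using assms(3,4) \<phi> b L test_function_L2(1)[OF \<phi>] by (simp add: L2_inner_simps is_weak_gradient_iff)
    then show "(LINT x|lebesgue_on \<Omega>. (g x \<bullet> b - h x \<bullet> b) * \<phi> x) = 0" by (simp add: L2_inner_def)
  qed
  then have "AE x in lebesgue_on \<Omega>. \<forall>b\<in>Basis. g x \<bullet> b - h x \<bullet> b = 0"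
    by (intro AE_finite_allI) auto
  then show ?thesis by eventually_elim (auto intro: euclidean_eqI)
qed

lemma is_weak_gradient_lincomb:
  assumes "u \<in> L2 \<Omega>" "v \<in> L2 \<Omega>" "g \<in> L2 \<Omega>" "h \<in> L2 \<Omega>" "is_weak_gradient \<Omega> u g" "is_weak_gradient \<Omega> v h"
  shows "is_weak_gradient \<Omega> (\<lambda>x. c * u x + d * v x) (\<lambda>x. c *\<^sub>R g x + d *\<^sub>R h x)"
  using assms unfolding is_weak_gradient_iff
  by (simp add: inner_add_left L2_inner_simps L2_component test_function_L2)

lemma weak_gradient_L2 [simp, intro]: "u \<in> H1 \<Omega> \<Longrightarrow> weak_gradient \<Omega> u \<in> L2 \<Omega>"
  and is_weak_gradient_weak_gradient: "u \<in> H1 \<Omega> \<Longrightarrow> is_weak_gradient \<Omega> u (weak_gradient \<Omega> u)"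
  using someI_ex[of "\<lambda>g. g \<in> L2 \<Omega> \<and> is_weak_gradient \<Omega> u g"]
  by (auto simp: H1_def weak_gradient_def)

lemma H1_L2 [simp, intro]: "u \<in> H1 \<Omega> \<Longrightarrow> u \<in> L2 \<Omega>"
  by (simp add: H1_def)

text \<open>\<open>weak_gradient\<close> is picked by Hilbert choice, so its values can be known
  almost everywhere at best. Every concrete gradient enters through this lemma, and gradient
  identities below are stated almost everywhere.\<close>

lemma weak_gradient_eqI:
  assumes "u \<in> L2 \<Omega>" "g \<in> L2 \<Omega>" "is_weak_gradient \<Omega> u g"
  shows "u \<in> H1 \<Omega>" "AE x in lebesgue_on \<Omega>. weak_gradient \<Omega> u x = g x"
proof -
  show "u \<in> H1 \<Omega>" unfolding H1_def using assms by blast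
  then show "AE x in lebesgue_on \<Omega>. weak_gradient \<Omega> u x = g x"
    by (intro is_weak_gradient_unique[of _ _ u] weak_gradient_L2 is_weak_gradient_weak_gradient assms(2,3))
qed

lemma
  assumes "u \<in> H1 \<Omega>" "v \<in> H1 \<Omega>"
  shows H1_lincomb: "(\<lambda>x. c * u x + d * v x) \<in> H1 \<Omega>"
    and weak_gradient_lincomb: "AE x in lebesgue_on \<Omega>. weak_gradient \<Omega> (\<lambda>x. c * u x + d * v x) x
        = c *\<^sub>R weak_gradient \<Omega> u x + d *\<^sub>R weak_gradient \<Omega> v x"
proof -
  let ?g = "\<lambda>x. c *\<^sub>R weak_gradient \<Omega> u x + d *\<^sub>R weak_gradient \<Omega> v x"
  have "is_weak_gradient \<Omega> (\<lambda>x. c * u x + d * v x) ?g"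
    using assms by (intro is_weak_gradient_lincomb is_weak_gradient_weak_gradient) auto
  moreover have "(\<lambda>x. c * u x + d * v x) \<in> L2 \<Omega>" "?g \<in> L2 \<Omega>" using assms by auto
  ultimately show "(\<lambda>x. c * u x + d * v x) \<in> H1 \<Omega>"
      "AE x in lebesgue_on \<Omega>. weak_gradient \<Omega> (\<lambda>x. c * u x + d * v x) x = ?g x"
    using weak_gradient_eqI by blast+
qed

lemma H1_diff [simp, intro]: "u \<in> H1 \<Omega> \<Longrightarrow> v \<in> H1 \<Omega> \<Longrightarrow> (\<lambda>x. u x - v x) \<in> H1 \<Omega>"
  using H1_lincomb[of u v 1 "-1"] by simp

lemma weak_gradient_diff:
  "u \<in> H1 \<Omega> \<Longrightarrow> v \<in> H1 \<Omega> \<Longrightarrow>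
   AE x in lebesgue_on \<Omega>. weak_gradient \<Omega> (\<lambda>x. u x - v x) x = weak_gradient \<Omega> u x - weak_gradient \<Omega> v x"
  using weak_gradient_lincomb[of u v 1 "-1"] by simp

lemma L2_norm_weak_gradient_diff:
  assumes "u \<in> H1 \<Omega>" "v \<in> H1 \<Omega>"
  shows "L2_norm \<Omega> (weak_gradient \<Omega> (\<lambda>x. u x - v x)) = L2_norm \<Omega> (\<lambda>x. weak_gradient \<Omega> u x - weak_gradient \<Omega> v x)"
  using assms by (intro L2_norm_cong_AE weak_gradient_diff) (auto intro!: L2_measurable)

text \<open>For a fixed test function and direction both sides of the defining identity are L2 inner
  products, hence continuous in the function and in the gradient.\<close>

lemma is_weak_gradient_limit:
  assumes "\<And>k. s k \<in> H1 \<Omega>" "u \<in> L2 \<Omega>" "g \<in> L2 \<Omega>"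
    "(\<lambda>k. L2_norm \<Omega> (\<lambda>x. s k x - u x)) \<longlonglongrightarrow> 0"
    "(\<lambda>k. L2_norm \<Omega> (\<lambda>x. weak_gradient \<Omega> (s k) x - g x)) \<longlonglongrightarrow> 0"
  shows "is_weak_gradient \<Omega> u g"
  unfolding is_weak_gradient_iff
proof (intro ballI)
  fix \<phi> and b :: 'a assume \<phi>: "\<phi> \<in> test_functions \<Omega>" and b: "b \<in> Basis"
  have c0: "(\<lambda>k. L2_norm \<Omega> (\<lambda>x. f x - f x)) \<longlonglongrightarrow> 0" for f :: "'a \<Rightarrow> real"
    by (simp add: L2_norm_def)
  have "(\<lambda>k. L2_norm \<Omega> (\<lambda>x. weak_gradient \<Omega> (s k) x \<bullet> b - g x \<bullet> b)) \<longlonglongrightarrow> 0"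
    using L2_norm_component_le[of "\<lambda>x. weak_gradient \<Omega> (s k) x - g x" b for k] assms b
    by (intro Lim_null_comparison[OF _ assms(5)]) (auto simp: inner_diff_left)
  then have 1: "(\<lambda>k. L2_inner \<Omega> (\<lambda>x. weak_gradient \<Omega> (s k) x \<bullet> b) \<phi>) \<longlonglongrightarrow> L2_inner \<Omega> (\<lambda>x. g x \<bullet> b) \<phi>"
    by (intro L2_inner_tendsto[OF _ _ _ _ _ c0]) (use assms b in \<open>auto intro!: L2_component test_function_L2[OF \<phi>]\<close>)
  have 2: "(\<lambda>k. L2_inner \<Omega> (s k) (\<lambda>x. frechet_derivative \<phi> (at x) b))
      \<longlonglongrightarrow> L2_inner \<Omega> u (\<lambda>x. frechet_derivative \<phi> (at x) b)"
    by (rule L2_inner_tendsto[OF _ _ _ _ _ c0]) (use assms b in \<open>auto intro!: test_function_L2[OF \<phi>]\<close>)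
  have 3: "L2_inner \<Omega> (s k) (\<lambda>x. frechet_derivative \<phi> (at x) b) = - L2_inner \<Omega> (\<lambda>x. weak_gradient \<Omega> (s k) x \<bullet> b) \<phi>" for k
    using is_weak_gradient_weak_gradient[OF assms(1)] \<phi> b by (simp add: is_weak_gradient_iff)
  show "L2_inner \<Omega> u (\<lambda>x. frechet_derivative \<phi> (at x) b) = - L2_inner \<Omega> (\<lambda>x. g x \<bullet> b) \<phi>"
    using LIMSEQ_unique[OF 2[unfolded 3] tendsto_minus[OF 1]] .
qed

text \<open>The functions and their gradients have separate limits in L2; closedness of the weak
  gradient ties the two limits together.\<close>

lemma H1_complete:
  assumes s: "\<And>k. s k \<in> H1 \<Omega>"
    and "\<And>e. e > 0 \<Longrightarrow> \<exists>M. \<forall>m\<ge>M. \<forall>n\<ge>M. L2_norm \<Omega> (\<lambda>x. s m x - s n x) < e"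
    and "\<And>e. e > 0 \<Longrightarrow> \<exists>M. \<forall>m\<ge>M. \<forall>n\<ge>M. L2_norm \<Omega> (weak_gradient \<Omega> (\<lambda>x. s m x - s n x)) < e"
  obtains u where "u \<in> H1 \<Omega>" "(\<lambda>k. L2_norm \<Omega> (\<lambda>x. s k x - u x)) \<longlonglongrightarrow> 0"
    "(\<lambda>k. L2_norm \<Omega> (weak_gradient \<Omega> (\<lambda>x. s k x - u x))) \<longlonglongrightarrow> 0"
proof -
  obtain u where u: "u \<in> L2 \<Omega>" "(\<lambda>k. L2_norm \<Omega> (\<lambda>x. s k x - u x)) \<longlonglongrightarrow> 0"
    using L2_complete[of s, OF H1_L2[OF s] assms(2)] by blast
  obtain g where g: "g \<in> L2 \<Omega>" "(\<lambda>k. L2_norm \<Omega> (\<lambda>x. weak_gradient \<Omega> (s k) x - g x)) \<longlonglongrightarrow> 0"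
    using L2_complete[of "\<lambda>k. weak_gradient \<Omega> (s k)" \<Omega>] assms(3) s
    by (auto simp: L2_norm_weak_gradient_diff)
  have wg: "is_weak_gradient \<Omega> u g" by (rule is_weak_gradient_limit[OF s u(1) g(1) u(2) g(2)])
  note uH = weak_gradient_eqI[OF u(1) g(1) wg]
  have "L2_norm \<Omega> (weak_gradient \<Omega> (\<lambda>x. s k x - u x)) = L2_norm \<Omega> (\<lambda>x. weak_gradient \<Omega> (s k) x - g x)" for k
    unfolding L2_norm_weak_gradient_diff[OF s uH(1)]
    by (rule L2_norm_cong_AE) (use uH s g in \<open>auto intro!: L2_measurable elim!: eventually_mono\<close>)
  then show thesis using that[OF uH(1) u(2)] g(2) by simp
qed

end

section \<open>The chain rule for continuous Sobolev functions\<close>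

lemma lborel_integral_shift:
  fixes f :: "'a::euclidean_space \<Rightarrow> real"
  assumes "f \<in> borel_measurable borel"
  shows "(LINT x|lborel. f (x - c)) = (LINT x|lborel. f x)"
proof -
  have "(LINT x|lborel. f x) = (LINT x|distr lborel borel ((+) (- c)). f x)"
    by (simp add: lborel_distr_plus)
  also have "\<dots> = (LINT x|lborel. f (- c + x))"
    using assms by (subst integral_distr) auto
  finally show ?thesis by simp
qed

text \<open>In the chain rule this is instantiated both with u and with F o u. Of the latter no weak
  gradient is known yet, hence a gradient is added only in the extension
  \<open>gradient_setup\<close>. The margin \<open>\<delta>\<close> keeps translates of
  \<open>K\<close> inside \<open>\<Omega>\<close>.\<close>

locale shift_setup = bounded_domain \<Omega> for \<Omega> :: "'a::euclidean_space set" +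
  fixes K :: "'a set" and \<delta> :: real and b :: 'a and u :: "'a \<Rightarrow> real"
  assumes compact_K: "compact K" and delta_pos: "\<delta> > 0"
    and cball_K: "\<And>x. x \<in> K \<Longrightarrow> cball x \<delta> \<subseteq> \<Omega>"
    and b_Basis: "b \<in> Basis"
    and cont_u: "continuous_on \<Omega> u" and u_L2: "u \<in> L2 \<Omega>"
begin

lemma shift_in_domain: "x \<in> K \<Longrightarrow> \<bar>h\<bar> \<le> \<delta> \<Longrightarrow> x + h *\<^sub>R b \<in> \<Omega>"
  using cball_K[of x] b_Basis by (auto simp: subset_iff dist_norm)

lemma K_subset: "K \<subseteq> \<Omega>"
  using shift_in_domain[of _ 0] delta_pos by auto

text \<open>The values of \<open>u\<close> outside \<open>\<Omega>\<close> are arbitrary. Setting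
  the function to 0 outside the compact set \<open>K\<close> makes it bounded and Borel on the whole
  space for shifts up to \<open>\<delta>\<close>; it is paired only with functions that vanish
  outside \<open>K\<close>.\<close>

definition shifted :: "real \<Rightarrow> 'a \<Rightarrow> real" where
  "shifted h x = (if x \<in> K then u (x + h *\<^sub>R b) else 0)"

definition increment :: "real \<Rightarrow> 'a \<Rightarrow> real" where
  "increment h x = shifted h x - shifted 0 x"

lemma continuous_on_shifted: "\<bar>h\<bar> \<le> \<delta> \<Longrightarrow> continuous_on K (\<lambda>x. u (x + h *\<^sub>R b))"
  by (rule continuous_on_compose2[OF cont_u]) (auto intro!: continuous_intros shift_in_domain)

lemma shifted_borel: "\<bar>h\<bar> \<le> \<delta> \<Longrightarrow> shifted h \<in> borel_measurable borel"
  unfolding shifted_def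
  by (rule borel_measurable_continuous_on_if[of K, where g="\<lambda>x. 0"])
     (use continuous_on_shifted compact_K in \<open>auto simp: compact_imp_closed\<close>)

lemma shifted_L2: assumes "\<bar>h\<bar> \<le> \<delta>" shows "shifted h \<in> L2 \<Omega>"
proof -
  have "compact ((\<lambda>x. u (x + h *\<^sub>R b)) ` K)"
    using continuous_on_shifted[OF assms] compact_K by (rule compact_continuous_image)
  then obtain B where "\<And>x. x \<in> K \<Longrightarrow> \<bar>u (x + h *\<^sub>R b)\<bar> \<le> B"
    using compact_imp_bounded by (metis bounded_iff image_eqI real_norm_def)
  then have "\<bar>shifted h x\<bar> \<le> max 0 B" for x by (auto simp: shifted_def le_max_iff_disj)
  moreover have "shifted h \<in> borel_measurable (lebesgue_on \<Omega>)"
    using shifted_borel[OF assms] by (intro measurable_restrict_space1 measurable_completion) simp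
  ultimately show ?thesis by (intro L2_bounded(1)) auto
qed

lemma increment_L2: "\<bar>h\<bar> \<le> \<delta> \<Longrightarrow> increment h \<in> L2 \<Omega>"
  unfolding increment_def[abs_def] using shifted_L2[of h] shifted_L2[of 0] delta_pos by auto

text \<open>\<open>K\<close> and its translate by t b both lie in \<open>\<Omega>\<close>, so either
  integral may be taken over the whole space; Borel measurability of f then gives access to the
  translation invariance of \<open>lborel\<close>.\<close>

lemma integral_shift:
  fixes f :: "'a \<Rightarrow> real"
  assumes f: "f \<in> borel_measurable borel" and "\<And>x. x \<notin> K \<Longrightarrow> f x = 0" and t: "\<bar>t\<bar> \<le> \<delta>"
  shows "(LINT x|lebesgue_on \<Omega>. f (x - t *\<^sub>R b)) = (LINT x|lebesgue_on \<Omega>. f x)"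
proof -
  have zero: "f (x - t *\<^sub>R b) = 0" if "x \<notin> \<Omega>" for x
  proof -
    have "x - t *\<^sub>R b \<notin> K" using shift_in_domain[of "x - t *\<^sub>R b" t] t that by auto
    then show ?thesis using assms(2) by simp
  qed
  have "(LINT x|lebesgue_on \<Omega>. f (x - t *\<^sub>R b)) = (LINT x|lebesgue. f (x - t *\<^sub>R b))"
    using zero by (subst integral_restrict_space) (auto intro!: Bochner_Integration.integral_cong simp: indicator_def)
  also have "\<dots> = (LINT x|lborel. f (x - t *\<^sub>R b))"
    using measurable_compose[of "\<lambda>x. x - t *\<^sub>R b" borel borel f] f
    by (intro integral_completion) simp
  also have "\<dots> = (LINT x|lborel. f x)" by (rule lborel_integral_shift[OF f])
  also have "\<dots> = (LINT x|lebesgue. f x)"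
    using f by (intro integral_completion[symmetric]) simp
  also have "\<dots> = (LINT x|lebesgue_on \<Omega>. f x)"
    using assms(2) subsetD[OF K_subset]
    by (subst integral_restrict_space) (force intro!: Bochner_Integration.integral_cong simp: indicator_def)+
  finally show ?thesis .
qed

definition tests :: "('a \<Rightarrow> real) set" where
  "tests = {\<psi> \<in> test_functions \<Omega>. \<forall>x. x \<notin> K \<longrightarrow> \<psi> x = 0}"

lemma testsD:
  assumes "\<psi> \<in> tests"
  shows "\<psi> \<in> test_functions \<Omega>" "\<And>x. x \<notin> K \<Longrightarrow> \<psi> x = 0" "\<psi> \<in> borel_measurable borel" "\<psi> \<in> L2 \<Omega>"
  using assms test_function_props(3)[of \<psi> \<Omega>]
  by (auto simp: tests_def borel_measurable_continuous_onI test_function_L2)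

lemma tests_shift:
  assumes "\<psi> \<in> tests" "\<bar>t\<bar> \<le> \<delta>"
  shows "(\<lambda>x. \<psi> (x - t *\<^sub>R b)) \<in> test_functions \<Omega>"
proof -
  have "(\<lambda>x. \<psi> (x + (- t *\<^sub>R b))) \<in> test_functions \<Omega>"
  proof (rule test_function_translate)
    show "compact ((\<lambda>x. x + t *\<^sub>R b) ` K)"
      using compact_K by (intro compact_continuous_image continuous_intros)
    show "(\<lambda>x. x + t *\<^sub>R b) ` K \<subseteq> \<Omega>" using shift_in_domain assms(2) by auto
    fix x assume "\<psi> (x + - t *\<^sub>R b) \<noteq> 0"
    then have "x - t *\<^sub>R b \<in> K" using testsD(2)[OF assms(1)] by auto
    then show "x \<in> (\<lambda>x. x + t *\<^sub>R b) ` K" by (auto intro!: image_eqI[of _ _ "x - t *\<^sub>R b"])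
  qed (use testsD[OF assms(1)] in auto)
  then show ?thesis by simp
qed

text \<open>Moves the translation from u, which has no classical derivative, to the smooth factor,
  so that the pairing can be differentiated in t.\<close>

lemma L2_inner_shift:
  assumes "\<psi> \<in> tests" "\<bar>t\<bar> \<le> \<delta>"
  shows "L2_inner \<Omega> u (\<lambda>x. \<psi> (x - t *\<^sub>R b)) = L2_inner \<Omega> (shifted t) \<psi>"
proof -
  have "(LINT x|lebesgue_on \<Omega>. shifted t (x - t *\<^sub>R b) * \<psi> (x - t *\<^sub>R b)) = (LINT x|lebesgue_on \<Omega>. shifted t x * \<psi> x)"
    using shifted_borel[OF assms(2)] testsD(2,3)[OF assms(1)] assms(2)
    by (intro integral_shift[where f="\<lambda>x. shifted t x * \<psi> x"]) auto
  moreover have "shifted t (x - t *\<^sub>R b) * \<psi> (x - t *\<^sub>R b) = u x * \<psi> (x - t *\<^sub>R b)" for x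
    using testsD(2)[OF assms(1)] by (auto simp: shifted_def)
  ultimately show ?thesis by (simp add: L2_inner_def)
qed

lemma L2_norm_shift:
  assumes "\<psi> \<in> tests" "\<bar>t\<bar> \<le> \<delta>"
  shows "L2_norm \<Omega> (\<lambda>x. \<psi> (x - t *\<^sub>R b)) = L2_norm \<Omega> \<psi>"
  unfolding L2_norm_def
  using testsD(2,3)[OF assms(1)] assms(2)
  by (intro arg_cong[where f=sqrt] integral_shift[where f="\<lambda>x. (norm (\<psi> x))\<^sup>2"]) auto

lemma test_function_direction_derivative:
  assumes \<psi>: "\<psi> \<in> test_functions \<Omega>"
  shows "((\<lambda>r. \<psi> (y + r *\<^sub>R b)) has_real_derivative frechet_derivative \<psi> (at (y + r *\<^sub>R b)) b) (at r)"
proof -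
  have "((\<lambda>r. \<psi> (y + r *\<^sub>R b)) has_derivative (\<lambda>h. frechet_derivative \<psi> (at (y + r *\<^sub>R b)) (h *\<^sub>R b))) (at r)"
    by (rule has_derivative_compose[OF _ test_function_props(5)[OF \<psi>]]) (auto intro!: derivative_eq_intros)
  moreover have "linear (frechet_derivative \<psi> (at (y + r *\<^sub>R b)))"
    using has_derivative_linear[OF test_function_props(5)[OF \<psi>]] .
  ultimately show ?thesis by (simp add: linear_cmul has_field_derivative_def mult.commute[of _ "frechet_derivative \<psi> (at (y + r *\<^sub>R b)) b"])
qed

lemma test_function_increment_bound:
  assumes \<psi>: "\<psi> \<in> test_functions \<Omega>" and B: "\<And>x. \<bar>frechet_derivative \<psi> (at x) b\<bar> \<le> B"
  shows "\<bar>\<psi> (y + s *\<^sub>R b) - \<psi> y\<bar> \<le> B * \<bar>s\<bar>"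
proof -
  have "norm (\<psi> (y + s *\<^sub>R b) - \<psi> (y + 0 *\<^sub>R b)) \<le> B * norm (s - 0)"
    using B test_function_direction_derivative[OF \<psi>]
    by (intro field_differentiable_bound[of UNIV "\<lambda>r. \<psi> (y + r *\<^sub>R b)" "\<lambda>r. frechet_derivative \<psi> (at (y + r *\<^sub>R b)) b"])
       (auto intro: has_field_derivative_at_within)
  then show ?thesis by simp
qed

lemma frechet_derivative_shift:
  assumes \<psi>: "\<psi> \<in> test_functions \<Omega>"
  shows "frechet_derivative (\<lambda>x. \<psi> (x - c)) (at x) = frechet_derivative \<psi> (at (x - c))"
proof -
  have "((\<lambda>x. \<psi> (x - c)) has_derivative frechet_derivative \<psi> (at (x - c))) (at x)"
    using has_derivative_compose[OF has_derivative_diff[OF has_derivative_ident has_derivative_const[of c]]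
        test_function_props(5)[OF \<psi>], of x UNIV] by simp
  then show ?thesis by (metis frechet_derivative_at)
qed

text \<open>Once the translation acts on the test function this is differentiation under the
  integral; the mean value bound for the test function gives the integrable majorant |u| B.\<close>

lemma shift_pairing_derivative:
  assumes \<psi>: "\<psi> \<in> tests" and t: "\<bar>t\<bar> < \<delta>"
  shows "((\<lambda>t. L2_inner \<Omega> (shifted t) \<psi>) has_real_derivative
     - L2_inner \<Omega> u (\<lambda>x. frechet_derivative \<psi> (at (x - t *\<^sub>R b)) b)) (at t)"
proof -
  note T = testsD(1)[OF \<psi>]
  obtain B where B: "B \<ge> 0" "\<And>x. \<bar>frechet_derivative \<psi> (at x) b\<bar> \<le> B"
    using test_function_bounded(2)[OF T] by blast
  have meas: "(\<lambda>x. f (x - c)) \<in> borel_measurable (lebesgue_on \<Omega>)" if "continuous_on UNIV f" for f :: "'a \<Rightarrow> real" and c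
    by (rule continuous_measurable) (auto intro!: continuous_on_compose2[OF that] continuous_intros)
  have L2s: "(\<lambda>x. \<psi> (x - c)) \<in> L2 \<Omega>" for c
    using test_function_bounded(1)[OF T] meas[OF test_function_props(3)[OF T]] by (blast intro: L2_bounded(1))
  define a where "a t = L2_inner \<Omega> u (\<lambda>x. \<psi> (x - t *\<^sub>R b))" for t
  have "((\<lambda>s. (a (t + s) - a t) / s) \<longlongrightarrow> - L2_inner \<Omega> u (\<lambda>x. frechet_derivative \<psi> (at (x - t *\<^sub>R b)) b)) (at 0)"
    unfolding tendsto_at_iff_sequentially o_def
  proof (intro allI impI)
    fix s :: "nat \<Rightarrow> real" assume s: "\<forall>i. s i \<in> UNIV - {0}" "s \<longlonglongrightarrow> 0"
    have s': "filterlim s (at 0) sequentially" using s by (simp add: filterlim_at)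
    have eq: "(a (t + s i) - a t) / s i =
        (LINT x|lebesgue_on \<Omega>. u x * ((\<psi> (x - (t + s i) *\<^sub>R b) - \<psi> (x - t *\<^sub>R b)) / s i))" for i
    proof -
      have "a (t + s i) - a t = L2_inner \<Omega> u (\<lambda>x. \<psi> (x - (t + s i) *\<^sub>R b) - \<psi> (x - t *\<^sub>R b))"
        unfolding a_def using u_L2 L2s by (simp add: L2_inner_simps)
      then have "(a (t + s i) - a t) / s i = L2_inner \<Omega> u (\<lambda>x. inverse (s i) * (\<psi> (x - (t + s i) *\<^sub>R b) - \<psi> (x - t *\<^sub>R b)))"
        by (subst L2_inner_cmult_right) (simp add: field_simps)
      then show ?thesis by (simp add: L2_inner_def field_simps)
    qed
    have "(\<lambda>i. LINT x|lebesgue_on \<Omega>. u x * ((\<psi> (x - (t + s i) *\<^sub>R b) - \<psi> (x - t *\<^sub>R b)) / s i)) \<longlonglongrightarrow>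
        (LINT x|lebesgue_on \<Omega>. u x * - frechet_derivative \<psi> (at (x - t *\<^sub>R b)) b)"
    proof (rule integral_dominated_convergence[where w="\<lambda>x. norm (u x) * B"])
      show "(\<lambda>x. u x * - frechet_derivative \<psi> (at (x - t *\<^sub>R b)) b) \<in> borel_measurable (lebesgue_on \<Omega>)"
        using L2_measurable[OF u_L2] meas[OF test_function_props(4)[OF T]] by auto
      show "(\<lambda>x. u x * ((\<psi> (x - (t + s i) *\<^sub>R b) - \<psi> (x - t *\<^sub>R b)) / s i)) \<in> borel_measurable (lebesgue_on \<Omega>)" for i
        using L2_measurable[OF u_L2] meas[OF test_function_props(3)[OF T]] by auto
      show "integrable (lebesgue_on \<Omega>) (\<lambda>x. norm (u x) * B)"
        using L2_integrable[OF u_L2] by auto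
      show "AE x in lebesgue_on \<Omega>. (\<lambda>i. u x * ((\<psi> (x - (t + s i) *\<^sub>R b) - \<psi> (x - t *\<^sub>R b)) / s i))
          \<longlonglongrightarrow> u x * - frechet_derivative \<psi> (at (x - t *\<^sub>R b)) b"
      proof (intro always_eventually allI tendsto_mult tendsto_const)
        fix x
        \<comment> \<open>The test function is evaluated at x - t b, that is at parameter -t on the
          line through x, and the increment s of t becomes -s; hence the minus sign in the
          limit.\<close>
        have "((\<lambda>h. (\<psi> (x + (- t + h) *\<^sub>R b) - \<psi> (x + (- t) *\<^sub>R b)) / h) \<longlongrightarrow> frechet_derivative \<psi> (at (x + (-t) *\<^sub>R b)) b) (at 0)"
          using test_function_direction_derivative[OF T, of x "- t"] unfolding DERIV_def by (simp add: algebra_simps)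
        moreover have "filterlim (\<lambda>i. - s i) (at 0) sequentially"
          using s tendsto_minus[OF s(2)] by (simp add: filterlim_at)
        ultimately have "(\<lambda>i. (\<psi> (x + (- t + - s i) *\<^sub>R b) - \<psi> (x + (- t) *\<^sub>R b)) / (- s i)) \<longlonglongrightarrow> frechet_derivative \<psi> (at (x + (-t) *\<^sub>R b)) b"
          by (rule filterlim_compose)
        then have "(\<lambda>i. - ((\<psi> (x + (- t + - s i) *\<^sub>R b) - \<psi> (x + (- t) *\<^sub>R b)) / (- s i))) \<longlonglongrightarrow> - frechet_derivative \<psi> (at (x + (-t) *\<^sub>R b)) b"
          by (rule tendsto_minus)
        then show "(\<lambda>i. (\<psi> (x - (t + s i) *\<^sub>R b) - \<psi> (x - t *\<^sub>R b)) / s i) \<longlonglongrightarrow> - frechet_derivative \<psi> (at (x - t *\<^sub>R b)) b"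
          by (simp add: algebra_simps)
      qed
      show "AE x in lebesgue_on \<Omega>. norm (u x * ((\<psi> (x - (t + s i) *\<^sub>R b) - \<psi> (x - t *\<^sub>R b)) / s i)) \<le> norm (u x) * B" for i
      proof (intro always_eventually allI)
        fix x
        have "\<bar>\<psi> (x - (t + s i) *\<^sub>R b) - \<psi> (x - t *\<^sub>R b)\<bar> \<le> B * \<bar>s i\<bar>"
          using test_function_increment_bound[OF T B(2), of "x - t *\<^sub>R b" "- s i"] by (simp add: algebra_simps)
        then have "\<bar>\<psi> (x - (t + s i) *\<^sub>R b) - \<psi> (x - t *\<^sub>R b)\<bar> / \<bar>s i\<bar> \<le> B"
          using s(1) by (simp add: divide_le_eq)
        then show "norm (u x * ((\<psi> (x - (t + s i) *\<^sub>R b) - \<psi> (x - t *\<^sub>R b)) / s i)) \<le> norm (u x) * B"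
          by (simp only: real_norm_def abs_mult abs_divide) (rule mult_left_mono, auto)
      qed
    qed
    then show "(\<lambda>i. (a (t + s i) - a t) / s i) \<longlonglongrightarrow> - L2_inner \<Omega> u (\<lambda>x. frechet_derivative \<psi> (at (x - t *\<^sub>R b)) b)"
      unfolding eq by (simp add: L2_inner_def)
  qed
  then have "(a has_real_derivative - L2_inner \<Omega> u (\<lambda>x. frechet_derivative \<psi> (at (x - t *\<^sub>R b)) b)) (at t)"
    by (simp add: DERIV_def)
  moreover have "\<forall>\<^sub>F s in nhds t. a s = L2_inner \<Omega> (shifted s) \<psi>"
  proof -
    have "\<forall>\<^sub>F s in nhds t. s \<in> {-\<delta> <..< \<delta>}"
      using t by (intro eventually_nhds_in_open) auto
    then show ?thesis by eventually_elim (auto simp: a_def intro!: L2_inner_shift[OF \<psi>])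
  qed
  ultimately show ?thesis by (subst (asm) DERIV_cong_ev[OF refl _ refl])
qed

lemma difference_quotient_tendsto:
  assumes \<psi>: "\<psi> \<in> tests"
  shows "((\<lambda>h. L2_inner \<Omega> (increment h) \<psi> / h) \<longlongrightarrow> - L2_inner \<Omega> u (\<lambda>x. frechet_derivative \<psi> (at x) b)) (at 0)"
proof -
  have "((\<lambda>h. (L2_inner \<Omega> (shifted h) \<psi> - L2_inner \<Omega> (shifted 0) \<psi>) / h) \<longlongrightarrow>
      - L2_inner \<Omega> u (\<lambda>x. frechet_derivative \<psi> (at x) b)) (at 0)"
    using shift_pairing_derivative[OF \<psi>, of 0] delta_pos by (simp add: DERIV_def)
  moreover have "\<forall>\<^sub>F h in at 0. (L2_inner \<Omega> (shifted h) \<psi> - L2_inner \<Omega> (shifted 0) \<psi>) / h = L2_inner \<Omega> (increment h) \<psi> / h"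
  proof -
    have "\<forall>\<^sub>F h in at 0. h \<in> {-\<delta> <..< \<delta>}"
      using delta_pos by (intro eventually_at_in_open') auto
    then show ?thesis
    proof eventually_elim
      case (elim h)
      then show ?case unfolding increment_def[abs_def]
        using shifted_L2[of h] shifted_L2[of 0] testsD(4)[OF \<psi>] delta_pos by (simp add: L2_inner_diff_left abs_le_iff)
    qed
  qed
  ultimately show ?thesis by (rule Lim_transform_eventually)
qed

text \<open>The products \<open>\<psi> = G \<phi>\<close> to be tested with are only continuous; they are
  uniform limits of test functions with support in \<open>K\<close>.\<close>

definition approximable :: "('a \<Rightarrow> real) set" where
  "approximable = {\<psi> \<in> L2 \<Omega>. (\<forall>x. x \<notin> K \<longrightarrow> \<psi> x = 0) \<and> (\<forall>e>0. \<exists>\<psi>'\<in>tests. \<forall>x. \<bar>\<psi> x - \<psi>' x\<bar> \<le> e)}"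

text \<open>By Stone-Weierstrass G is uniformly close on \<open>K\<close> to a polynomial p, and p
  times a test function is again a test function with the same support.\<close>

lemma continuous_mult_test_approximable:
  assumes G: "continuous_on K G" and \<phi>: "\<phi> \<in> tests"
  shows "(\<lambda>x. G x * \<phi> x) \<in> approximable"
proof -
  obtain B where B: "B \<ge> 0" "\<And>x. \<bar>\<phi> x\<bar> \<le> B"
    using test_function_bounded(1)[OF testsD(1)[OF \<phi>]] by blast
  have eq: "(\<lambda>x. G x * \<phi> x) = (\<lambda>x. (if x \<in> K then G x else 0) *\<^sub>R \<phi> x)"
    using testsD(2)[OF \<phi>] by auto
  have "compact (G ` K)" using G compact_K by (rule compact_continuous_image)
  then obtain C where C: "\<And>x. x \<in> K \<Longrightarrow> \<bar>G x\<bar> \<le> C"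
    using compact_imp_bounded by (metis bounded_iff image_eqI real_norm_def)
  have "(\<lambda>x. if x \<in> K then G x else 0) \<in> borel_measurable borel"
    by (rule borel_measurable_continuous_on_if[of K, where g="\<lambda>x. 0"])
       (use G compact_K in \<open>auto simp: compact_imp_closed\<close>)
  then have "(\<lambda>x. if x \<in> K then G x else 0) \<in> borel_measurable (lebesgue_on \<Omega>)"
    by (intro measurable_restrict_space1 measurable_completion) simp
  then have L2: "(\<lambda>x. G x * \<phi> x) \<in> L2 \<Omega>"
    unfolding eq using C by (intro L2_mult_bounded(1)[OF testsD(4)[OF \<phi>], where C="max 0 C"]) (auto simp: le_max_iff_disj)
  have "\<exists>\<psi>'\<in>tests. \<forall>x. \<bar>G x * \<phi> x - \<psi>' x\<bar> \<le> e" if e: "e > 0" for e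
  proof -
    \<comment> \<open>The denominator is B + 1 because the bound B may be 0.\<close>
    obtain p where p: "real_polynomial_function p" "\<And>x. x \<in> K \<Longrightarrow> \<bar>G x - p x\<bar> < e / (B + 1)"
      using Stone_Weierstrass_real_polynomial_function[OF compact_K G, of "e / (B + 1)"] e B(1) by auto
    have "(\<lambda>x. p x * \<phi> x) \<in> tests"
      using test_function_mult_polynomial[OF testsD(1)[OF \<phi>] p(1)] testsD(2)[OF \<phi>] by (auto simp: tests_def)
    moreover have "\<bar>G x * \<phi> x - p x * \<phi> x\<bar> \<le> e" for x
    proof (cases "x \<in> K")
      case True
      have "\<bar>G x * \<phi> x - p x * \<phi> x\<bar> = \<bar>G x - p x\<bar> * \<bar>\<phi> x\<bar>" by (metis abs_mult left_diff_distrib)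
      also have "\<dots> \<le> e / (B + 1) * B"
        using less_imp_le[OF p(2)[OF True]] B e by (intro mult_mono) auto
      also have "\<dots> \<le> e" using B(1) e by (simp add: field_simps)
      finally show ?thesis .
    qed (use testsD(2)[OF \<phi>] e in auto)
    ultimately show ?thesis by (intro bexI[of _ "\<lambda>x. p x * \<phi> x"]) auto
  qed
  then show ?thesis using L2 testsD(2)[OF \<phi>] by (auto simp: approximable_def)
qed

lemma approximable_norm_le:
  assumes "\<psi> \<in> approximable" "\<psi>' \<in> tests" "\<And>x. \<bar>\<psi> x - \<psi>' x\<bar> \<le> e" "e > 0"
  shows "L2_norm \<Omega> (\<lambda>x. \<psi> x - \<psi>' x) \<le> e * vol"
  using L2_bounded(2)[of "\<lambda>x. \<psi> x - \<psi>' x" e] assms L2_measurable[of \<psi>] L2_measurable[OF testsD(4)[OF assms(2)]]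
  by (auto simp: approximable_def)

end

section \<open>Difference quotients of a continuous function with a weak gradient\<close>

locale gradient_setup = shift_setup +
  fixes g :: "'a \<Rightarrow> 'a"
  assumes g_L2: "g \<in> L2 \<Omega>" and g_grad: "is_weak_gradient \<Omega> u g"
begin

abbreviation gb :: "'a \<Rightarrow> real" where "gb \<equiv> \<lambda>x. g x \<bullet> b"

lemma gb_L2: "gb \<in> L2 \<Omega>"
  by (rule L2_component[OF g_L2 b_Basis])

lemma weak_gradient_tested:
  "\<psi> \<in> test_functions \<Omega> \<Longrightarrow> L2_inner \<Omega> u (\<lambda>x. frechet_derivative \<psi> (at x) b) = - L2_inner \<Omega> gb \<psi>"
  using g_grad b_Basis by (simp add: is_weak_gradient_iff)

text \<open>Mean value inequality in the shift t: the derivative of the pairing is the inner product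
  of \<open>gb\<close> with a translated test function, whose norm does not depend on t.\<close>

lemma increment_pairing_le_tests:
  assumes \<psi>: "\<psi> \<in> tests" and h: "\<bar>h\<bar> < \<delta>"
  shows "\<bar>L2_inner \<Omega> (increment h) \<psi>\<bar> \<le> \<bar>h\<bar> * L2_norm \<Omega> gb * L2_norm \<Omega> \<psi>"
proof -
  have "norm (L2_inner \<Omega> (shifted h) \<psi> - L2_inner \<Omega> (shifted 0) \<psi>) \<le> (L2_norm \<Omega> gb * L2_norm \<Omega> \<psi>) * norm (h - 0)"
  proof (rule field_differentiable_bound[of "{- \<delta> <..< \<delta>}"])
    fix t assume t: "t \<in> {- \<delta> <..< \<delta>}"
    show "((\<lambda>t. L2_inner \<Omega> (shifted t) \<psi>) has_field_derivative
        - L2_inner \<Omega> u (\<lambda>x. frechet_derivative \<psi> (at (x - t *\<^sub>R b)) b)) (at t within {- \<delta> <..< \<delta>})"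
      using t by (intro has_field_derivative_at_within[OF shift_pairing_derivative[OF \<psi>]]) auto
    have "L2_inner \<Omega> u (\<lambda>x. frechet_derivative \<psi> (at (x - t *\<^sub>R b)) b) = - L2_inner \<Omega> gb (\<lambda>x. \<psi> (x - t *\<^sub>R b))"
      using weak_gradient_tested[OF tests_shift[OF \<psi>, of t]] t frechet_derivative_shift[OF testsD(1)[OF \<psi>]] by auto
    moreover have "\<bar>L2_inner \<Omega> gb (\<lambda>x. \<psi> (x - t *\<^sub>R b))\<bar> \<le> L2_norm \<Omega> gb * L2_norm \<Omega> (\<lambda>x. \<psi> (x - t *\<^sub>R b))"
      using t by (intro L2_Cauchy_Schwarz gb_L2 test_function_L2(1)[OF tests_shift[OF \<psi>]]) auto
    ultimately show "norm (- L2_inner \<Omega> u (\<lambda>x. frechet_derivative \<psi> (at (x - t *\<^sub>R b)) b)) \<le> L2_norm \<Omega> gb * L2_norm \<Omega> \<psi>"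
      using t L2_norm_shift[OF \<psi>, of t] by auto
  qed (use h delta_pos in auto)
  then show ?thesis
    using h delta_pos shifted_L2[of h] shifted_L2[of 0] testsD(4)[OF \<psi>]
    by (simp add: increment_def[abs_def] L2_inner_diff_left mult_ac)
qed

text \<open>Both sides are continuous in the tested function under uniform convergence, since
  \<open>\<Omega>\<close> has finite measure; so the bound extends from test functions to their
  uniform limits.\<close>

lemma increment_pairing_le:
  assumes \<psi>: "\<psi> \<in> approximable" and h: "\<bar>h\<bar> < \<delta>"
  shows "\<bar>L2_inner \<Omega> (increment h) \<psi>\<bar> \<le> \<bar>h\<bar> * L2_norm \<Omega> gb * L2_norm \<Omega> \<psi>"
proof (rule field_le_epsilon)
  fix e :: real assume e: "e > 0"
  define C where "C = L2_norm \<Omega> (increment h) * vol + \<bar>h\<bar> * L2_norm \<Omega> gb * vol"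
  have C: "C \<ge> 0" by (simp add: C_def)
  define d where "d = e / (C + 1)"
  have d: "d > 0" using C e by (simp add: d_def)
  obtain \<psi>' where \<psi>': "\<psi>' \<in> tests" "\<And>x. \<bar>\<psi> x - \<psi>' x\<bar> \<le> d"
    using \<psi> d by (auto simp: approximable_def)
  have L: "\<psi> \<in> L2 \<Omega>" "\<psi>' \<in> L2 \<Omega>" "increment h \<in> L2 \<Omega>"
    using \<psi> testsD(4)[OF \<psi>'(1)] h by (auto simp: approximable_def intro!: increment_L2)
  note n = approximable_norm_le[OF \<psi> \<psi>' d]
  have "L2_inner \<Omega> (increment h) \<psi> = L2_inner \<Omega> (increment h) \<psi>' + L2_inner \<Omega> (increment h) (\<lambda>x. \<psi> x - \<psi>' x)"
    using L by (simp add: L2_inner_simps)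
  then have "\<bar>L2_inner \<Omega> (increment h) \<psi>\<bar> \<le> \<bar>h\<bar> * L2_norm \<Omega> gb * L2_norm \<Omega> \<psi>' + L2_norm \<Omega> (increment h) * (d * vol)"
    using increment_pairing_le_tests[OF \<psi>'(1) h] L2_Cauchy_Schwarz[OF L(3) L2_diff[OF L(1,2)]]
      mult_left_mono[OF n L2_norm_nonneg[of \<Omega> "increment h"]] by linarith
  also have "\<bar>h\<bar> * L2_norm \<Omega> gb * L2_norm \<Omega> \<psi>' \<le> \<bar>h\<bar> * L2_norm \<Omega> gb * (L2_norm \<Omega> \<psi> + d * vol)"
    using n L2_norm_triangle_diff[OF L(1,2)] by (intro mult_left_mono) auto
  finally have "\<bar>L2_inner \<Omega> (increment h) \<psi>\<bar> \<le> \<bar>h\<bar> * L2_norm \<Omega> gb * L2_norm \<Omega> \<psi> + d * C"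
    by (simp add: C_def algebra_simps)
  moreover have "d * C \<le> e" using C e by (simp add: d_def field_simps)
  ultimately show "\<bar>L2_inner \<Omega> (increment h) \<psi>\<bar> \<le> \<bar>h\<bar> * L2_norm \<Omega> gb * L2_norm \<Omega> \<psi> + e" by simp
qed

text \<open>Convergence on a dense class plus a uniform bound: for test functions the limit is the
  definition of the weak gradient, and \<open>increment_pairing_le\<close> controls the quotients on
  the approximation error uniformly in h.\<close>

lemma increment_quotient_tendsto:
  assumes \<psi>: "\<psi> \<in> approximable"
  shows "((\<lambda>h. L2_inner \<Omega> (increment h) \<psi> / h) \<longlongrightarrow> L2_inner \<Omega> gb \<psi>) (at 0)"
proof (rule tendstoI)
  fix e :: real assume e: "e > 0"
  define C where "C = L2_norm \<Omega> gb * vol"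
  have C: "C \<ge> 0" by (simp add: C_def)
  define d where "d = e / (3 * (C + 1))"
  have d: "d > 0" using C e by (simp add: d_def)
  have dC: "d * C < e / 3" using C e by (simp add: d_def field_simps)
  obtain \<psi>' where \<psi>': "\<psi>' \<in> tests" "\<And>x. \<bar>\<psi> x - \<psi>' x\<bar> \<le> d"
    using \<psi> d by (auto simp: approximable_def)
  have L: "\<psi> \<in> L2 \<Omega>" "\<psi>' \<in> L2 \<Omega>"
    using \<psi> testsD(4)[OF \<psi>'(1)] by (auto simp: approximable_def)
  note n = approximable_norm_le[OF \<psi> \<psi>' d]
  \<comment> \<open>To be fed into \<open>increment_pairing_le\<close>, the error itself must be a
    uniform limit of test functions.\<close>
  have diff: "(\<lambda>x. \<psi> x - \<psi>' x) \<in> approximable"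
  proof -
    have "\<exists>\<psi>''\<in>tests. \<forall>x. \<bar>\<psi> x - \<psi>' x - \<psi>'' x\<bar> \<le> r" if "r > 0" for r
    proof -
      obtain \<zeta> where \<zeta>: "\<zeta> \<in> tests" "\<And>x. \<bar>\<psi> x - \<zeta> x\<bar> \<le> r"
        using \<psi> \<open>r > 0\<close> by (auto simp: approximable_def)
      have "C_k k (\<lambda>x. \<zeta> x + (-1) * \<psi>' x)" for k
        by (intro C_k_add C_k_mult C_k_const test_function_props(1)[OF testsD(1)[OF \<zeta>(1)]]
            test_function_props(1)[OF testsD(1)[OF \<psi>'(1)]])
      then have "(\<lambda>x. \<zeta> x + (-1) * \<psi>' x) \<in> test_functions \<Omega>"
        using testsD(2)[OF \<zeta>(1)] testsD(2)[OF \<psi>'(1)] compact_K K_subset by (intro test_functionsI[of _ K]) auto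
      then have "(\<lambda>x. \<zeta> x - \<psi>' x) \<in> tests"
        using testsD(2)[OF \<zeta>(1)] testsD(2)[OF \<psi>'(1)] by (auto simp: tests_def)
      then show ?thesis using \<zeta>(2) by (intro bexI[of _ "\<lambda>x. \<zeta> x - \<psi>' x"]) auto
    qed
    then show ?thesis using \<psi> L testsD(2)[OF \<psi>'(1)] by (auto simp: approximable_def)
  qed
  have "((\<lambda>h. L2_inner \<Omega> (increment h) \<psi>' / h) \<longlongrightarrow> L2_inner \<Omega> gb \<psi>') (at 0)"
    using difference_quotient_tendsto[OF \<psi>'(1)] weak_gradient_tested[OF testsD(1)[OF \<psi>'(1)]] by simp
  then have "\<forall>\<^sub>F h in at 0. dist (L2_inner \<Omega> (increment h) \<psi>' / h) (L2_inner \<Omega> gb \<psi>') < e / 3"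
    using e by (intro tendstoD) auto
  moreover have "\<forall>\<^sub>F h in at 0. h \<in> {- \<delta> <..< \<delta>}"
    using delta_pos by (intro eventually_at_in_open') auto
  moreover have "\<forall>\<^sub>F h in at (0::real). h \<noteq> 0" by (simp add: eventually_at_filter)
  ultimately show "\<forall>\<^sub>F h in at 0. dist (L2_inner \<Omega> (increment h) \<psi> / h) (L2_inner \<Omega> gb \<psi>) < e"
  proof eventually_elim
    case (elim h)
    then have h: "\<bar>h\<bar> < \<delta>" "h \<noteq> 0" by auto
    have hL: "increment h \<in> L2 \<Omega>" using h by (intro increment_L2) auto
    have "\<bar>L2_inner \<Omega> (increment h) (\<lambda>x. \<psi> x - \<psi>' x)\<bar> \<le> \<bar>h\<bar> * (L2_norm \<Omega> gb * L2_norm \<Omega> (\<lambda>x. \<psi> x - \<psi>' x))"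
      using increment_pairing_le[OF diff h(1)] by (simp add: mult.assoc)
    also have "\<dots> \<le> \<bar>h\<bar> * (d * C)"
      using mult_left_mono[OF n, of "L2_norm \<Omega> gb"] by (intro mult_left_mono) (auto simp: C_def mult_ac)
    finally have "\<bar>L2_inner \<Omega> (increment h) (\<lambda>x. \<psi> x - \<psi>' x)\<bar> / \<bar>h\<bar> \<le> d * C"
      using h by (simp add: divide_le_eq mult.commute)
    moreover have "L2_inner \<Omega> (increment h) \<psi> / h - L2_inner \<Omega> (increment h) \<psi>' / h = L2_inner \<Omega> (increment h) (\<lambda>x. \<psi> x - \<psi>' x) / h"
      using hL L by (simp add: L2_inner_simps diff_divide_distrib)
    ultimately have 1: "\<bar>L2_inner \<Omega> (increment h) \<psi> / h - L2_inner \<Omega> (increment h) \<psi>' / h\<bar> \<le> d * C"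
      by (simp add: abs_divide)
    have "\<bar>L2_inner \<Omega> gb \<psi> - L2_inner \<Omega> gb \<psi>'\<bar> = \<bar>L2_inner \<Omega> gb (\<lambda>x. \<psi> x - \<psi>' x)\<bar>"
      using gb_L2 L by (simp add: L2_inner_simps)
    also have "\<dots> \<le> L2_norm \<Omega> gb * (d * vol)"
      using L2_Cauchy_Schwarz[OF gb_L2 L2_diff[OF L]] mult_left_mono[OF n L2_norm_nonneg[of \<Omega> gb]] by linarith
    finally have "\<bar>L2_inner \<Omega> gb \<psi> - L2_inner \<Omega> gb \<psi>'\<bar> \<le> d * C" by (simp add: C_def mult_ac)
    with 1 dC elim(1) show ?case unfolding dist_real_def by linarith
  qed
qed

text \<open>The increment, times the square of the test function, is itself an admissible function
  to pair with. This bounds the square of the norm by |h| M times \<open>L2_norm \<Omega> gb\<close>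
  times the norm, and one factor cancels. The outcome is a strong bound of order |h| for the
  localised increment, obtained from weak ones.\<close>

lemma weighted_increment_le:
  assumes \<phi>: "\<phi> \<in> tests" and M: "\<And>x. \<bar>\<phi> x\<bar> \<le> M" and h: "\<bar>h\<bar> < \<delta>"
  shows "(\<lambda>x. \<phi> x * increment h x) \<in> L2 \<Omega>"
    and "L2_norm \<Omega> (\<lambda>x. \<phi> x * increment h x) \<le> \<bar>h\<bar> * (M * L2_norm \<Omega> gb)"
proof -
  have M0: "M \<ge> 0" using M[of undefined] by linarith
  have hL: "increment h \<in> L2 \<Omega>" using h by (intro increment_L2) auto
  have \<phi>m: "\<phi> \<in> borel_measurable (lebesgue_on \<Omega>)" using testsD(4)[OF \<phi>] by (rule L2_measurable)
  show D: "(\<lambda>x. \<phi> x * increment h x) \<in> L2 \<Omega>"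
    using L2_mult_bounded(1)[OF hL \<phi>m, of M] M by simp
  have cont: "continuous_on K (\<lambda>x. increment h x * \<phi> x)"
  proof -
    have "continuous_on K (\<lambda>x. (u (x + h *\<^sub>R b) - u (x + 0 *\<^sub>R b)) * \<phi> x)"
      using h delta_pos test_function_props(3)[OF testsD(1)[OF \<phi>]]
      by (intro continuous_on_mult continuous_on_diff continuous_on_shifted) (auto intro: continuous_on_subset)
    then show ?thesis by (rule continuous_on_eq) (auto simp: increment_def shifted_def)
  qed
  have ap: "(\<lambda>x. increment h x * \<phi> x * \<phi> x) \<in> approximable"
    by (rule continuous_mult_test_approximable[OF cont \<phi>])
  let ?n = "L2_norm \<Omega> (\<lambda>x. \<phi> x * increment h x)"
  have "L2_norm \<Omega> (\<lambda>x. increment h x * \<phi> x * \<phi> x) \<le> M * ?n"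
    using L2_mult_bounded(2)[OF D \<phi>m, of M] M M0 by (simp add: mult_ac)
  then have "\<bar>h\<bar> * L2_norm \<Omega> gb * L2_norm \<Omega> (\<lambda>x. increment h x * \<phi> x * \<phi> x) \<le> \<bar>h\<bar> * L2_norm \<Omega> gb * (M * ?n)"
    by (rule mult_left_mono) simp
  then have "\<bar>L2_inner \<Omega> (increment h) (\<lambda>x. increment h x * \<phi> x * \<phi> x)\<bar> \<le> \<bar>h\<bar> * L2_norm \<Omega> gb * (M * ?n)"
    using increment_pairing_le[OF ap h] by linarith
  moreover have "L2_inner \<Omega> (increment h) (\<lambda>x. increment h x * \<phi> x * \<phi> x) = ?n * ?n"
    unfolding power2_eq_square[symmetric] L2_norm_sq by (simp add: L2_inner_def mult_ac)
  ultimately have *: "?n * ?n \<le> (\<bar>h\<bar> * (M * L2_norm \<Omega> gb)) * ?n"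
    by (simp add: mult_ac)
  show "?n \<le> \<bar>h\<bar> * (M * L2_norm \<Omega> gb)"
  proof (cases "?n = 0")
    case True then show ?thesis using M0 by simp
  next
    case False
    then have "0 < ?n" using L2_norm_nonneg[of \<Omega> "\<lambda>x. \<phi> x * increment h x"] by linarith
    then show ?thesis using * by (rule mult_right_le_imp_le[rotated])
  qed
qed

end

context bounded_domain
begin

lemma cball_neighbourhood:
  assumes "compact K" "K \<subseteq> \<Omega>"
  obtains \<delta> where "\<delta> > 0" "\<And>x. x \<in> K \<Longrightarrow> cball x \<delta> \<subseteq> \<Omega>"
    "compact {x + y | x y. x \<in> K \<and> y \<in> cball 0 \<delta>}" "{x + y | x y. x \<in> K \<and> y \<in> cball 0 \<delta>} \<subseteq> \<Omega>"
proof -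
  obtain \<delta> where d: "\<delta> > 0" "(\<Union>x\<in>K. cball x \<delta>) \<subseteq> \<Omega>"
    using compact_subset_open_imp_cball_epsilon_subset[OF assms(1) open_domain assms(2)] by blast
  have "{x + y | x y. x \<in> K \<and> y \<in> cball 0 \<delta>} \<subseteq> (\<Union>x\<in>K. cball x \<delta>)"
    by (auto simp: dist_norm)
  with d show thesis
    by (intro that[of \<delta>] compact_sums assms compact_cball) blast+
qed

text \<open>The increment of F o u paired with a test function is compared with the increment of u
  paired with F'(u) times it. Pointwise they differ by a small multiple of the localised increment
  of u, whose norm is of order |h| by \<open>weighted_increment_le\<close>. After division by h both
  pairings have the same limit: one is the weak derivative of F o u, the other the asserted
  gradient.\<close>

theorem weak_gradient_chain_rule:
  fixes u :: "'a \<Rightarrow> real" and F F' :: "real \<Rightarrow> real"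
  assumes cont: "continuous_on \<Omega> u" and u: "u \<in> L2 \<Omega>" and g: "g \<in> L2 \<Omega>" and wg: "is_weak_gradient \<Omega> u g"
    and F: "\<And>t. (F has_real_derivative F' t) (at t)" and F': "continuous_on UNIV F'"
    and Fu: "(\<lambda>x. F (u x)) \<in> L2 \<Omega>" and F'g: "(\<lambda>x. F' (u x) *\<^sub>R g x) \<in> L2 \<Omega>"
  shows "is_weak_gradient \<Omega> (\<lambda>x. F (u x)) (\<lambda>x. F' (u x) *\<^sub>R g x)"
  unfolding is_weak_gradient_iff
proof (intro ballI)
  fix \<phi> and b :: 'a assume \<phi>: "\<phi> \<in> test_functions \<Omega>" and b: "b \<in> Basis"
  obtain K where K: "compact K" "K \<subseteq> \<Omega>" "\<And>x. x \<notin> K \<Longrightarrow> \<phi> x = 0"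
    using test_function_props(2)[OF \<phi>] by blast
  obtain \<delta> where \<delta>: "\<delta> > 0" "\<And>x. x \<in> K \<Longrightarrow> cball x \<delta> \<subseteq> \<Omega>"
    and nb: "compact {x + y | x y. x \<in> K \<and> y \<in> cball 0 \<delta>}" "{x + y | x y. x \<in> K \<and> y \<in> cball 0 \<delta>} \<subseteq> \<Omega>"
    using cball_neighbourhood[OF K(1,2)] by blast
  let ?N = "{x + y | x y. x \<in> K \<and> y \<in> cball 0 \<delta>}"
  have contF: "continuous_on UNIV F"
    using DERIV_isCont[OF F] by (simp add: continuous_on_eq_continuous_at)
  interpret U: gradient_setup \<Omega> K \<delta> b u g
    by unfold_locales (use K \<delta> b cont u g wg in auto)
  interpret V: shift_setup \<Omega> K \<delta> b "\<lambda>x. F (u x)"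
    by unfold_locales (use K \<delta> b Fu in \<open>auto intro!: continuous_on_compose2[OF contF cont]\<close>)
  have \<phi>t: "\<phi> \<in> U.tests" "\<phi> \<in> V.tests" using \<phi> K(3) by (auto simp: U.tests_def V.tests_def)
  obtain M where M: "M \<ge> 0" "\<And>x. \<bar>\<phi> x\<bar> \<le> M" using test_function_bounded(1)[OF \<phi>] by blast
  define \<psi> where "\<psi> x = F' (u x) * \<phi> x" for x
  have \<psi>: "\<psi> \<in> U.approximable"
    unfolding \<psi>_def[abs_def] using K(2)
    by (intro U.continuous_mult_test_approximable \<phi>t continuous_on_compose2[OF F'] continuous_on_subset[OF cont]) auto
  then have \<psi>L: "\<psi> \<in> L2 \<Omega>" by (simp add: U.approximable_def)
  have key: "((\<lambda>h. (L2_inner \<Omega> (V.increment h) \<phi> - L2_inner \<Omega> (U.increment h) \<psi>) / h) \<longlongrightarrow> 0) (at 0)"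
  proof (rule tendstoI)
    fix e :: real assume e: "e > 0"
    define C where "C = M * L2_norm \<Omega> U.gb * vol"
    have C: "C \<ge> 0" using M by (simp add: C_def)
    define d where "d = e / (C + 1)"
    have d: "d > 0" "d * C < e" using C e by (auto simp: d_def field_simps)
    have uN: "continuous_on ?N u" using cont nb(2) by (rule continuous_on_subset)
    have "bounded (u ` ?N)" using compact_continuous_image[OF uN nb(1)] by (rule compact_imp_bounded)
    then obtain R where R: "\<And>x. x \<in> ?N \<Longrightarrow> \<bar>u x\<bar> \<le> R" unfolding bounded_iff real_norm_def by blast
    \<comment> \<open>R bounds u on the closed neighbourhood \<open>?N\<close>, which contains every
      shifted point; F' is uniformly continuous only after restriction to such a bounded
      range.\<close>
    have "uniformly_continuous_on {-R..R} F'"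
      using F' by (intro compact_uniformly_continuous) (auto intro: continuous_on_subset)
    then obtain \<rho> where \<rho>: "\<rho> > 0" "\<And>s t. s \<in> {-R..R} \<Longrightarrow> t \<in> {-R..R} \<Longrightarrow> \<bar>s - t\<bar> < \<rho> \<Longrightarrow> \<bar>F' s - F' t\<bar> < d"
      using d(1) unfolding uniformly_continuous_on_def dist_real_def by metis
    have "uniformly_continuous_on ?N u" using uN nb(1) by (rule compact_uniformly_continuous)
    then obtain \<eta> where \<eta>: "\<eta> > 0" "\<And>x y. x \<in> ?N \<Longrightarrow> y \<in> ?N \<Longrightarrow> dist y x < \<eta> \<Longrightarrow> \<bar>u y - u x\<bar> < \<rho>"
      using \<rho>(1) unfolding uniformly_continuous_on_def dist_real_def[symmetric] by meson
    \<comment> \<open>First order Taylor estimate with uniform remainder: the mean value inequality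
      for r -> F r - F'(u x) r on the segment between the two values of u.\<close>
    have pt: "\<bar>F (u (x + h *\<^sub>R b)) - F (u x) - F' (u x) * (u (x + h *\<^sub>R b) - u x)\<bar> \<le> d * \<bar>u (x + h *\<^sub>R b) - u x\<bar>"
      if x: "x \<in> K" and h: "\<bar>h\<bar> < \<delta>" "\<bar>h\<bar> < \<eta>" for x h
    proof -
      let ?s = "u x" and ?t = "u (x + h *\<^sub>R b)"
      have "h *\<^sub>R b \<in> cball 0 \<delta>" using h(1) b by simp
      then have xN2: "x + h *\<^sub>R b \<in> ?N" using x by blast
      have "(0::'a) \<in> cball 0 \<delta>" using \<delta>(1) by simp
      then have "x + 0 \<in> ?N" using x by blast
      then have xN1: "x \<in> ?N" by simp
      have st: "\<bar>?t - ?s\<bar> < \<rho>" using \<eta>(2)[OF xN1 xN2] h(2) b by (simp add: dist_norm)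
      have "norm ((F ?t - F' ?s * ?t) - (F ?s - F' ?s * ?s)) \<le> d * norm (?t - ?s)"
      proof (rule field_differentiable_bound[of "closed_segment ?s ?t" "\<lambda>r. F r - F' ?s * r" "\<lambda>r. F' r - F' ?s"])
        fix r assume r: "r \<in> closed_segment ?s ?t"
        show "((\<lambda>r. F r - F' ?s * r) has_field_derivative F' r - F' ?s) (at r within closed_segment ?s ?t)"
          by (rule has_field_derivative_at_within) (auto intro!: derivative_eq_intros F)
        have "r \<in> {-R..R}" "\<bar>r - ?s\<bar> < \<rho>"
          using r R[OF xN1] R[OF xN2] st by (auto simp: closed_segment_eq_real_ivl abs_le_iff abs_less_iff split: if_splits)
        then show "norm (F' r - F' ?s) \<le> d"
          using \<rho>(2)[of r ?s] R[OF xN1] by (auto simp: abs_le_iff)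
      qed auto
      then show ?thesis by (simp add: algebra_simps)
    qed
    have "\<forall>\<^sub>F h in at 0. h \<in> {- min \<delta> \<eta> <..< min \<delta> \<eta>}"
      using \<delta>(1) \<eta>(1) by (intro eventually_at_in_open') auto
    moreover have "\<forall>\<^sub>F h in at (0::real). h \<noteq> 0" by (simp add: eventually_at_filter)
    ultimately show "\<forall>\<^sub>F h in at 0. dist ((L2_inner \<Omega> (V.increment h) \<phi> - L2_inner \<Omega> (U.increment h) \<psi>) / h) 0 < e"
    proof eventually_elim
      case (elim h)
      then have h: "\<bar>h\<bar> < \<delta>" "\<bar>h\<bar> < \<eta>" "h \<noteq> 0" by auto
      note w = U.weighted_increment_le[OF \<phi>t(1) M(2) h(1)]
      have L: "V.increment h \<in> L2 \<Omega>" "U.increment h \<in> L2 \<Omega>"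
        using h(1) by (auto intro!: V.increment_L2 U.increment_L2)
      have \<phi>L: "\<phi> \<in> L2 \<Omega>" by (rule test_function_L2(1)[OF \<phi>])
      have i1: "integrable (lebesgue_on \<Omega>) (\<lambda>x. V.increment h x * \<phi> x)"
        and i2: "integrable (lebesgue_on \<Omega>) (\<lambda>x. U.increment h x * \<psi> x)"
        using L2_integrable_inner[OF L(1) \<phi>L] L2_integrable_inner[OF L(2) \<psi>L] by simp_all
      have absL: "(\<lambda>x. \<bar>\<phi> x * U.increment h x\<bar>) \<in> L2 \<Omega>"
        by (rule L2_bound[OF w(1)]) (use L2_measurable[OF w(1)] in auto)
      have "L2_inner \<Omega> (V.increment h) \<phi> - L2_inner \<Omega> (U.increment h) \<psi>
          = (LINT x|lebesgue_on \<Omega>. V.increment h x * \<phi> x - U.increment h x * \<psi> x)"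
        using i1 i2 by (simp add: L2_inner_def)
      also have "\<bar>\<dots>\<bar> \<le> (LINT x|lebesgue_on \<Omega>. d * norm (\<phi> x * U.increment h x))"
      proof (rule order_trans[OF integral_abs_bound integral_mono])
        show "integrable (lebesgue_on \<Omega>) (\<lambda>x. d * norm (\<phi> x * U.increment h x))"
          using L2_integrable[OF w(1)] by (intro integrable_mult_right integrable_norm)
        show "integrable (lebesgue_on \<Omega>) (\<lambda>x. \<bar>V.increment h x * \<phi> x - U.increment h x * \<psi> x\<bar>)"
          using i1 i2 by (intro integrable_abs Bochner_Integration.integrable_diff)
        fix x
        show "\<bar>V.increment h x * \<phi> x - U.increment h x * \<psi> x\<bar> \<le> d * norm (\<phi> x * U.increment h x)"
        proof (cases "x \<in> K")
          case True
          have "V.increment h x * \<phi> x - U.increment h x * \<psi> x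
              = (F (u (x + h *\<^sub>R b)) - F (u x) - F' (u x) * (u (x + h *\<^sub>R b) - u x)) * \<phi> x"
            using True by (simp add: V.increment_def U.increment_def V.shifted_def U.shifted_def \<psi>_def algebra_simps)
          then have "\<bar>V.increment h x * \<phi> x - U.increment h x * \<psi> x\<bar>
              = \<bar>F (u (x + h *\<^sub>R b)) - F (u x) - F' (u x) * (u (x + h *\<^sub>R b) - u x)\<bar> * \<bar>\<phi> x\<bar>"
            by (simp only: abs_mult)
          also have "\<dots> \<le> (d * \<bar>u (x + h *\<^sub>R b) - u x\<bar>) * \<bar>\<phi> x\<bar>"
            by (rule mult_right_mono[OF pt[OF True h(1,2)]]) simp
          also have "\<dots> = d * norm (\<phi> x * U.increment h x)"
            using True by (simp add: U.increment_def U.shifted_def abs_mult)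
          finally show ?thesis .
        qed (use K(3) d(1) in \<open>auto simp: \<psi>_def\<close>)
      qed
      also have "\<dots> = d * L2_inner \<Omega> (\<lambda>x. 1) (\<lambda>x. \<bar>\<phi> x * U.increment h x\<bar>)"
        by (simp add: L2_inner_def)
      also have "\<dots> \<le> d * (vol * L2_norm \<Omega> (\<lambda>x. \<bar>\<phi> x * U.increment h x\<bar>))"
        using L2_Cauchy_Schwarz[OF L2_const[of "1::real"] absL] d(1)
        by (intro mult_left_mono) (auto simp: vol_def)
      also have "L2_norm \<Omega> (\<lambda>x. \<bar>\<phi> x * U.increment h x\<bar>) = L2_norm \<Omega> (\<lambda>x. \<phi> x * U.increment h x)"
        by (simp add: L2_norm_def)
      also have "d * (vol * L2_norm \<Omega> (\<lambda>x. \<phi> x * U.increment h x)) \<le> d * (vol * (\<bar>h\<bar> * (M * L2_norm \<Omega> U.gb)))"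
        using w(2) d(1) by (intro mult_left_mono) auto
      also have "\<dots> = \<bar>h\<bar> * (d * C)" by (simp add: C_def mult_ac)
      finally have "\<bar>L2_inner \<Omega> (V.increment h) \<phi> - L2_inner \<Omega> (U.increment h) \<psi>\<bar> / \<bar>h\<bar> \<le> d * C"
        using h(3) by (simp add: divide_le_eq mult.commute)
      then show ?case using d(2) by (simp add: abs_divide)
    qed
  qed
  have lim1: "((\<lambda>h. L2_inner \<Omega> (V.increment h) \<phi> / h) \<longlongrightarrow> 0 + L2_inner \<Omega> U.gb \<psi>) (at 0)"
    using tendsto_add[OF key U.increment_quotient_tendsto[OF \<psi>]] by (simp add: diff_divide_distrib)
  have lim2: "((\<lambda>h. L2_inner \<Omega> (V.increment h) \<phi> / h) \<longlongrightarrow> - L2_inner \<Omega> (\<lambda>x. F (u x)) (\<lambda>x. frechet_derivative \<phi> (at x) b)) (at 0)"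
    by (rule V.difference_quotient_tendsto[OF \<phi>t(2)])
  have "- L2_inner \<Omega> (\<lambda>x. F (u x)) (\<lambda>x. frechet_derivative \<phi> (at x) b) = L2_inner \<Omega> U.gb \<psi>"
    using tendsto_unique[OF at_neq_bot lim2 lim1] by simp
  also have "\<dots> = L2_inner \<Omega> (\<lambda>x. (F' (u x) *\<^sub>R g x) \<bullet> b) \<phi>"
    by (simp add: L2_inner_def \<psi>_def mult_ac)
  finally show "L2_inner \<Omega> (\<lambda>x. F (u x)) (\<lambda>x. frechet_derivative \<phi> (at x) b)
      = - L2_inner \<Omega> (\<lambda>x. (F' (u x) *\<^sub>R g x) \<bullet> b) \<phi>" by simp
qed

end

section \<open>Closable forms and their resolvents\<close>

text \<open>\<open>V\<close> consists of representatives and \<open>q\<close> is a semi-inner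
  product on them. Nothing is asked about functions that agree almost everywhere; compatibility with
  that is recovered for the closure in \<open>cdom_cong_AE\<close>.\<close>

locale quadratic_form =
  fixes \<Omega> :: "'a::euclidean_space set" and V :: "('a \<Rightarrow> real) set"
    and q :: "('a \<Rightarrow> real) \<Rightarrow> ('a \<Rightarrow> real) \<Rightarrow> real"
  assumes V_L2: "V \<subseteq> L2 \<Omega>" and V_zero: "(\<lambda>x. 0) \<in> V"
    and V_lincomb: "\<And>u v c d. u \<in> V \<Longrightarrow> v \<in> V \<Longrightarrow> (\<lambda>x. c * u x + d * v x) \<in> V"
    and q_lincomb: "\<And>u v w c d. u \<in> V \<Longrightarrow> v \<in> V \<Longrightarrow> w \<in> V \<Longrightarrow>
        q (\<lambda>x. c * u x + d * v x) w = c * q u w + d * q v w"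
    and q_commute: "\<And>u v. u \<in> V \<Longrightarrow> v \<in> V \<Longrightarrow> q u v = q v u"
    and q_nonneg: "\<And>u. u \<in> V \<Longrightarrow> 0 \<le> q u u"
begin

lemma V_in_L2 [simp, intro]: "u \<in> V \<Longrightarrow> u \<in> L2 \<Omega>"
  using V_L2 by blast

lemma V_diff: "u \<in> V \<Longrightarrow> v \<in> V \<Longrightarrow> (\<lambda>x. u x - v x) \<in> V"
  using V_lincomb[of u v 1 "-1"] by simp

lemma q_lincomb_right:
  assumes "u \<in> V" "v \<in> V" "w \<in> V"
  shows "q w (\<lambda>x. c * u x + d * v x) = c * q w u + d * q w v"
  using assms q_lincomb[OF assms, of c d] q_commute[of w "\<lambda>x. c * u x + d * v x"] q_commute[of w] V_lincomb by simp

lemma q_diff_left: "u \<in> V \<Longrightarrow> v \<in> V \<Longrightarrow> w \<in> V \<Longrightarrow> q (\<lambda>x. u x - v x) w = q u w - q v w"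
  using q_lincomb[of u v w 1 "-1"] by simp

lemma q_diff_right: "u \<in> V \<Longrightarrow> v \<in> V \<Longrightarrow> w \<in> V \<Longrightarrow> q w (\<lambda>x. u x - v x) = q w u - q w v"
  using q_lincomb_right[of u v w 1 "-1"] by simp

lemma q_lincomb_self:
  assumes "u \<in> V" "v \<in> V"
  shows "q (\<lambda>x. c * u x + d * v x) (\<lambda>x. c * u x + d * v x) = c\<^sup>2 * q u u + 2 * c * d * q u v + d\<^sup>2 * q v v"
  using assms q_commute[of v u]
  by (simp add: q_lincomb q_lincomb_right V_lincomb algebra_simps power2_eq_square)

definition qnorm :: "('a \<Rightarrow> real) \<Rightarrow> real" where "qnorm u = sqrt (q u u)"

lemma qnorm_nonneg [simp]: "u \<in> V \<Longrightarrow> 0 \<le> qnorm u"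
  by (simp add: qnorm_def q_nonneg)

lemma qnorm_sq: "u \<in> V \<Longrightarrow> (qnorm u)\<^sup>2 = q u u"
  by (simp add: qnorm_def q_nonneg)

lemma q_Cauchy_Schwarz:
  assumes "u \<in> V" "v \<in> V" shows "\<bar>q u v\<bar> \<le> qnorm u * qnorm v"
proof -
  have "0 \<le> q u u + 2 * t * q u v + t\<^sup>2 * q v v" for t
    using q_nonneg[OF V_lincomb[OF assms, of 1 t]] q_lincomb_self[OF assms, of 1 t] by simp
  then have "(q u v)\<^sup>2 \<le> q u u * q v v"
    by (intro quadratic_nonneg_imp_discriminant q_nonneg assms)
  also have "\<dots> = (qnorm u * qnorm v)\<^sup>2"
    using assms by (simp add: power_mult_distrib qnorm_sq)
  finally show ?thesis using assms by (simp add: abs_le_square_iff[symmetric])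
qed

lemma qnorm_lincomb_le:
  assumes "u \<in> V" "v \<in> V"
  shows "qnorm (\<lambda>x. c * u x + d * v x) \<le> \<bar>c\<bar> * qnorm u + \<bar>d\<bar> * qnorm v"
proof (rule power2_le_imp_le)
  have "2 * c * d * q u v \<le> \<bar>2 * c * d\<bar> * \<bar>q u v\<bar>" by (metis abs_ge_self abs_mult)
  also have "\<dots> \<le> \<bar>2 * c * d\<bar> * (qnorm u * qnorm v)"
    by (intro mult_left_mono q_Cauchy_Schwarz assms) simp
  finally have "c\<^sup>2 * q u u + 2 * c * d * q u v + d\<^sup>2 * q v v
      \<le> c\<^sup>2 * q u u + 2 * (\<bar>c\<bar> * \<bar>d\<bar> * (qnorm u * qnorm v)) + d\<^sup>2 * q v v" by (simp add: abs_mult)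
  also have "\<dots> = (\<bar>c\<bar> * qnorm u + \<bar>d\<bar> * qnorm v)\<^sup>2"
    using assms by (simp add: power2_sum power_mult_distrib qnorm_sq algebra_simps)
  finally show "(qnorm (\<lambda>x. c * u x + d * v x))\<^sup>2 \<le> (\<bar>c\<bar> * qnorm u + \<bar>d\<bar> * qnorm v)\<^sup>2"
    using assms by (simp add: qnorm_sq V_lincomb q_lincomb_self)
qed (use assms in simp)

lemma qnorm_diff_commute: "u \<in> V \<Longrightarrow> v \<in> V \<Longrightarrow> qnorm (\<lambda>x. u x - v x) = qnorm (\<lambda>x. v x - u x)"
  unfolding qnorm_def by (simp add: q_diff_left q_diff_right V_diff)

lemma qnorm_triangle_diff:
  assumes "u \<in> V" "v \<in> V" shows "\<bar>qnorm u - qnorm v\<bar> \<le> qnorm (\<lambda>x. u x - v x)"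
proof -
  have "qnorm u \<le> qnorm (\<lambda>x. u x - v x) + qnorm v"
    using qnorm_lincomb_le[OF V_diff[OF assms] assms(2), of 1 1] by simp
  moreover have "qnorm v \<le> qnorm (\<lambda>x. v x - u x) + qnorm u"
    using qnorm_lincomb_le[OF V_diff[OF assms(2,1)] assms(1), of 1 1] by simp
  ultimately show ?thesis using qnorm_diff_commute[OF assms] by linarith
qed

text \<open>Passes from Cauchy for the square \<open>q\<close> to Cauchy for the seminorm, which has
  a triangle inequality.\<close>

lemma approximates_iff:
  "approximates \<Omega> V q s u \<longleftrightarrow> (\<forall>k. s k \<in> V)
     \<and> (\<forall>\<epsilon>>0. \<exists>M. \<forall>m\<ge>M. \<forall>n\<ge>M. qnorm (\<lambda>x. s m x - s n x) < \<epsilon>)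
     \<and> (\<lambda>k. L2_norm \<Omega> (\<lambda>x. s k x - u x)) \<longlonglongrightarrow> 0"
proof -
  have "(\<forall>\<epsilon>>0. \<exists>M. \<forall>m\<ge>M. \<forall>n\<ge>M. q (\<lambda>x. s m x - s n x) (\<lambda>x. s m x - s n x) < \<epsilon>)
      \<longleftrightarrow> (\<forall>\<epsilon>>0. \<exists>M. \<forall>m\<ge>M. \<forall>n\<ge>M. qnorm (\<lambda>x. s m x - s n x) < \<epsilon>)" (is "?A \<longleftrightarrow> ?B")
  proof
    assume A: ?A
    show ?B
    proof (intro allI impI)
      fix \<epsilon> :: real assume e: "\<epsilon> > 0"
      then obtain M where "\<forall>m\<ge>M. \<forall>n\<ge>M. q (\<lambda>x. s m x - s n x) (\<lambda>x. s m x - s n x) < \<epsilon>\<^sup>2"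
        using A by (meson zero_less_power)
      then have "\<forall>m\<ge>M. \<forall>n\<ge>M. qnorm (\<lambda>x. s m x - s n x) < \<epsilon>"
        using e unfolding qnorm_def by (metis real_sqrt_less_mono real_sqrt_abs abs_of_pos)
      then show "\<exists>M. \<forall>m\<ge>M. \<forall>n\<ge>M. qnorm (\<lambda>x. s m x - s n x) < \<epsilon>" ..
    qed
  next
    assume B: ?B
    show ?A
    proof (intro allI impI)
      fix \<epsilon> :: real assume e: "\<epsilon> > 0"
      then obtain M where "\<forall>m\<ge>M. \<forall>n\<ge>M. qnorm (\<lambda>x. s m x - s n x) < sqrt \<epsilon>"
        using B by (meson real_sqrt_gt_zero)
      then show "\<exists>M. \<forall>m\<ge>M. \<forall>n\<ge>M. q (\<lambda>x. s m x - s n x) (\<lambda>x. s m x - s n x) < \<epsilon>"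
        unfolding qnorm_def by auto
    qed
  qed
  then show ?thesis unfolding approximates_def by blast
qed

lemma approximatesD:
  assumes "approximates \<Omega> V q s u"
  shows "s k \<in> V" "(\<lambda>k. L2_norm \<Omega> (\<lambda>x. s k x - u x)) \<longlonglongrightarrow> 0"
    "\<And>e. e > 0 \<Longrightarrow> \<exists>M. \<forall>m\<ge>M. \<forall>n\<ge>M. qnorm (\<lambda>x. s m x - s n x) < e"
  using assms by (auto simp: approximates_iff)

lemma approximates_lincomb:
  assumes s: "approximates \<Omega> V q s u" and t: "approximates \<Omega> V q t v" and uv: "u \<in> L2 \<Omega>" "v \<in> L2 \<Omega>"
  shows "approximates \<Omega> V q (\<lambda>k x. c * s k x + d * t k x) (\<lambda>x. c * u x + d * v x)"
  unfolding approximates_iff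
proof (intro conjI allI impI)
  note sV = approximatesD(1)[OF s] and tV = approximatesD(1)[OF t]
  show "(\<lambda>x. c * s k x + d * t k x) \<in> V" for k using sV tV by (intro V_lincomb)
  fix \<epsilon> :: real assume e: "\<epsilon> > 0"
  define e' where "e' = \<epsilon> / (\<bar>c\<bar> + \<bar>d\<bar> + 1)"
  have e': "e' > 0" using e by (simp add: e'_def add_nonneg_pos)
  obtain M1 where M1: "\<And>m n. m \<ge> M1 \<Longrightarrow> n \<ge> M1 \<Longrightarrow> qnorm (\<lambda>x. s m x - s n x) < e'"
    using approximatesD(3)[OF s e'] by blast
  obtain M2 where M2: "\<And>m n. m \<ge> M2 \<Longrightarrow> n \<ge> M2 \<Longrightarrow> qnorm (\<lambda>x. t m x - t n x) < e'"
    using approximatesD(3)[OF t e'] by blast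
  have "qnorm (\<lambda>x. (c * s m x + d * t m x) - (c * s n x + d * t n x)) < \<epsilon>" if "m \<ge> max M1 M2" "n \<ge> max M1 M2" for m n
  proof -
    have "qnorm (\<lambda>x. (c * s m x + d * t m x) - (c * s n x + d * t n x))
        = qnorm (\<lambda>x. c * (s m x - s n x) + d * (t m x - t n x))"
      by (simp add: algebra_simps)
    also have "\<dots> \<le> \<bar>c\<bar> * qnorm (\<lambda>x. s m x - s n x) + \<bar>d\<bar> * qnorm (\<lambda>x. t m x - t n x)"
      by (intro qnorm_lincomb_le V_diff sV tV)
    also have "\<dots> \<le> \<bar>c\<bar> * e' + \<bar>d\<bar> * e'"
      using M1[of m n] M2[of m n] that by (intro add_mono mult_left_mono) auto
    also have "\<dots> < \<epsilon>"
    proof -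
      have "\<bar>c\<bar> * e' + \<bar>d\<bar> * e' < (\<bar>c\<bar> + \<bar>d\<bar> + 1) * e'" using e' by (simp add: algebra_simps)
      also have "\<dots> = \<epsilon>" by (simp add: e'_def add_nonneg_pos less_imp_neq[symmetric])
      finally show ?thesis .
    qed
    finally show ?thesis .
  qed
  then show "\<exists>M. \<forall>m\<ge>M. \<forall>n\<ge>M. qnorm (\<lambda>x. (c * s m x + d * t m x) - (c * s n x + d * t n x)) < \<epsilon>" by blast
next
  note sV = approximatesD(1)[OF s] and tV = approximatesD(1)[OF t]
  have "(\<lambda>k. \<bar>c\<bar> * L2_norm \<Omega> (\<lambda>x. s k x - u x) + \<bar>d\<bar> * L2_norm \<Omega> (\<lambda>x. t k x - v x)) \<longlonglongrightarrow> \<bar>c\<bar> * 0 + \<bar>d\<bar> * 0"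
    by (intro tendsto_intros approximatesD(2)[OF s] approximatesD(2)[OF t])
  then have lim: "(\<lambda>k. \<bar>c\<bar> * L2_norm \<Omega> (\<lambda>x. s k x - u x) + \<bar>d\<bar> * L2_norm \<Omega> (\<lambda>x. t k x - v x)) \<longlonglongrightarrow> 0" by simp
  have "L2_norm \<Omega> (\<lambda>x. (c * s k x + d * t k x) - (c * u x + d * v x))
      \<le> \<bar>c\<bar> * L2_norm \<Omega> (\<lambda>x. s k x - u x) + \<bar>d\<bar> * L2_norm \<Omega> (\<lambda>x. t k x - v x)" for k
  proof -
    have "L2_norm \<Omega> (\<lambda>x. (c * s k x + d * t k x) - (c * u x + d * v x))
        = L2_norm \<Omega> (\<lambda>x. c * (s k x - u x) + d * (t k x - v x))" by (simp add: algebra_simps)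
    also have "\<dots> \<le> L2_norm \<Omega> (\<lambda>x. c * (s k x - u x)) + L2_norm \<Omega> (\<lambda>x. d * (t k x - v x))"
      using sV tV uv by (intro L2_norm_add_le L2_cmult L2_diff) auto
    finally show ?thesis by (simp add: L2_norm_cmult)
  qed
  then show "(\<lambda>k. L2_norm \<Omega> (\<lambda>x. (c * s k x + d * t k x) - (c * u x + d * v x))) \<longlonglongrightarrow> 0"
    by (intro Lim_null_comparison[OF _ lim]) auto
qed

lemma approximates_bounded:
  assumes s: "approximates \<Omega> V q s u"
  obtains B where "B > 0" "\<And>k. qnorm (s k) \<le> B"
proof -
  note sV = approximatesD(1)[OF s]
  have "Cauchy (\<lambda>k. qnorm (s k))"
  proof (rule metric_CauchyI)
    fix e :: real assume "e > 0"
    then obtain M where M: "\<And>m n. m \<ge> M \<Longrightarrow> n \<ge> M \<Longrightarrow> qnorm (\<lambda>x. s m x - s n x) < e"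
      using approximatesD(3)[OF s] by blast
    have "dist (qnorm (s m)) (qnorm (s n)) < e" if "m \<ge> M" "n \<ge> M" for m n
      using M[OF that] qnorm_triangle_diff[OF sV sV, of m n] by (simp add: dist_real_def)
    then show "\<exists>M. \<forall>m\<ge>M. \<forall>n\<ge>M. dist (qnorm (s m)) (qnorm (s n)) < e" by blast
  qed
  then have "Bseq (\<lambda>k. qnorm (s k))" by (rule Cauchy_Bseq)
  then obtain B where "B > 0" "\<And>k. norm (qnorm (s k)) \<le> B" by (auto elim: BseqE)
  then show thesis using that[of B] by (auto simp: abs_le_iff)
qed

lemma approximates_convergent:
  assumes s: "approximates \<Omega> V q s u" and t: "approximates \<Omega> V q t v"
  shows "convergent (\<lambda>k. q (s k) (t k))"
proof -
  note sV = approximatesD(1)[OF s] and tV = approximatesD(1)[OF t]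
  obtain B where B: "B > 0" "\<And>k. qnorm (s k) \<le> B" using approximates_bounded[OF s] by blast
  obtain C where C: "C > 0" "\<And>k. qnorm (t k) \<le> C" using approximates_bounded[OF t] by blast
  have "Cauchy (\<lambda>k. q (s k) (t k))"
  proof (rule metric_CauchyI)
    fix e :: real assume e: "e > 0"
    define e' where "e' = e / (B + C)"
    have e': "e' > 0" using e B C by (simp add: e'_def)
    obtain M1 where M1: "\<And>m n. m \<ge> M1 \<Longrightarrow> n \<ge> M1 \<Longrightarrow> qnorm (\<lambda>x. s m x - s n x) < e'"
      using approximatesD(3)[OF s e'] by blast
    obtain M2 where M2: "\<And>m n. m \<ge> M2 \<Longrightarrow> n \<ge> M2 \<Longrightarrow> qnorm (\<lambda>x. t m x - t n x) < e'"
      using approximatesD(3)[OF t e'] by blast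
    have "dist (q (s m) (t m)) (q (s n) (t n)) < e" if "m \<ge> max M1 M2" "n \<ge> max M1 M2" for m n
    proof -
      have "q (s m) (t m) - q (s n) (t n) = q (\<lambda>x. s m x - s n x) (t m) + q (s n) (\<lambda>x. t m x - t n x)"
        using sV tV by (simp add: q_diff_left q_diff_right)
      then have "\<bar>q (s m) (t m) - q (s n) (t n)\<bar> \<le> qnorm (\<lambda>x. s m x - s n x) * qnorm (t m) + qnorm (s n) * qnorm (\<lambda>x. t m x - t n x)"
        using q_Cauchy_Schwarz[OF V_diff[OF sV sV] tV, of m n m] q_Cauchy_Schwarz[OF sV V_diff[OF tV tV], of n m n] by linarith
      also have "\<dots> \<le> qnorm (\<lambda>x. s m x - s n x) * C + B * qnorm (\<lambda>x. t m x - t n x)"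
        using B C sV tV by (intro add_mono mult_left_mono mult_right_mono qnorm_nonneg V_diff) auto
      also have "\<dots> < e' * C + B * e'"
        using M1[of m n] M2[of m n] that B(1) C(1) by (intro add_strict_mono mult_strict_right_mono mult_strict_left_mono) auto
      also have "\<dots> = (B + C) * e'" by (simp add: algebra_simps)
      also have "\<dots> = e" using B(1) C(1) by (simp add: e'_def)
      finally show ?thesis by (simp add: dist_real_def)
    qed
    then show "\<exists>M. \<forall>m\<ge>M. \<forall>n\<ge>M. dist (q (s m) (t m)) (q (s n) (t n)) < e" by blast
  qed
  then show ?thesis by (rule Cauchy_convergent)
qed

text \<open>\<open>cdom\<close>, \<open>cform\<close> and later \<open>lap\<close> repeat
  \<open>closure_dom\<close>, \<open>closure_form\<close> and \<open>Laplacian\<close> for an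
  abstract domain and form, so that the concrete objects become instances by mere unfolding.\<close>

definition cdom :: "('a \<Rightarrow> real) set" where
  "cdom = {u \<in> L2 \<Omega>. \<exists>s. approximates \<Omega> V q s u}"

definition cform :: "('a \<Rightarrow> real) \<Rightarrow> ('a \<Rightarrow> real) \<Rightarrow> real" where
  "cform u v = (THE c. \<forall>s t. approximates \<Omega> V q s u \<longrightarrow> approximates \<Omega> V q t v \<longrightarrow> (\<lambda>k. q (s k) (t k)) \<longlonglongrightarrow> c)"

lemma cdom_L2 [simp, intro]: "u \<in> cdom \<Longrightarrow> u \<in> L2 \<Omega>"
  by (simp add: cdom_def)

lemma cdom_approximable: "u \<in> cdom \<Longrightarrow> \<exists>s. approximates \<Omega> V q s u"
  unfolding cdom_def by blast

lemma cdom_lincomb: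
  assumes "u \<in> cdom" "v \<in> cdom" shows "(\<lambda>x. c * u x + d * v x) \<in> cdom"
proof -
  obtain s t where "approximates \<Omega> V q s u" "approximates \<Omega> V q t v"
    using assms[THEN cdom_approximable] by blast
  from approximates_lincomb[OF this cdom_L2[OF assms(1)] cdom_L2[OF assms(2)], of c d]
  show ?thesis using L2_add[OF L2_cmult L2_cmult, OF assms[THEN cdom_L2], of c d]
    unfolding cdom_def by (intro CollectI conjI exI)
qed

end

section \<open>Consequences of closability and the weak resolvent equation\<close>

locale closable_form = quadratic_form +
  assumes closable: "\<And>s. approximates \<Omega> V q s (\<lambda>x. 0) \<Longrightarrow> (\<lambda>k. q (s k) (s k)) \<longlonglongrightarrow> 0"
begin

lemma approximates_same_limit:
  assumes s: "approximates \<Omega> V q s u" and s': "approximates \<Omega> V q s' u" and u: "u \<in> L2 \<Omega>"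
  shows "(\<lambda>k. qnorm (\<lambda>x. s k x - s' k x)) \<longlonglongrightarrow> 0"
proof -
  have "approximates \<Omega> V q (\<lambda>k x. 1 * s k x + (-1) * s' k x) (\<lambda>x. 1 * u x + (-1) * u x)"
    by (rule approximates_lincomb[OF s s' u u])
  then have "(\<lambda>k. q (\<lambda>x. s k x - s' k x) (\<lambda>x. s k x - s' k x)) \<longlonglongrightarrow> 0"
    by (intro closable) simp
  then show ?thesis unfolding qnorm_def using tendsto_real_sqrt by fastforce
qed

lemma approximates_limit_unique:
  assumes s: "approximates \<Omega> V q s u" and s': "approximates \<Omega> V q s' u"
    and t: "approximates \<Omega> V q t v" and t': "approximates \<Omega> V q t' v" and uv: "u \<in> L2 \<Omega>" "v \<in> L2 \<Omega>"
  shows "(\<lambda>k. q (s k) (t k) - q (s' k) (t' k)) \<longlonglongrightarrow> 0"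
proof -
  note V = approximatesD(1)[OF s] approximatesD(1)[OF s'] approximatesD(1)[OF t] approximatesD(1)[OF t']
  obtain B where B: "B > 0" "\<And>k. qnorm (s' k) \<le> B" using approximates_bounded[OF s'] by blast
  obtain C where C: "C > 0" "\<And>k. qnorm (t k) \<le> C" using approximates_bounded[OF t] by blast
  have "(\<lambda>k. qnorm (\<lambda>x. s k x - s' k x) * C + B * qnorm (\<lambda>x. t k x - t' k x)) \<longlonglongrightarrow> 0 * C + B * 0"
    by (intro tendsto_intros approximates_same_limit[OF s s' uv(1)] approximates_same_limit[OF t t' uv(2)])
  then have lim: "(\<lambda>k. qnorm (\<lambda>x. s k x - s' k x) * C + B * qnorm (\<lambda>x. t k x - t' k x)) \<longlonglongrightarrow> 0" by simp
  have "norm (q (s k) (t k) - q (s' k) (t' k)) \<le> qnorm (\<lambda>x. s k x - s' k x) * C + B * qnorm (\<lambda>x. t k x - t' k x)" for k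
  proof -
    have "q (s k) (t k) - q (s' k) (t' k) = q (\<lambda>x. s k x - s' k x) (t k) + q (s' k) (\<lambda>x. t k x - t' k x)"
      using V by (simp add: q_diff_left q_diff_right)
    then have "\<bar>q (s k) (t k) - q (s' k) (t' k)\<bar> \<le> qnorm (\<lambda>x. s k x - s' k x) * qnorm (t k) + qnorm (s' k) * qnorm (\<lambda>x. t k x - t' k x)"
      using q_Cauchy_Schwarz[OF V_diff[OF V(1,2)] V(3), of k k k] q_Cauchy_Schwarz[OF V(2) V_diff[OF V(3,4)], of k k k] by linarith
    also have "\<dots> \<le> qnorm (\<lambda>x. s k x - s' k x) * C + B * qnorm (\<lambda>x. t k x - t' k x)"
      using B C V by (intro add_mono mult_left_mono mult_right_mono qnorm_nonneg V_diff) auto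
    finally show ?thesis by simp
  qed
  then show ?thesis by (intro Lim_null_comparison[OF _ lim]) auto
qed

text \<open>Shows that the definite description is proper: a limit exists since the values along
  Cauchy sequences are Cauchy, and closability makes it independent of the two approximating
  sequences.\<close>

lemma cform_tendsto:
  assumes s: "approximates \<Omega> V q s u" and t: "approximates \<Omega> V q t v" and uv: "u \<in> L2 \<Omega>" "v \<in> L2 \<Omega>"
  shows "(\<lambda>k. q (s k) (t k)) \<longlonglongrightarrow> cform u v"
proof -
  obtain c where c: "(\<lambda>k. q (s k) (t k)) \<longlonglongrightarrow> c"
    using approximates_convergent[OF s t] by (auto simp: convergent_def)
  have all: "(\<lambda>k. q (s' k) (t' k)) \<longlonglongrightarrow> c" if "approximates \<Omega> V q s' u" "approximates \<Omega> V q t' v" for s' t'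
    using tendsto_diff[OF c approximates_limit_unique[OF s that(1) t that(2) uv]] by simp
  have "cform u v = c"
    unfolding cform_def
  proof (rule the_equality)
    show "\<forall>s t. approximates \<Omega> V q s u \<longrightarrow> approximates \<Omega> V q t v \<longrightarrow> (\<lambda>k. q (s k) (t k)) \<longlonglongrightarrow> c"
      by (intro allI impI all)
    fix c' assume "\<forall>s t. approximates \<Omega> V q s u \<longrightarrow> approximates \<Omega> V q t v \<longrightarrow> (\<lambda>k. q (s k) (t k)) \<longlonglongrightarrow> c'"
    then have "(\<lambda>k. q (s k) (t k)) \<longlonglongrightarrow> c'" using s t by blast
    then show "c' = c" using c by (rule LIMSEQ_unique)
  qed
  then show ?thesis using c by simp
qed

lemma cform_lincomb:
  assumes "u \<in> cdom" "v \<in> cdom" "w \<in> cdom"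
  shows "cform (\<lambda>x. c * u x + d * v x) w = c * cform u w + d * cform v w"
proof -
  obtain s t p where a: "approximates \<Omega> V q s u" "approximates \<Omega> V q t v" "approximates \<Omega> V q p w"
    using assms[THEN cdom_approximable] by blast
  note L = cdom_L2[OF assms(1)] cdom_L2[OF assms(2)] cdom_L2[OF assms(3)]
  note V = approximatesD(1)[OF a(1)] approximatesD(1)[OF a(2)] approximatesD(1)[OF a(3)]
  have "(\<lambda>k. q (\<lambda>x. c * s k x + d * t k x) (p k)) \<longlonglongrightarrow> cform (\<lambda>x. c * u x + d * v x) w"
    by (rule cform_tendsto[OF approximates_lincomb[OF a(1,2) L(1,2)] a(3) _ L(3)]) (use L in auto)
  moreover have "(\<lambda>k. c * q (s k) (p k) + d * q (t k) (p k)) \<longlonglongrightarrow> c * cform u w + d * cform v w"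
    by (intro tendsto_add tendsto_mult tendsto_const cform_tendsto[OF a(1,3) L(1,3)] cform_tendsto[OF a(2,3) L(2,3)])
  moreover have "q (\<lambda>x. c * s k x + d * t k x) (p k) = c * q (s k) (p k) + d * q (t k) (p k)" for k
    using V by (intro q_lincomb)
  ultimately show ?thesis using LIMSEQ_unique by simp
qed

lemma cform_commute:
  assumes "u \<in> cdom" "v \<in> cdom" shows "cform u v = cform v u"
proof -
  obtain s t where a: "approximates \<Omega> V q s u" "approximates \<Omega> V q t v"
    using assms[THEN cdom_approximable] by blast
  have "q (s k) (t k) = q (t k) (s k)" for k
    using approximatesD(1)[OF a(1)] approximatesD(1)[OF a(2)] by (intro q_commute) auto
  then show ?thesis
    using cform_tendsto[OF a cdom_L2[OF assms(1)] cdom_L2[OF assms(2)]]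
      cform_tendsto[OF a(2,1) cdom_L2[OF assms(2)] cdom_L2[OF assms(1)]] LIMSEQ_unique by simp
qed

lemma cform_nonneg:
  assumes "u \<in> cdom" shows "0 \<le> cform u u"
proof -
  obtain s where a: "approximates \<Omega> V q s u" using cdom_approximable[OF assms] by blast
  show ?thesis
    by (rule LIMSEQ_le_const[OF cform_tendsto[OF a a cdom_L2[OF assms] cdom_L2[OF assms]]])
       (intro exI allI impI q_nonneg approximatesD(1)[OF a])
qed

text \<open>The limit function enters \<open>approximates\<close> only through an L2 distance, so
  the sets of approximating sequences coincide.\<close>

lemma cdom_cong_AE:
  assumes "u \<in> cdom" "u' \<in> L2 \<Omega>" "AE x in lebesgue_on \<Omega>. u x = u' x"
  shows "u' \<in> cdom" "cform u' \<phi> = cform u \<phi>"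
proof -
  have uL: "u \<in> L2 \<Omega>" using assms(1) by (rule cdom_L2)
  have "approximates \<Omega> V q s u = approximates \<Omega> V q s u'" for s
  proof (cases "\<forall>k. s k \<in> V")
    case True
    have "L2_norm \<Omega> (\<lambda>x. s k x - u x) = L2_norm \<Omega> (\<lambda>x. s k x - u' x)" for k
      by (rule L2_norm_cong_AE) (use True uL assms(2,3) in \<open>auto intro!: L2_measurable elim!: eventually_mono\<close>)
    then show ?thesis by (simp add: approximates_def)
  qed (auto simp: approximates_def)
  then have "approximates \<Omega> V q s u = approximates \<Omega> V q s u'" for s .
  note * = this
  show "u' \<in> cdom" using cdom_approximable[OF assms(1)] assms(2) unfolding cdom_def * by (intro CollectI conjI)
  show "cform u' \<phi> = cform u \<phi>" unfolding cform_def * ..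
qed

text \<open>The weak form of (r - A) u = f, where A is the operator of the closed form.\<close>

definition solves :: "real \<Rightarrow> ('a \<Rightarrow> real) \<Rightarrow> ('a \<Rightarrow> real) \<Rightarrow> bool" where
  "solves r f u \<longleftrightarrow> u \<in> cdom \<and> (\<forall>\<phi>\<in>cdom. cform u \<phi> + r * L2_inner \<Omega> u \<phi> = L2_inner \<Omega> f \<phi>)"

lemma solves_cdom: "solves r f u \<Longrightarrow> u \<in> cdom"
  and solves_L2: "solves r f u \<Longrightarrow> u \<in> L2 \<Omega>"
  and solves_test: "solves r f u \<Longrightarrow> \<phi> \<in> cdom \<Longrightarrow> cform u \<phi> + r * L2_inner \<Omega> u \<phi> = L2_inner \<Omega> f \<phi>"
  by (auto simp: solves_def)

lemma solves_lincomb: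
  assumes f: "solves r f u" and g: "solves r g v" and L: "f \<in> L2 \<Omega>" "g \<in> L2 \<Omega>"
  shows "solves r (\<lambda>x. c * f x + d * g x) (\<lambda>x. c * u x + d * v x)"
  unfolding solves_def
proof (intro conjI ballI)
  show "(\<lambda>x. c * u x + d * v x) \<in> cdom" using f g by (intro cdom_lincomb solves_cdom)
  fix \<phi> assume \<phi>: "\<phi> \<in> cdom"
  note U = solves_L2[OF f] solves_L2[OF g] cdom_L2[OF \<phi>]
  have "cform (\<lambda>x. c * u x + d * v x) \<phi> = c * cform u \<phi> + d * cform v \<phi>"
    by (intro cform_lincomb solves_cdom[OF f] solves_cdom[OF g] \<phi>)
  moreover have "L2_inner \<Omega> (\<lambda>x. c * u x + d * v x) \<phi> = c * L2_inner \<Omega> u \<phi> + d * L2_inner \<Omega> v \<phi>"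
    using U by (simp add: L2_inner_add_left L2_inner_cmult_left L2_cmult)
  moreover have "L2_inner \<Omega> (\<lambda>x. c * f x + d * g x) \<phi> = c * L2_inner \<Omega> f \<phi> + d * L2_inner \<Omega> g \<phi>"
    using U L by (simp add: L2_inner_add_left L2_inner_cmult_left L2_cmult)
  ultimately show "cform (\<lambda>x. c * u x + d * v x) \<phi> + r * L2_inner \<Omega> (\<lambda>x. c * u x + d * v x) \<phi>
      = L2_inner \<Omega> (\<lambda>x. c * f x + d * g x) \<phi>"
    using solves_test[OF f \<phi>, symmetric] solves_test[OF g \<phi>, symmetric] by (simp add: algebra_simps)
qed

lemma solves_cong:
  assumes s: "solves r f u" and L: "f \<in> L2 \<Omega>" "f' \<in> L2 \<Omega>" "u' \<in> L2 \<Omega>"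
    and AE: "AE x in lebesgue_on \<Omega>. u x = u' x" "AE x in lebesgue_on \<Omega>. f x = f' x"
  shows "solves r f' u'"
  unfolding solves_def
proof (intro conjI ballI)
  note u = solves_cdom[OF s]
  show "u' \<in> cdom" by (rule cdom_cong_AE(1)[OF u L(3) AE(1)])
  fix \<phi> assume \<phi>: "\<phi> \<in> cdom"
  note \<phi>L = cdom_L2[OF \<phi>]
  have "L2_inner \<Omega> u \<phi> = L2_inner \<Omega> u' \<phi>"
    by (rule L2_inner_cong_AE[OF solves_L2[OF s] L(3) \<phi>L \<phi>L AE(1)]) simp
  moreover have "L2_inner \<Omega> f \<phi> = L2_inner \<Omega> f' \<phi>"
    by (rule L2_inner_cong_AE[OF L(1,2) \<phi>L \<phi>L AE(2)]) simp
  ultimately show "cform u' \<phi> + r * L2_inner \<Omega> u' \<phi> = L2_inner \<Omega> f' \<phi>"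
    using solves_test[OF s \<phi>] cdom_cong_AE(2)[OF u L(3) AE(1), of \<phi>] by simp
qed

lemma solves_bound:
  assumes s: "solves r f u" shows "r * L2_inner \<Omega> u u \<le> L2_inner \<Omega> f u"
  using solves_test[OF s solves_cdom[OF s]] cform_nonneg[OF solves_cdom[OF s]] by simp

lemma solves_norm:
  assumes s: "solves r f u" and f: "f \<in> L2 \<Omega>"
  shows "r * L2_norm \<Omega> u \<le> L2_norm \<Omega> f"
proof (cases "L2_norm \<Omega> u = 0")
  case False
  then have pos: "0 < L2_norm \<Omega> u" using L2_norm_nonneg[of \<Omega> u] by linarith
  have "r * L2_norm \<Omega> u * L2_norm \<Omega> u \<le> L2_norm \<Omega> f * L2_norm \<Omega> u"
    using solves_bound[OF s] L2_Cauchy_Schwarz[OF f solves_L2[OF s]]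
    by (simp add: L2_norm_sq[symmetric] power2_eq_square mult.assoc)
  then show ?thesis using pos by (rule mult_right_le_imp_le)
qed simp

lemma solves_unique:
  assumes s: "solves r f u" and t: "solves r f v" and r: "r > 0" and f: "f \<in> L2 \<Omega>"
  shows "AE x in lebesgue_on \<Omega>. u x = v x"
proof -
  have "solves r (\<lambda>x. 1 * f x + (-1) * f x) (\<lambda>x. 1 * u x + (-1) * v x)"
    by (rule solves_lincomb[OF s t f f])
  then have "solves r (\<lambda>x. 0) (\<lambda>x. u x - v x)" by simp
  then have "r * L2_norm \<Omega> (\<lambda>x. u x - v x) \<le> L2_norm \<Omega> (\<lambda>x. 0::real)" by (rule solves_norm) simp
  also have "\<dots> = 0" by (simp add: L2_norm_def)
  finally have "L2_norm \<Omega> (\<lambda>x. u x - v x) = 0"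
    using r L2_norm_nonneg[of \<Omega> "\<lambda>x. u x - v x"] by (simp add: mult_le_0_iff)
  then show ?thesis
    using L2_norm_diff_eq_0_iff[OF solves_L2[OF s] solves_L2[OF t]] by simp
qed

text \<open>Self-adjointness of the resolvent at r: each solution is tested with the other. It
  cancels the cross terms in the contraction estimate for complex points.\<close>

lemma solves_symmetric:
  assumes s: "solves r f u" and t: "solves r g v"
  shows "L2_inner \<Omega> f v = L2_inner \<Omega> g u"
  using solves_test[OF s solves_cdom[OF t]] solves_test[OF t solves_cdom[OF s]]
    cform_commute[OF solves_cdom[OF s] solves_cdom[OF t]] L2_inner_commute[of \<Omega> u v] by simp

end

text \<open>The solution of \<open>(r - A) u = f\<close> minimises the functional \<open>J\<close>.\<close>

definition (in quadratic_form) J :: "real \<Rightarrow> ('a \<Rightarrow> real) \<Rightarrow> ('a \<Rightarrow> real) \<Rightarrow> real" where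
  "J r f v = q v v + r * L2_inner \<Omega> v v - 2 * L2_inner \<Omega> f v"

definition (in quadratic_form) jmin :: "real \<Rightarrow> ('a \<Rightarrow> real) \<Rightarrow> real" where
  "jmin r f = (INF v\<in>V. J r f v)"

section \<open>Bounds for the quadratic minimisation problem\<close>

context quadratic_form
begin

text \<open>Completing the square in the norm of v; this makes the infimum \<open>jmin\<close>
  finite.\<close>

lemma J_lower_bound:
  assumes r: "r > 0" and f: "f \<in> L2 \<Omega>" and v: "v \<in> V"
  shows "- ((L2_norm \<Omega> f)\<^sup>2 / r) \<le> J r f v"
proof -
  let ?n = "L2_norm \<Omega> v" and ?F = "L2_norm \<Omega> f"
  have "0 \<le> r * (?n - ?F / r)\<^sup>2" using r by simp
  also have "\<dots> = r * ?n\<^sup>2 - 2 * (?F * ?n) + ?F\<^sup>2 / r"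
    using r by (simp add: power2_eq_square field_simps)
  finally have "- (?F\<^sup>2 / r) \<le> r * ?n\<^sup>2 - 2 * (?F * ?n)" by simp
  then show ?thesis
    using q_nonneg[OF v] L2_Cauchy_Schwarz[OF f V_in_L2[OF v]]
    unfolding J_def L2_norm_sq by linarith
qed

lemma jmin_le: "r > 0 \<Longrightarrow> f \<in> L2 \<Omega> \<Longrightarrow> v \<in> V \<Longrightarrow> jmin r f \<le> J r f v"
  unfolding jmin_def by (rule cINF_lower) (auto intro!: bdd_belowI2 J_lower_bound)

lemma jmin_greatest: "(\<And>v. v \<in> V \<Longrightarrow> c \<le> J r f v) \<Longrightarrow> c \<le> jmin r f"
  unfolding jmin_def using V_zero by (intro cINF_greatest) auto

lemma jmin_approx:
  assumes "e > 0" shows "\<exists>v\<in>V. J r f v < jmin r f + e"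
proof (rule ccontr)
  assume "\<not> ?thesis"
  then have "jmin r f + e \<le> jmin r f" by (intro jmin_greatest) (auto simp: not_less)
  then show False using assms by simp
qed

text \<open>In 2 J(u) + 2 J(v) - 4 J((u + v)/2) the linear terms cancel and the left hand side
  remains exactly; the value at the midpoint is at least the infimum. All estimates on
  near-minimisers rest on this.\<close>

lemma J_parallelogram:
  assumes r: "r > 0" and f: "f \<in> L2 \<Omega>" and V: "u \<in> V" "v \<in> V"
  shows "q (\<lambda>x. u x - v x) (\<lambda>x. u x - v x) + r * (L2_norm \<Omega> (\<lambda>x. u x - v x))\<^sup>2
      \<le> 2 * J r f u + 2 * J r f v - 4 * jmin r f"
proof -
  have L: "u \<in> L2 \<Omega>" "v \<in> L2 \<Omega>" using V by auto
  have A: "jmin r f \<le> J r f (\<lambda>x. (1/2) * u x + (1/2) * v x)"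
    by (intro jmin_le r f V_lincomb V)
  have B: "q (\<lambda>x. u x - v x) (\<lambda>x. u x - v x) = q u u - 2 * q u v + q v v"
    using q_lincomb_self[OF V, of 1 "-1"] by simp
  have C: "L2_inner \<Omega> (\<lambda>x. u x - v x) (\<lambda>x. u x - v x) = L2_inner \<Omega> u u - 2 * L2_inner \<Omega> u v + L2_inner \<Omega> v v"
    using L by (simp add: L2_inner_diff_left L2_inner_diff_right L2_diff L2_inner_commute[of \<Omega> v u])
  have D: "q (\<lambda>x. (1/2) * u x + (1/2) * v x) (\<lambda>x. (1/2) * u x + (1/2) * v x) = q u u / 4 + q u v / 2 + q v v / 4"
    unfolding q_lincomb_self[OF V] by (simp add: power2_eq_square)
  have E: "L2_inner \<Omega> (\<lambda>x. (1/2) * u x + (1/2) * v x) (\<lambda>x. (1/2) * u x + (1/2) * v x)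
      = L2_inner \<Omega> u u / 4 + L2_inner \<Omega> u v / 2 + L2_inner \<Omega> v v / 4"
    using L by (simp only: L2_inner_add_left L2_inner_add_right L2_inner_cmult_left L2_inner_cmult_right L2_add L2_cmult
        L2_inner_commute[of \<Omega> v u]) (simp add: field_simps)
  have F: "L2_inner \<Omega> f (\<lambda>x. (1/2) * u x + (1/2) * v x) = L2_inner \<Omega> f u / 2 + L2_inner \<Omega> f v / 2"
    using L f by (simp only: L2_inner_add_right L2_inner_cmult_right L2_cmult)
  show ?thesis
    using A[unfolded J_def D E F] unfolding J_def L2_norm_sq B C by (simp add: algebra_simps)
qed

text \<open>The polynomial J(s + a t) - jmin in a is nonnegative, so its discriminant is not
  positive. This is a quantitative Euler-Lagrange equation for the near-minimiser s.\<close>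

lemma J_variation:
  assumes r: "r > 0" and f: "f \<in> L2 \<Omega>" and V: "s \<in> V" "t \<in> V"
  shows "(q s t + r * L2_inner \<Omega> s t - L2_inner \<Omega> f t)\<^sup>2 \<le> (J r f s - jmin r f) * (q t t + r * L2_inner \<Omega> t t)"
proof (rule quadratic_nonneg_imp_discriminant)
  have L: "s \<in> L2 \<Omega>" "t \<in> L2 \<Omega>" using V by auto
  fix a :: real
  have "J r f (\<lambda>x. 1 * s x + a * t x) = J r f s + 2 * a * (q s t + r * L2_inner \<Omega> s t - L2_inner \<Omega> f t)
      + a\<^sup>2 * (q t t + r * L2_inner \<Omega> t t)"
  proof -
    have "L2_inner \<Omega> (\<lambda>x. 1 * s x + a * t x) (\<lambda>x. 1 * s x + a * t x)
        = L2_inner \<Omega> s s + 2 * a * L2_inner \<Omega> s t + a\<^sup>2 * L2_inner \<Omega> t t"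
      using L by (simp only: L2_inner_add_left L2_inner_add_right L2_inner_cmult_left L2_inner_cmult_right L2_add L2_cmult
          L2_inner_commute[of \<Omega> t s]) (simp add: power2_eq_square algebra_simps)
    moreover have "L2_inner \<Omega> f (\<lambda>x. 1 * s x + a * t x) = L2_inner \<Omega> f s + a * L2_inner \<Omega> f t"
      using L f by (simp only: L2_inner_add_right L2_inner_cmult_right L2_cmult)
    ultimately show ?thesis unfolding J_def q_lincomb_self[OF V] by (simp add: algebra_simps)
  qed
  moreover have "jmin r f \<le> J r f (\<lambda>x. 1 * s x + a * t x)" by (intro jmin_le r f V_lincomb V)
  ultimately show "0 \<le> (J r f s - jmin r f) + 2 * a * (q s t + r * L2_inner \<Omega> s t - L2_inner \<Omega> f t)
      + a\<^sup>2 * (q t t + r * L2_inner \<Omega> t t)" by simp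
next
  show "0 \<le> q t t + r * L2_inner \<Omega> t t" using q_nonneg[OF V(2)] r by simp
qed

end

context closable_form
begin

text \<open>The parallelogram bound makes s Cauchy in L2 and for \<open>q\<close> at once, so s
  approximates its limit in the sense of the closure. The bound of \<open>J_variation\<close> passes
  to the limit along any sequence approximating the test element and becomes the resolvent
  equation.\<close>

lemma minimising_sequence_solves:
  assumes r: "r > 0" and f: "f \<in> L2 \<Omega>" and s: "\<And>k. s k \<in> V" and lim: "(\<lambda>k. J r f (s k)) \<longlonglongrightarrow> jmin r f"
  obtains u where "solves r f u" "(\<lambda>k. L2_norm \<Omega> (\<lambda>x. s k x - u x)) \<longlonglongrightarrow> 0"
proof -
  note sL = V_in_L2[OF s]
  define d where "d k = J r f (s k) - jmin r f" for k
  have d0: "d \<longlonglongrightarrow> 0" using lim by (simp add: d_def[abs_def] LIM_zero_iff)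
  have d_nn: "0 \<le> d k" for k using jmin_le[OF r f s] by (simp add: d_def)
  have par: "q (\<lambda>x. s m x - s n x) (\<lambda>x. s m x - s n x) + r * (L2_norm \<Omega> (\<lambda>x. s m x - s n x))\<^sup>2 \<le> 2 * d m + 2 * d n" for m n
    using J_parallelogram[OF r f s s, of m n] by (simp add: d_def)
  have small: "\<exists>M. \<forall>m\<ge>M. \<forall>n\<ge>M. 2 * d m + 2 * d n < e" if e: "e > 0" for e
  proof -
    have "\<forall>\<^sub>F k in sequentially. d k < e / 4" using d0 e by (intro order_tendstoD) auto
    then obtain M where M: "\<And>k. k \<ge> M \<Longrightarrow> d k < e / 4" by (auto simp: eventually_sequentially)
    have "2 * d m + 2 * d n < e" if "m \<ge> M" "n \<ge> M" for m n
      using M[OF that(1)] M[OF that(2)] by linarith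
    then show ?thesis by blast
  qed
  have "\<exists>M. \<forall>m\<ge>M. \<forall>n\<ge>M. L2_norm \<Omega> (\<lambda>x. s m x - s n x) < e" if e: "e > 0" for e
  proof -
    obtain M where M: "\<And>m n. m \<ge> M \<Longrightarrow> n \<ge> M \<Longrightarrow> 2 * d m + 2 * d n < r * e\<^sup>2"
      using small[of "r * e\<^sup>2"] r e by auto
    have "L2_norm \<Omega> (\<lambda>x. s m x - s n x) < e" if mn: "m \<ge> M" "n \<ge> M" for m n
    proof (rule power2_less_imp_less)
      have "r * (L2_norm \<Omega> (\<lambda>x. s m x - s n x))\<^sup>2 < r * e\<^sup>2"
        using par[of m n] q_nonneg[OF V_diff[OF s s], of m n] M[OF mn] by linarith
      then show "(L2_norm \<Omega> (\<lambda>x. s m x - s n x))\<^sup>2 < e\<^sup>2" using r by simp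
    qed (use e in simp)
    then show ?thesis by blast
  qed
  then obtain u where u: "u \<in> L2 \<Omega>" "(\<lambda>k. L2_norm \<Omega> (\<lambda>x. s k x - u x)) \<longlonglongrightarrow> 0"
    using L2_complete[of s \<Omega>, OF sL] by blast
  have "\<exists>M. \<forall>m\<ge>M. \<forall>n\<ge>M. q (\<lambda>x. s m x - s n x) (\<lambda>x. s m x - s n x) < e" if e: "e > 0" for e
  proof -
    obtain M where M: "\<And>m n. m \<ge> M \<Longrightarrow> n \<ge> M \<Longrightarrow> 2 * d m + 2 * d n < e"
      using small[OF e] by blast
    have "q (\<lambda>x. s m x - s n x) (\<lambda>x. s m x - s n x) < e" if mn: "m \<ge> M" "n \<ge> M" for m n
    proof -
      have "0 \<le> r * (L2_norm \<Omega> (\<lambda>x. s m x - s n x))\<^sup>2" using r by simp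
      then show ?thesis using par[of m n] M[OF mn] by linarith
    qed
    then show ?thesis by blast
  qed
  then have ap: "approximates \<Omega> V q s u" using s u(2) by (simp add: approximates_def)
  have "solves r f u" unfolding solves_def
  proof (intro conjI ballI)
    show "u \<in> cdom" using u(1) ap unfolding cdom_def by (intro CollectI conjI exI)
    fix \<phi> assume \<phi>: "\<phi> \<in> cdom"
    obtain t where t: "approximates \<Omega> V q t \<phi>" using cdom_approximable[OF \<phi>] by blast
    note tV = approximatesD(1)[OF t] and tlim = approximatesD(2)[OF t] and \<phi>L = cdom_L2[OF \<phi>]
    note tL = V_in_L2[OF tV]
    have f0: "(\<lambda>k. L2_norm \<Omega> (\<lambda>x. f x - f x)) \<longlonglongrightarrow> 0" by (simp add: L2_norm_def)
    have 1: "(\<lambda>k. q (s k) (t k) + r * L2_inner \<Omega> (s k) (t k) - L2_inner \<Omega> f (t k))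
        \<longlonglongrightarrow> cform u \<phi> + r * L2_inner \<Omega> u \<phi> - L2_inner \<Omega> f \<phi>"
      by (intro tendsto_diff tendsto_add tendsto_mult tendsto_const cform_tendsto[OF ap t u(1) \<phi>L]
          L2_inner_tendsto[OF sL u(1) tL \<phi>L u(2) tlim] L2_inner_tendsto[OF f f tL \<phi>L f0 tlim])
    have "(\<lambda>k. sqrt (d k * (q (t k) (t k) + r * L2_inner \<Omega> (t k) (t k))))
        \<longlonglongrightarrow> sqrt (0 * (cform \<phi> \<phi> + r * L2_inner \<Omega> \<phi> \<phi>))"
      by (intro tendsto_real_sqrt tendsto_add tendsto_mult tendsto_const d0 cform_tendsto[OF t t \<phi>L \<phi>L]
          L2_inner_tendsto[OF tL \<phi>L tL \<phi>L tlim tlim])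
    then have z: "(\<lambda>k. sqrt (d k * (q (t k) (t k) + r * L2_inner \<Omega> (t k) (t k)))) \<longlonglongrightarrow> 0" by simp
    have "norm (q (s k) (t k) + r * L2_inner \<Omega> (s k) (t k) - L2_inner \<Omega> f (t k))
        \<le> sqrt (d k * (q (t k) (t k) + r * L2_inner \<Omega> (t k) (t k)))" for k
      using J_variation[OF r f s tV, of k k] unfolding d_def real_norm_def by (intro real_le_rsqrt) simp
    then have 2: "(\<lambda>k. q (s k) (t k) + r * L2_inner \<Omega> (s k) (t k) - L2_inner \<Omega> f (t k)) \<longlonglongrightarrow> 0"
      by (intro Lim_null_comparison[OF _ z]) (intro always_eventually allI)
    show "cform u \<phi> + r * L2_inner \<Omega> u \<phi> = L2_inner \<Omega> f \<phi>"
      using LIMSEQ_unique[OF 1 2] by simp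
  qed
  then show thesis using u(2) by (rule that)
qed

lemma minimising_sequence_exists:
  assumes r: "r > 0" and f: "f \<in> L2 \<Omega>"
  obtains s where "\<And>k. s k \<in> V" "(\<lambda>k. J r f (s k)) \<longlonglongrightarrow> jmin r f"
proof -
  have "\<forall>k. \<exists>v. v \<in> V \<and> J r f v < jmin r f + 1 / real (Suc k)" using jmin_approx[of "1 / real (Suc k)" for k] by fastforce
  then obtain s where s: "\<And>k. s k \<in> V" "\<And>k. J r f (s k) < jmin r f + 1 / real (Suc k)" by metis
  have "(\<lambda>k. jmin r f + 1 / real (Suc k)) \<longlonglongrightarrow> jmin r f + 0"
    by (intro tendsto_add tendsto_const LIMSEQ_Suc[OF lim_1_over_n])
  then have l: "(\<lambda>k. jmin r f + 1 / real (Suc k)) \<longlonglongrightarrow> jmin r f" by simp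
  have "(\<lambda>k. J r f (s k)) \<longlonglongrightarrow> jmin r f"
    by (rule tendsto_sandwich[OF _ _ tendsto_const l])
       (intro always_eventually allI jmin_le[OF r f s(1)], intro always_eventually allI less_imp_le s(2))
  then show thesis using s(1) by (rule that[rotated])
qed

lemma solution_exists:
  assumes r: "r > 0" and f: "f \<in> L2 \<Omega>" shows "\<exists>u. solves r f u"
  using minimising_sequence_exists[OF assms] minimising_sequence_solves[OF assms] by metis

text \<open>The parallelogram bound between v and a minimising sequence, in the limit; uniqueness
  identifies the limit of that sequence with u almost everywhere.\<close>

lemma solves_near_minimiser:
  assumes r: "r > 0" and f: "f \<in> L2 \<Omega>" and u: "solves r f u" and v: "v \<in> V"
  shows "r * (L2_norm \<Omega> (\<lambda>x. v x - u x))\<^sup>2 \<le> 2 * (J r f v - jmin r f)"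
proof -
  obtain s where s: "\<And>k. s k \<in> V" "(\<lambda>k. J r f (s k)) \<longlonglongrightarrow> jmin r f"
    using minimising_sequence_exists[OF r f] by blast
  obtain w where w: "solves r f w" "(\<lambda>k. L2_norm \<Omega> (\<lambda>x. s k x - w x)) \<longlonglongrightarrow> 0"
    using minimising_sequence_solves[OF r f s] by blast
  note L = V_in_L2[OF v] V_in_L2[OF s(1)] solves_L2[OF w(1)] solves_L2[OF u]
  have AE: "AE x in lebesgue_on \<Omega>. w x = u x" by (rule solves_unique[OF w(1) u r f])
  have eq: "L2_norm \<Omega> (\<lambda>x. v x - w x) = L2_norm \<Omega> (\<lambda>x. v x - u x)"
    by (rule L2_norm_cong_AE) (use AE L in \<open>auto intro!: L2_measurable elim!: eventually_mono\<close>)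
  have "(\<lambda>k. L2_norm \<Omega> (\<lambda>x. (v x - s k x) - (v x - w x))) \<longlonglongrightarrow> 0"
    using w(2) by (simp add: L2_norm_minus_commute[of \<Omega> w])
  then have "(\<lambda>k. L2_norm \<Omega> (\<lambda>x. v x - s k x)) \<longlonglongrightarrow> L2_norm \<Omega> (\<lambda>x. v x - w x)"
    by (intro L2_norm_tendsto L2_diff L)
  then have 1: "(\<lambda>k. r * (L2_norm \<Omega> (\<lambda>x. v x - s k x))\<^sup>2) \<longlonglongrightarrow> r * (L2_norm \<Omega> (\<lambda>x. v x - w x))\<^sup>2"
    by (intro tendsto_mult tendsto_const tendsto_power)
  have 2: "(\<lambda>k. 2 * J r f v + 2 * J r f (s k) - 4 * jmin r f) \<longlonglongrightarrow> 2 * J r f v + 2 * jmin r f - 4 * jmin r f"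
    by (intro tendsto_add tendsto_diff tendsto_mult tendsto_const s(2))
  have "r * (L2_norm \<Omega> (\<lambda>x. v x - s k x))\<^sup>2 \<le> 2 * J r f v + 2 * J r f (s k) - 4 * jmin r f" for k
    using J_parallelogram[OF r f v s(1), of k] q_nonneg[OF V_diff[OF v s(1)], of k] by linarith
  then have "r * (L2_norm \<Omega> (\<lambda>x. v x - w x))\<^sup>2 \<le> 2 * J r f v + 2 * jmin r f - 4 * jmin r f"
    by (intro LIMSEQ_le[OF 1 2]) blast
  then show ?thesis using eq by simp
qed

end

section \<open>Resolvents at complex points\<close>

lemma L2_Re_Im_iff:
  fixes u :: "'a::euclidean_space \<Rightarrow> complex"
  shows "u \<in> L2 \<Omega> \<longleftrightarrow> (\<lambda>x. Re (u x)) \<in> L2 \<Omega> \<and> (\<lambda>x. Im (u x)) \<in> L2 \<Omega>"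
proof
  assume u: "u \<in> L2 \<Omega>"
  have m: "u \<in> borel_measurable (lebesgue_on \<Omega>)" using u by (rule L2_measurable)
  show "(\<lambda>x. Re (u x)) \<in> L2 \<Omega> \<and> (\<lambda>x. Im (u x)) \<in> L2 \<Omega>"
    using m by (intro conjI L2_bound[OF u]) (auto simp: abs_Re_le_cmod abs_Im_le_cmod)
next
  assume "(\<lambda>x. Re (u x)) \<in> L2 \<Omega> \<and> (\<lambda>x. Im (u x)) \<in> L2 \<Omega>"
  then have re: "(\<lambda>x. Re (u x)) \<in> L2 \<Omega>" and im: "(\<lambda>x. Im (u x)) \<in> L2 \<Omega>" by auto
  have "u \<in> borel_measurable (lebesgue_on \<Omega>)"
    using L2_measurable[OF re] L2_measurable[OF im] by (simp add: borel_measurable_complex_iff)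
  moreover have "integrable (lebesgue_on \<Omega>) (\<lambda>x. (norm (u x))\<^sup>2)"
    using Bochner_Integration.integrable_add[OF L2_integrable_norm_sq[OF re] L2_integrable_norm_sq[OF im]]
    by (simp add: cmod_power2)
  ultimately show "u \<in> L2 \<Omega>" by (simp add: L2_def)
qed

lemma L2_Re: "u \<in> L2 \<Omega> \<Longrightarrow> (\<lambda>x. Re (u x)) \<in> L2 \<Omega>"
  and L2_Im: "u \<in> L2 \<Omega> \<Longrightarrow> (\<lambda>x. Im (u x)) \<in> L2 \<Omega>"
  using L2_Re_Im_iff by blast+

lemma L2_norm_complex_sq:
  fixes u :: "'a::euclidean_space \<Rightarrow> complex"
  assumes "u \<in> L2 \<Omega>"
  shows "(L2_norm \<Omega> u)\<^sup>2 = (L2_norm \<Omega> (\<lambda>x. Re (u x)))\<^sup>2 + (L2_norm \<Omega> (\<lambda>x. Im (u x)))\<^sup>2"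
proof -
  have "(LINT x|lebesgue_on \<Omega>. (norm (u x))\<^sup>2)
      = (LINT x|lebesgue_on \<Omega>. (norm (Re (u x)))\<^sup>2 + (norm (Im (u x)))\<^sup>2)"
    by (simp add: cmod_power2)
  also have "\<dots> = (LINT x|lebesgue_on \<Omega>. (norm (Re (u x)))\<^sup>2) + (LINT x|lebesgue_on \<Omega>. (norm (Im (u x)))\<^sup>2)"
    by (intro Bochner_Integration.integral_add L2_integrable_norm_sq L2_Re L2_Im assms)
  finally show ?thesis by (simp add: L2_norm_def)
qed

lemma L2_norm_complex_le:
  fixes u :: "'a::euclidean_space \<Rightarrow> complex"
  assumes "u \<in> L2 \<Omega>"
  shows "L2_norm \<Omega> u \<le> L2_norm \<Omega> (\<lambda>x. Re (u x)) + L2_norm \<Omega> (\<lambda>x. Im (u x))"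
  by (rule power2_le_imp_le) (simp_all add: L2_norm_complex_sq[OF assms] power2_sum)

lemma L2_mult_complex:
  fixes u :: "'a::euclidean_space \<Rightarrow> complex"
  assumes "u \<in> L2 \<Omega>" shows "(\<lambda>x. c * u x) \<in> L2 \<Omega>"
  using assms L2_measurable[OF assms] by (auto simp: L2_def norm_mult power_mult_distrib)

lemma L2_norm_mult_complex:
  fixes u :: "'a::euclidean_space \<Rightarrow> complex"
  shows "L2_norm \<Omega> (\<lambda>x. c * u x) = cmod c * L2_norm \<Omega> u"
  by (simp add: L2_norm_def norm_mult power_mult_distrib real_sqrt_mult)

section \<open>The resolvent at complex points as a fixed point\<close>

context closable_form
begin

definition lap :: "(('a \<Rightarrow> real) \<times> ('a \<Rightarrow> real)) set" where
  "lap = {(u, (\<lambda>x. - v x)) | u v. u \<in> cdom \<and> v \<in> L2 \<Omega> \<and> (\<forall>\<phi>\<in>cdom. cform u \<phi> = L2_inner \<Omega> v \<phi>)}"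

definition csolves :: "real \<Rightarrow> ('a \<Rightarrow> complex) \<Rightarrow> ('a \<Rightarrow> complex) \<Rightarrow> bool" where
  "csolves r h u \<longleftrightarrow> solves r (\<lambda>x. Re (h x)) (\<lambda>x. Re (u x)) \<and> solves r (\<lambda>x. Im (h x)) (\<lambda>x. Im (u x))"

lemma csolves_L2: "csolves r h u \<Longrightarrow> u \<in> L2 \<Omega>"
  unfolding csolves_def using L2_Re_Im_iff solves_L2 by blast

lemma lap_shift:
  assumes f: "f \<in> L2 \<Omega>" and u: "u \<in> L2 \<Omega>"
  shows "(u, \<lambda>x. r * u x - f x) \<in> lap \<longleftrightarrow> solves r f u"
proof -
  have "(u, \<lambda>x. r * u x - f x) \<in> lap \<longleftrightarrow>
      u \<in> cdom \<and> (\<lambda>x. f x - r * u x) \<in> L2 \<Omega> \<and> (\<forall>\<phi>\<in>cdom. cform u \<phi> = L2_inner \<Omega> (\<lambda>x. f x - r * u x) \<phi>)"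
  proof -
    have "(\<lambda>x. r * u x - f x) = (\<lambda>x. - v x) \<longleftrightarrow> v = (\<lambda>x. f x - r * u x)" for v
      by (auto simp: fun_eq_iff algebra_simps)
    then show ?thesis unfolding lap_def by auto
  qed
  also have "\<dots> \<longleftrightarrow> u \<in> cdom \<and> (\<forall>\<phi>\<in>cdom. cform u \<phi> = L2_inner \<Omega> f \<phi> - r * L2_inner \<Omega> u \<phi>)"
  proof -
    have "L2_inner \<Omega> (\<lambda>x. f x - r * u x) \<phi> = L2_inner \<Omega> f \<phi> - r * L2_inner \<Omega> u \<phi>" if "\<phi> \<in> cdom" for \<phi>
      using f u cdom_L2[OF that] by (simp add: L2_inner_diff_left L2_inner_cmult_left L2_cmult)
    then show ?thesis using L2_diff[OF f L2_cmult[OF u]] by auto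
  qed
  finally show ?thesis unfolding solves_def by (auto simp: algebra_simps)
qed

lemma lap_cong_AE:
  assumes "(u, w) \<in> lap" "w' \<in> L2 \<Omega>" "AE x in lebesgue_on \<Omega>. w x = w' x"
  shows "(u, w') \<in> lap"
proof -
  obtain v where v: "w = (\<lambda>x. - v x)" "u \<in> cdom" "v \<in> L2 \<Omega>" "\<forall>\<phi>\<in>cdom. cform u \<phi> = L2_inner \<Omega> v \<phi>"
    using assms(1) by (auto simp: lap_def)
  have L: "(\<lambda>x. - w' x) \<in> L2 \<Omega>" by (rule L2_minus[OF assms(2)])
  have "L2_inner \<Omega> v \<phi> = L2_inner \<Omega> (\<lambda>x. - w' x) \<phi>" if "\<phi> \<in> cdom" for \<phi>
  proof (rule L2_inner_cong_AE[OF v(3) L cdom_L2[OF that] cdom_L2[OF that]])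
    show "AE x in lebesgue_on \<Omega>. v x = - w' x" using assms(3) by eventually_elim (simp add: v(1))
  qed simp
  then show ?thesis using v L unfolding lap_def
    by (intro CollectI exI[of _ u] exI[of _ "\<lambda>x. - w' x"]) auto
qed

lemma lap_L2: "(u, w) \<in> lap \<Longrightarrow> u \<in> L2 \<Omega> \<and> w \<in> L2 \<Omega>"
  unfolding lap_def using L2_minus cdom_L2 by blast

text \<open>(z - A) u = f is rewritten as (r - A) u = f - (z - r) u for a real r, to be taken as
  |z|. The equality almost everywhere in \<open>resolvent_eq\<close> is absorbed by replacing the
  image w by z u - f itself.\<close>

lemma resolvent_eq_iff:
  assumes f: "f \<in> L2 \<Omega>"
  shows "resolvent_eq \<Omega> lap z f u \<longleftrightarrow> csolves r (\<lambda>x. f x - (z - of_real r) * u x) u"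
proof -
  let ?h = "\<lambda>x. f x - (z - of_real r) * u x"
  let ?w = "\<lambda>x. z * u x - f x"
  have "resolvent_eq \<Omega> lap z f u \<longleftrightarrow> (u, ?w) \<in> complexification lap"
  proof
    assume "resolvent_eq \<Omega> lap z f u"
    then obtain w where w: "(\<lambda>x. Re (u x), \<lambda>x. Re (w x)) \<in> lap" "(\<lambda>x. Im (u x), \<lambda>x. Im (w x)) \<in> lap"
      and AE: "AE x in lebesgue_on \<Omega>. z * u x - w x = f x"
      by (auto simp: resolvent_eq_def complexification_def)
    have u: "u \<in> L2 \<Omega>" using lap_L2[OF w(1)] lap_L2[OF w(2)] L2_Re_Im_iff by blast
    have wL: "?w \<in> L2 \<Omega>" using f u by (intro L2_diff L2_mult_complex)
    have AE': "AE x in lebesgue_on \<Omega>. w x = ?w x" using AE by eventually_elim (auto simp: algebra_simps)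
    have "(\<lambda>x. Re (u x), \<lambda>x. Re (?w x)) \<in> lap"
      by (rule lap_cong_AE[OF w(1) L2_Re[OF wL]]) (use AE' in eventually_elim, simp)
    moreover have "(\<lambda>x. Im (u x), \<lambda>x. Im (?w x)) \<in> lap"
      by (rule lap_cong_AE[OF w(2) L2_Im[OF wL]]) (use AE' in eventually_elim, simp)
    ultimately show "(u, ?w) \<in> complexification lap" by (simp add: complexification_def)
  next
    assume "(u, ?w) \<in> complexification lap"
    then show "resolvent_eq \<Omega> lap z f u" unfolding resolvent_eq_def by (intro exI[of _ ?w]) auto
  qed
  also have "\<dots> \<longleftrightarrow> csolves r ?h u"
  proof (cases "u \<in> L2 \<Omega>")
    case True
    have hL: "?h \<in> L2 \<Omega>" using f True by (intro L2_diff L2_mult_complex)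
    have "(\<lambda>x. Re (?w x)) = (\<lambda>x. r * Re (u x) - Re (?h x))" "(\<lambda>x. Im (?w x)) = (\<lambda>x. r * Im (u x) - Im (?h x))"
      by (auto simp: fun_eq_iff algebra_simps)
    then have "(u, ?w) \<in> complexification lap \<longleftrightarrow>
      (\<lambda>x. Re (u x), \<lambda>x. r * Re (u x) - Re (?h x)) \<in> lap \<and> (\<lambda>x. Im (u x), \<lambda>x. r * Im (u x) - Im (?h x)) \<in> lap"
      unfolding complexification_def by simp
    then show ?thesis
      unfolding csolves_def using lap_shift[OF L2_Re[OF hL] L2_Re[OF True]] lap_shift[OF L2_Im[OF hL] L2_Im[OF True]] by simp
  next
    case False
    then show ?thesis
      using csolves_L2 lap_L2 L2_Re_Im_iff[of u \<Omega>] by (auto simp: complexification_def)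
  qed
  finally show ?thesis .
qed

lemma csolves_diff:
  assumes s: "csolves r h u" and t: "csolves r k v" and L: "h \<in> L2 \<Omega>" "k \<in> L2 \<Omega>"
  shows "csolves r (\<lambda>x. h x - k x) (\<lambda>x. u x - v x)"
  using solves_lincomb[of r "\<lambda>x. Re (h x)" "\<lambda>x. Re (u x)" "\<lambda>x. Re (k x)" "\<lambda>x. Re (v x)" 1 "-1"]
    solves_lincomb[of r "\<lambda>x. Im (h x)" "\<lambda>x. Im (u x)" "\<lambda>x. Im (k x)" "\<lambda>x. Im (v x)" 1 "-1"]
    s t L2_Re[OF L(1)] L2_Re[OF L(2)] L2_Im[OF L(1)] L2_Im[OF L(2)]
  by (simp add: csolves_def)

lemma csolves_mult:
  assumes s: "csolves r h u" and L: "h \<in> L2 \<Omega>"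
  shows "csolves r (\<lambda>x. c * h x) (\<lambda>x. c * u x)"
  using solves_lincomb[of r "\<lambda>x. Re (h x)" "\<lambda>x. Re (u x)" "\<lambda>x. Im (h x)" "\<lambda>x. Im (u x)" "Re c" "- Im c"]
    solves_lincomb[of r "\<lambda>x. Re (h x)" "\<lambda>x. Re (u x)" "\<lambda>x. Im (h x)" "\<lambda>x. Im (u x)" "Im c" "Re c"]
    s L2_Re[OF L] L2_Im[OF L]
  by (simp add: csolves_def algebra_simps)

lemma csolves_unique:
  assumes s: "csolves r h u" and t: "csolves r h v" and r: "r > 0" and L: "h \<in> L2 \<Omega>"
  shows "AE x in lebesgue_on \<Omega>. u x = v x"
proof -
  have "AE x in lebesgue_on \<Omega>. Re (u x) = Re (v x)"
    using s t by (intro solves_unique[OF _ _ r L2_Re[OF L]]) (auto simp: csolves_def)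
  moreover have "AE x in lebesgue_on \<Omega>. Im (u x) = Im (v x)"
    using s t by (intro solves_unique[OF _ _ r L2_Im[OF L]]) (auto simp: csolves_def)
  ultimately show ?thesis by eventually_elim (simp add: complex_eq_iff)
qed

lemma csolves_cong:
  assumes s: "csolves r h u" and u': "u' \<in> L2 \<Omega>" and h: "h \<in> L2 \<Omega>" "h' \<in> L2 \<Omega>"
    and AE: "AE x in lebesgue_on \<Omega>. u x = u' x" "AE x in lebesgue_on \<Omega>. h x = h' x"
  shows "csolves r h' u'"
  unfolding csolves_def
proof
  have "AE x in lebesgue_on \<Omega>. Re (u x) = Re (u' x)" by (rule eventually_mono[OF AE(1)]) simp
  moreover have "AE x in lebesgue_on \<Omega>. Re (h x) = Re (h' x)" by (rule eventually_mono[OF AE(2)]) simp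
  ultimately show "solves r (\<lambda>x. Re (h' x)) (\<lambda>x. Re (u' x))"
    using s unfolding csolves_def by (intro solves_cong[OF _ L2_Re[OF h(1)] L2_Re[OF h(2)] L2_Re[OF u']]) auto
  have "AE x in lebesgue_on \<Omega>. Im (u x) = Im (u' x)" by (rule eventually_mono[OF AE(1)]) simp
  moreover have "AE x in lebesgue_on \<Omega>. Im (h x) = Im (h' x)" by (rule eventually_mono[OF AE(2)]) simp
  ultimately show "solves r (\<lambda>x. Im (h' x)) (\<lambda>x. Im (u' x))"
    using s unfolding csolves_def by (intro solves_cong[OF _ L2_Im[OF h(1)] L2_Im[OF h(2)] L2_Im[OF u']]) auto
qed

lemma csolves_exists:
  assumes r: "r > 0" and h: "h \<in> L2 \<Omega>" shows "\<exists>u. csolves r h u"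
proof -
  obtain a b where "solves r (\<lambda>x. Re (h x)) a" "solves r (\<lambda>x. Im (h x)) b"
    using solution_exists[OF r L2_Re[OF h]] solution_exists[OF r L2_Im[OF h]] by blast
  then show ?thesis by (intro exI[of _ "\<lambda>x. Complex (a x) (b x)"]) (simp add: csolves_def)
qed

definition Res :: "real \<Rightarrow> ('a \<Rightarrow> complex) \<Rightarrow> 'a \<Rightarrow> complex" where
  "Res r h = (SOME u. csolves r h u)"

lemma csolves_Res: "r > 0 \<Longrightarrow> h \<in> L2 \<Omega> \<Longrightarrow> csolves r h (Res r h)"
  unfolding Res_def using csolves_exists by (rule someI_ex)

lemma Res_L2: "r > 0 \<Longrightarrow> h \<in> L2 \<Omega> \<Longrightarrow> Res r h \<in> L2 \<Omega>"
  using csolves_Res csolves_L2 by blast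

lemma csolves_norm:
  assumes s: "csolves r h u" and r: "r > 0" and h: "h \<in> L2 \<Omega>"
  shows "r * L2_norm \<Omega> u \<le> L2_norm \<Omega> h"
proof (rule power2_le_imp_le)
  have "r * L2_norm \<Omega> (\<lambda>x. Re (u x)) \<le> L2_norm \<Omega> (\<lambda>x. Re (h x))" "r * L2_norm \<Omega> (\<lambda>x. Im (u x)) \<le> L2_norm \<Omega> (\<lambda>x. Im (h x))"
    using s L2_Re[OF h] L2_Im[OF h] by (auto simp: csolves_def intro: solves_norm)
  then have "(r * L2_norm \<Omega> (\<lambda>x. Re (u x)))\<^sup>2 + (r * L2_norm \<Omega> (\<lambda>x. Im (u x)))\<^sup>2
      \<le> (L2_norm \<Omega> (\<lambda>x. Re (h x)))\<^sup>2 + (L2_norm \<Omega> (\<lambda>x. Im (h x)))\<^sup>2"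
    using r by (intro add_mono power_mono) auto
  then show "(r * L2_norm \<Omega> u)\<^sup>2 \<le> (L2_norm \<Omega> h)\<^sup>2"
    by (simp add: power_mult_distrib L2_norm_complex_sq[OF h] L2_norm_complex_sq[OF csolves_L2[OF s]] algebra_simps)
qed simp

text \<open>With \<open>r = \<bar>z\<bar>\<close>, \<open>\<alpha> = (1 + cnj z / r) / 2\<close> and \<open>R\<close> the resolvent at \<open>r\<close>, the equation
  \<open>(z - A) u = f\<close> is the fixed point equation \<open>u = (1 - \<alpha>) u + \<alpha> R (f - (z - r) u)\<close>. Its linear
  part is \<open>p - i k S\<close> with real \<open>p\<close>, \<open>k\<close>, where \<open>p\<^sup>2 + k\<^sup>2 = p = (1 - Re z / r) / 2 < 1\<close>, and
  \<open>S = 2 r R - 1\<close> is self-adjoint of norm at most 1. So it is a contraction.\<close>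

lemma contraction_estimate:
  assumes z: "cmod z = r" and r: "r > 0" and d: "d \<in> L2 \<Omega>" and s: "csolves r d e"
  shows "(L2_norm \<Omega> (\<lambda>x. (1 - cnj z / of_real r) / 2 * d x - \<i> * of_real (Im z) * e x))\<^sup>2
     \<le> (1 - Re z / r) / 2 * (L2_norm \<Omega> d)\<^sup>2"
proof -
  define p where "p = (1 - Re z / r) / 2"
  define k where "k = Im z / (2 * r)"
  have pk: "p\<^sup>2 + k\<^sup>2 = p"
  proof -
    have "(Re z)\<^sup>2 + (Im z)\<^sup>2 = r\<^sup>2" using z by (simp add: cmod_power2[symmetric])
    then have "(Im z)\<^sup>2 = r\<^sup>2 - (Re z)\<^sup>2" by simp
    then have k: "k\<^sup>2 = (1 - (Re z / r)\<^sup>2) / 4" using r by (simp add: k_def power_divide power_mult_distrib field_simps)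
    have "((1 - c) / 2)\<^sup>2 + (1 - c\<^sup>2) / 4 = (1 - c) / 2" for c :: real by (simp add: power2_eq_square field_simps)
    then show ?thesis unfolding k p_def .
  qed
  have kr: "Im z = 2 * r * k" using r by (simp add: k_def)
  have coef: "(1 - cnj z / of_real r) / 2 = Complex p k"
    using r by (auto simp: complex_eq_iff p_def k_def)
  let ?K = "\<lambda>x. (1 - cnj z / of_real r) / 2 * d x - \<i> * of_real (Im z) * e x"
  let ?d1 = "\<lambda>x. Re (d x)" and ?d2 = "\<lambda>x. Im (d x)" and ?e1 = "\<lambda>x. Re (e x)" and ?e2 = "\<lambda>x. Im (e x)"
  note eL = csolves_L2[OF s]
  have L: "?d1 \<in> L2 \<Omega>" "?d2 \<in> L2 \<Omega>" "?e1 \<in> L2 \<Omega>" "?e2 \<in> L2 \<Omega>"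
    using d eL by (auto intro: L2_Re L2_Im)
  have KL: "?K \<in> L2 \<Omega>" using d eL by (intro L2_diff L2_mult_complex)
  have re: "(\<lambda>x. Re (?K x)) = (\<lambda>x. p * ?d1 x + (- k) * ?d2 x + (2 * r * k) * ?e2 x)"
    and im: "(\<lambda>x. Im (?K x)) = (\<lambda>x. p * ?d2 x + k * ?d1 x + (- (2 * r * k)) * ?e1 x)"
    unfolding coef kr by (auto simp: fun_eq_iff)
  have expand: "L2_inner \<Omega> (\<lambda>x. a * f x + b * g x + c * h x) (\<lambda>x. a * f x + b * g x + c * h x)
      = a\<^sup>2 * L2_inner \<Omega> f f + b\<^sup>2 * L2_inner \<Omega> g g + c\<^sup>2 * L2_inner \<Omega> h h
        + 2 * a * b * L2_inner \<Omega> f g + 2 * a * c * L2_inner \<Omega> f h + 2 * b * c * L2_inner \<Omega> g h"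
    if "f \<in> L2 \<Omega>" "g \<in> L2 \<Omega>" "h \<in> L2 \<Omega>" for a b c and f g h :: "'a \<Rightarrow> real"
    using that by (simp only: L2_inner_add_left L2_inner_add_right L2_inner_cmult_left L2_inner_cmult_right L2_add L2_cmult
        L2_inner_commute[of \<Omega> g f] L2_inner_commute[of \<Omega> h f] L2_inner_commute[of \<Omega> h g])
      (simp add: power2_eq_square algebra_simps)
  \<comment> \<open>In the expanded square the terms with coefficient p k cancel, those with e by
    this symmetry. What is left besides (p^2 + k^2) |d|^2 is a nonnegative multiple of r |e|^2 - (d,
    e) in each component, which is at most 0.\<close>
  have sym: "L2_inner \<Omega> ?d1 ?e2 = L2_inner \<Omega> ?d2 ?e1"
    using s by (auto simp: csolves_def intro: solves_symmetric)
  have b: "r * L2_inner \<Omega> ?e1 ?e1 \<le> L2_inner \<Omega> ?d1 ?e1" "r * L2_inner \<Omega> ?e2 ?e2 \<le> L2_inner \<Omega> ?d2 ?e2"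
    using s by (auto simp: csolves_def intro: solves_bound)
  have "(L2_norm \<Omega> ?K)\<^sup>2 = (p\<^sup>2 + k\<^sup>2) * (L2_inner \<Omega> ?d1 ?d1 + L2_inner \<Omega> ?d2 ?d2)
      + 4 * r * k\<^sup>2 * ((r * L2_inner \<Omega> ?e1 ?e1 - L2_inner \<Omega> ?d1 ?e1) + (r * L2_inner \<Omega> ?e2 ?e2 - L2_inner \<Omega> ?d2 ?e2))"
    unfolding L2_norm_sq L2_norm_complex_sq[OF KL, unfolded L2_norm_sq] re im expand[OF L(1,2,4)] expand[OF L(2,1,3)] sym
      L2_inner_commute[of \<Omega> ?d2 ?d1]
    by (simp add: power2_eq_square algebra_simps)
  also have "\<dots> \<le> (p\<^sup>2 + k\<^sup>2) * (L2_inner \<Omega> ?d1 ?d1 + L2_inner \<Omega> ?d2 ?d2) + 0"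
    using b r by (intro add_left_mono mult_nonneg_nonpos) auto
  also have "\<dots> = p * (L2_norm \<Omega> d)\<^sup>2"
    unfolding pk L2_norm_complex_sq[OF d] by (simp add: L2_norm_sq)
  finally show ?thesis unfolding p_def .
qed

definition Phi :: "complex \<Rightarrow> ('a \<Rightarrow> complex) \<Rightarrow> ('a \<Rightarrow> complex) \<Rightarrow> 'a \<Rightarrow> complex" where
  "Phi z f u = (\<lambda>x. (1 - cnj z / of_real (cmod z)) / 2 * u x
     + (1 + cnj z / of_real (cmod z)) / 2 * Res (cmod z) (\<lambda>x. f x - (z - of_real (cmod z)) * u x) x)"

text \<open>Square root of the number p above, because \<open>contraction_estimate\<close> bounds a
  squared norm. For z = r exp(i a) it equals |sin (a/2)|.\<close>

definition rate :: "complex \<Rightarrow> real" where "rate z = sqrt ((1 - Re z / cmod z) / 2)"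

lemma rate_bounds:
  assumes "z \<notin> \<real>\<^sub>\<le>\<^sub>0" shows "0 \<le> rate z" "rate z < 1"
proof -
  have z0: "cmod z > 0" using assms by auto
  have "Re z / cmod z \<le> 1" using z0 complex_Re_le_cmod[of z] by simp
  then show "0 \<le> rate z" by (simp add: rate_def)
  have "- cmod z < Re z"
  proof (rule ccontr)
    assume "\<not> ?thesis"
    then have "Re z = - cmod z" using abs_Re_le_cmod[of z] by simp
    then have "(Re z)\<^sup>2 = (cmod z)\<^sup>2" by simp
    then have "Im z = 0" by (simp add: cmod_power2)
    moreover have "Re z \<le> 0" using \<open>Re z = - cmod z\<close> by simp
    ultimately show False using assms by (simp add: complex_nonpos_Reals_iff)
  qed
  then have "(1 - Re z / cmod z) / 2 < 1" using z0 by (simp add: field_simps)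
  then show "rate z < 1" by (simp add: rate_def real_sqrt_lt_1_iff)
qed

lemma Phi_L2:
  assumes "z \<notin> \<real>\<^sub>\<le>\<^sub>0" "f \<in> L2 \<Omega>" "u \<in> L2 \<Omega>" shows "Phi z f u \<in> L2 \<Omega>"
proof -
  have "cmod z > 0" using assms(1) by auto
  then show ?thesis unfolding Phi_def
    by (intro L2_add L2_mult_complex Res_L2 L2_diff assms)
qed

lemma Phi_lipschitz:
  assumes z: "z \<notin> \<real>\<^sub>\<le>\<^sub>0" and f: "f \<in> L2 \<Omega>" and u: "u \<in> L2 \<Omega>" and v: "v \<in> L2 \<Omega>"
  shows "L2_norm \<Omega> (\<lambda>x. Phi z f u x - Phi z f v x) \<le> rate z * L2_norm \<Omega> (\<lambda>x. u x - v x)"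
proof -
  define r where "r = cmod z"
  have r: "r > 0" using z by (auto simp: r_def)
  define \<beta> where "\<beta> = z - of_real r"
  define A where "A = Res r (\<lambda>x. f x - \<beta> * u x)"
  define B where "B = Res r (\<lambda>x. f x - \<beta> * v x)"
  define d where "d = (\<lambda>x. u x - v x)"
  define e where "e = Res r d"
  have dL: "d \<in> L2 \<Omega>" unfolding d_def using u v by (rule L2_diff)
  have hu: "(\<lambda>x. f x - \<beta> * u x) \<in> L2 \<Omega>" and hv: "(\<lambda>x. f x - \<beta> * v x) \<in> L2 \<Omega>"
    by (intro L2_diff L2_mult_complex f u v)+
  have A: "csolves r (\<lambda>x. f x - \<beta> * u x) A" and B: "csolves r (\<lambda>x. f x - \<beta> * v x) B"
    unfolding A_def B_def by (intro csolves_Res r hu hv)+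
  have e: "csolves r d e" unfolding e_def by (rule csolves_Res[OF r dL])
  have "csolves r (\<lambda>x. - \<beta> * d x) (\<lambda>x. A x - B x)"
  proof -
    have "(\<lambda>x. - \<beta> * d x) = (\<lambda>x. (f x - \<beta> * u x) - (f x - \<beta> * v x))"
      by (simp add: d_def algebra_simps)
    then show ?thesis using csolves_diff[OF A B hu hv] by simp
  qed
  \<comment> \<open>Both sides solve the same equation at r; since \<open>Res\<close> is a choice of
    representatives, linearity holds only almost everywhere.\<close>
  then have AE: "AE x in lebesgue_on \<Omega>. A x - B x = - \<beta> * e x"
    by (rule csolves_unique[OF _ csolves_mult[OF e dL] r L2_mult_complex[OF dL]])
  \<comment> \<open>From cnj z * z = r^2 one gets (1 + cnj z / r) (z - r) = z - cnj z. The factor in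
    front of the resolvent thus becomes purely imaginary, which brings the linear part into the form
    of \<open>contraction_estimate\<close>.\<close>
  have \<beta>: "(1 + cnj z / of_real r) / 2 * \<beta> = \<i> * of_real (Im z)"
  proof -
    have "cnj z * z = of_real r * of_real r"
      using complex_norm_square[of z] by (simp add: r_def power2_eq_square mult.commute)
    then have "(1 + cnj z / of_real r) * \<beta> = z - cnj z"
      using r by (simp add: \<beta>_def field_simps)
    also have "\<dots> = 2 * (\<i> * of_real (Im z))" by (simp add: complex_eq_iff)
    finally show ?thesis by simp
  qed
  note PL = Phi_L2[OF z f u] Phi_L2[OF z f v]
  have "L2_norm \<Omega> (\<lambda>x. Phi z f u x - Phi z f v x)
      = L2_norm \<Omega> (\<lambda>x. (1 - cnj z / of_real r) / 2 * d x - \<i> * of_real (Im z) * e x)"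
  proof (rule L2_norm_cong_AE)
    show "AE x in lebesgue_on \<Omega>. Phi z f u x - Phi z f v x
        = (1 - cnj z / of_real r) / 2 * d x - \<i> * of_real (Im z) * e x"
      using AE
    proof eventually_elim
      case (elim x)
      have "Phi z f u x - Phi z f v x = (1 - cnj z / of_real r) / 2 * d x + (1 + cnj z / of_real r) / 2 * (A x - B x)"
        unfolding Phi_def A_def B_def d_def \<beta>_def r_def by (simp only: right_diff_distrib) simp
      also have "\<dots> = (1 - cnj z / of_real r) / 2 * d x - ((1 + cnj z / of_real r) / 2 * \<beta>) * e x"
        unfolding elim by simp
      finally show ?case unfolding \<beta> .
    qed
    show "(\<lambda>x. Phi z f u x - Phi z f v x) \<in> borel_measurable (lebesgue_on \<Omega>)"
      by (rule L2_measurable[OF L2_diff[OF PL]])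
    show "(\<lambda>x. (1 - cnj z / of_real r) / 2 * d x - \<i> * of_real (Im z) * e x) \<in> borel_measurable (lebesgue_on \<Omega>)"
      by (intro L2_measurable L2_diff L2_mult_complex dL csolves_L2[OF e])
  qed
  also have "\<dots> \<le> rate z * L2_norm \<Omega> d"
  proof (rule power2_le_imp_le)
    have "(rate z)\<^sup>2 = (1 - Re z / r) / 2"
      using rate_bounds(1)[OF z] complex_Re_le_cmod[of z] r by (simp add: rate_def r_def)
    then show "(L2_norm \<Omega> (\<lambda>x. (1 - cnj z / of_real r) / 2 * d x - \<i> * of_real (Im z) * e x))\<^sup>2 \<le> (rate z * L2_norm \<Omega> d)\<^sup>2"
      using contraction_estimate[OF r_def[symmetric] r dL e] by (simp only: power_mult_distrib)
  qed (simp add: rate_bounds(1)[OF z])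
  finally show ?thesis by (simp add: d_def)
qed

text \<open>\<open>Phi\<close> moves u towards the resolvent by the factor \<alpha>, which vanishes
  only for z = -r; off the half-line its fixed points are therefore the solutions.\<close>

lemma resolvent_eq_iff_fixed_point:
  assumes z: "z \<notin> \<real>\<^sub>\<le>\<^sub>0" and f: "f \<in> L2 \<Omega>"
  shows "resolvent_eq \<Omega> lap z f u \<longleftrightarrow> u \<in> L2 \<Omega> \<and> (AE x in lebesgue_on \<Omega>. u x = Phi z f u x)"
proof -
  define r where "r = cmod z"
  have r: "r > 0" using z by (auto simp: r_def)
  define \<alpha> where "\<alpha> = (1 + cnj z / of_real r) / 2"
  have \<alpha>: "\<alpha> \<noteq> 0"
  proof
    assume "\<alpha> = 0"
    then have "cnj z = - of_real r" using r by (simp add: \<alpha>_def field_simps add_eq_0_iff)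
    then have "z = - of_real r" by (metis complex_cnj_cnj complex_cnj_minus complex_cnj_complex_of_real)
    then show False using z r by (simp add: complex_nonpos_Reals_iff)
  qed
  have Phi: "Phi z f u x = u x + \<alpha> * (Res r (\<lambda>x. f x - (z - of_real r) * u x) x - u x)" for x
    unfolding Phi_def \<alpha>_def r_def by (simp add: field_simps)
  have eq: "u x = Phi z f u x \<longleftrightarrow> Res r (\<lambda>x. f x - (z - of_real r) * u x) x = u x" for x
    unfolding Phi using \<alpha> by auto
  have hL: "(\<lambda>x. f x - (z - of_real r) * u x) \<in> L2 \<Omega>" if "u \<in> L2 \<Omega>"
    by (intro L2_diff L2_mult_complex f that)
  show ?thesis unfolding resolvent_eq_iff[OF f, where r=r] eq
  proof (intro iffI conjI; (elim conjE)?)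
    assume s: "csolves r (\<lambda>x. f x - (z - of_real r) * u x) u"
    then show u: "u \<in> L2 \<Omega>" by (rule csolves_L2)
    show "AE x in lebesgue_on \<Omega>. Res r (\<lambda>x. f x - (z - of_real r) * u x) x = u x"
      by (rule csolves_unique[OF csolves_Res[OF r hL[OF u]] s r hL[OF u]])
  next
    assume u: "u \<in> L2 \<Omega>" and AE: "AE x in lebesgue_on \<Omega>. Res r (\<lambda>x. f x - (z - of_real r) * u x) x = u x"
    show "csolves r (\<lambda>x. f x - (z - of_real r) * u x) u"
      by (rule csolves_cong[OF csolves_Res[OF r hL[OF u]] u hL[OF u] hL[OF u] AE]) simp
  qed
qed

text \<open>The a posteriori estimate of the contraction principle. It yields uniqueness with v
  another solution, boundedness of the resolvent with v = 0, and convergence with v the limiting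
  resolvent.\<close>

lemma fixed_point_norm:
  assumes z: "z \<notin> \<real>\<^sub>\<le>\<^sub>0" and f: "f \<in> L2 \<Omega>" and u: "resolvent_eq \<Omega> lap z f u" and v: "v \<in> L2 \<Omega>"
  shows "(1 - rate z) * L2_norm \<Omega> (\<lambda>x. u x - v x) \<le> L2_norm \<Omega> (\<lambda>x. Phi z f v x - v x)"
proof -
  have uL: "u \<in> L2 \<Omega>" and AE: "AE x in lebesgue_on \<Omega>. u x = Phi z f u x"
    using u resolvent_eq_iff_fixed_point[OF z f] by auto
  note PL = Phi_L2[OF z f uL] Phi_L2[OF z f v]
  have "L2_norm \<Omega> (\<lambda>x. u x - v x) = L2_norm \<Omega> (\<lambda>x. Phi z f u x - v x)"
    by (rule L2_norm_cong_AE[OF L2_measurable[OF L2_diff[OF uL v]] L2_measurable[OF L2_diff[OF PL(1) v]]])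
       (use AE in \<open>auto elim!: eventually_mono\<close>)
  also have "\<dots> \<le> L2_norm \<Omega> (\<lambda>x. Phi z f u x - Phi z f v x) + L2_norm \<Omega> (\<lambda>x. Phi z f v x - v x)"
    by (rule L2_norm_triangle3[OF PL v])
  also have "\<dots> \<le> rate z * L2_norm \<Omega> (\<lambda>x. u x - v x) + L2_norm \<Omega> (\<lambda>x. Phi z f v x - v x)"
    using Phi_lipschitz[OF z f uL v] by simp
  finally show ?thesis by (simp add: algebra_simps)
qed

text \<open>Contraction principle by iteration from 0. \<open>L2_norm\<close> is a seminorm on
  representatives, so the limit is a fixed point only almost everywhere, which is all that the
  characterisation asks.\<close>

lemma resolvent_eq_exists:
  assumes z: "z \<notin> \<real>\<^sub>\<le>\<^sub>0" and f: "f \<in> L2 \<Omega>"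
  shows "\<exists>u. resolvent_eq \<Omega> lap z f u"
proof -
  define s where "s k = (Phi z f ^^ k) (\<lambda>x. 0)" for k
  have s_Suc: "s (Suc k) = Phi z f (s k)" for k by (simp add: s_def)
  have sL: "s k \<in> L2 \<Omega>" for k
    by (induction k) (simp_all add: s_def[of 0] s_Suc Phi_L2[OF z f])
  note \<rho> = rate_bounds[OF z]
  define C where "C = L2_norm \<Omega> (\<lambda>x. Phi z f (s 0) x - s 0 x)"
  have step: "L2_norm \<Omega> (\<lambda>x. Phi z f (s k) x - s k x) \<le> C * rate z ^ k" for k
  proof (induction k)
    case (Suc k)
    have "L2_norm \<Omega> (\<lambda>x. Phi z f (s (Suc k)) x - s (Suc k) x) \<le> rate z * L2_norm \<Omega> (\<lambda>x. s (Suc k) x - s k x)"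
      using Phi_lipschitz[OF z f sL[of "Suc k"] sL[of k]] by (simp add: s_Suc[of k])
    also have "\<dots> \<le> rate z * (C * rate z ^ k)"
      using Suc \<rho> by (intro mult_left_mono) (simp_all add: s_Suc)
    finally show ?case by (simp add: mult_ac)
  qed (simp add: C_def)
  have lim0: "(\<lambda>k. C * rate z ^ k) \<longlonglongrightarrow> 0"
    using tendsto_mult[OF tendsto_const[of C] LIMSEQ_power_zero[of "rate z"]] \<rho> by simp
  have diff: "(1 - rate z) * L2_norm \<Omega> (\<lambda>x. s m x - s n x) \<le> C * rate z ^ m + C * rate z ^ n" for m n
  proof -
    note P = Phi_L2[OF z f sL[of m]] Phi_L2[OF z f sL[of n]]
    have "L2_norm \<Omega> (\<lambda>x. s m x - s n x) \<le> L2_norm \<Omega> (\<lambda>x. s m x - Phi z f (s m) x) + L2_norm \<Omega> (\<lambda>x. Phi z f (s m) x - s n x)"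
      by (rule L2_norm_triangle3[OF sL P(1) sL])
    moreover have "L2_norm \<Omega> (\<lambda>x. Phi z f (s m) x - s n x)
        \<le> L2_norm \<Omega> (\<lambda>x. Phi z f (s m) x - Phi z f (s n) x) + L2_norm \<Omega> (\<lambda>x. Phi z f (s n) x - s n x)"
      by (rule L2_norm_triangle3[OF P sL])
    moreover have "L2_norm \<Omega> (\<lambda>x. s m x - Phi z f (s m) x) = L2_norm \<Omega> (\<lambda>x. Phi z f (s m) x - s m x)"
      by (rule L2_norm_minus_commute)
    ultimately show ?thesis
      using step[of m] step[of n] Phi_lipschitz[OF z f sL[of m] sL[of n]] by (simp add: algebra_simps)
  qed
  have "\<exists>M. \<forall>m\<ge>M. \<forall>n\<ge>M. L2_norm \<Omega> (\<lambda>x. s m x - s n x) < e" if e: "e > 0" for e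
  proof -
    have "\<forall>\<^sub>F k in sequentially. C * rate z ^ k < (1 - rate z) * e / 2"
      using e \<rho> by (intro order_tendstoD[OF lim0]) simp
    then obtain M where M: "\<And>k. k \<ge> M \<Longrightarrow> C * rate z ^ k < (1 - rate z) * e / 2" by (auto simp: eventually_sequentially)
    have "L2_norm \<Omega> (\<lambda>x. s m x - s n x) < e" if "m \<ge> M" "n \<ge> M" for m n
    proof -
      have "(1 - rate z) * L2_norm \<Omega> (\<lambda>x. s m x - s n x) < (1 - rate z) * e"
        using diff[of m n] M[OF that(1)] M[OF that(2)] by linarith
      then show ?thesis using \<rho> by simp
    qed
    then show ?thesis by blast
  qed
  then obtain u where u: "u \<in> L2 \<Omega>" "(\<lambda>k. L2_norm \<Omega> (\<lambda>x. s k x - u x)) \<longlonglongrightarrow> 0"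
    using L2_complete[of s \<Omega>, OF sL] by blast
  have PuL: "Phi z f u \<in> L2 \<Omega>" by (rule Phi_L2[OF z f u(1)])
  have le: "L2_norm \<Omega> (\<lambda>x. Phi z f u x - u x)
      \<le> rate z * L2_norm \<Omega> (\<lambda>x. s k x - u x) + C * rate z ^ k + L2_norm \<Omega> (\<lambda>x. s k x - u x)" for k
  proof -
    note P = Phi_L2[OF z f sL[of k]]
    have "L2_norm \<Omega> (\<lambda>x. Phi z f u x - u x) \<le> L2_norm \<Omega> (\<lambda>x. Phi z f u x - Phi z f (s k) x) + L2_norm \<Omega> (\<lambda>x. Phi z f (s k) x - u x)"
      by (rule L2_norm_triangle3[OF PuL P u(1)])
    moreover have "L2_norm \<Omega> (\<lambda>x. Phi z f (s k) x - u x) \<le> L2_norm \<Omega> (\<lambda>x. Phi z f (s k) x - s k x) + L2_norm \<Omega> (\<lambda>x. s k x - u x)"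
      by (rule L2_norm_triangle3[OF P sL u(1)])
    moreover have "L2_norm \<Omega> (\<lambda>x. u x - s k x) = L2_norm \<Omega> (\<lambda>x. s k x - u x)"
      by (rule L2_norm_minus_commute)
    ultimately show ?thesis using step[of k] Phi_lipschitz[OF z f u(1) sL[of k]] by simp
  qed
  have "(\<lambda>k. rate z * L2_norm \<Omega> (\<lambda>x. s k x - u x) + C * rate z ^ k + L2_norm \<Omega> (\<lambda>x. s k x - u x)) \<longlonglongrightarrow> rate z * 0 + 0 + 0"
    by (intro tendsto_add tendsto_mult tendsto_const u(2) lim0)
  then have "L2_norm \<Omega> (\<lambda>x. Phi z f u x - u x) \<le> rate z * 0 + 0 + 0"
    by (rule LIMSEQ_le_const) (use le in blast)
  then have "L2_norm \<Omega> (\<lambda>x. Phi z f u x - u x) = 0"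
    using L2_norm_nonneg[of \<Omega> "\<lambda>x. Phi z f u x - u x"] by linarith
  then have "AE x in lebesgue_on \<Omega>. Phi z f u x = u x"
    using L2_norm_diff_eq_0_iff[OF PuL u(1)] by simp
  then have "AE x in lebesgue_on \<Omega>. u x = Phi z f u x" by eventually_elim simp
  then show ?thesis using u(1) resolvent_eq_iff_fixed_point[OF z f] by blast
qed

lemma in_resolvent_set_lap:
  assumes z: "z \<notin> \<real>\<^sub>\<le>\<^sub>0" shows "in_resolvent_set \<Omega> lap z"
  unfolding in_resolvent_set_def
proof (intro conjI)
  note \<rho> = rate_bounds[OF z]
  show "\<forall>f\<in>L2 \<Omega>. \<exists>u. resolvent_eq \<Omega> lap z f u" using resolvent_eq_exists[OF z] by blast
  show "\<forall>f\<in>L2 \<Omega>. \<forall>u v. resolvent_eq \<Omega> lap z f u \<longrightarrow> resolvent_eq \<Omega> lap z f v \<longrightarrow>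
      (AE x in lebesgue_on \<Omega>. u x = v x)"
  proof (intro ballI allI impI)
    fix f u v :: "'a \<Rightarrow> complex" assume f: "f \<in> L2 \<Omega>" and u: "resolvent_eq \<Omega> lap z f u" and v: "resolvent_eq \<Omega> lap z f v"
    have L: "u \<in> L2 \<Omega>" "v \<in> L2 \<Omega>" and AE: "AE x in lebesgue_on \<Omega>. v x = Phi z f v x"
      using u v resolvent_eq_iff_fixed_point[OF z f] by auto
    have "L2_norm \<Omega> (\<lambda>x. Phi z f v x - v x) = 0"
      unfolding L2_norm_diff_eq_0_iff[OF Phi_L2[OF z f L(2)] L(2)] using AE by eventually_elim simp
    then have "(1 - rate z) * L2_norm \<Omega> (\<lambda>x. u x - v x) \<le> 0" using fixed_point_norm[OF z f u L(2)] by simp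
    then have "L2_norm \<Omega> (\<lambda>x. u x - v x) = 0"
      using \<rho> L2_norm_nonneg[of \<Omega> "\<lambda>x. u x - v x"] by (simp add: mult_le_0_iff)
    then show "AE x in lebesgue_on \<Omega>. u x = v x" using L2_norm_diff_eq_0_iff[OF L] by simp
  qed
  define r where "r = cmod z"
  have r: "r > 0" using z by (auto simp: r_def)
  define \<alpha> where "\<alpha> = (1 + cnj z / of_real r) / 2"
  show "\<exists>C. \<forall>f\<in>L2 \<Omega>. \<forall>u. resolvent_eq \<Omega> lap z f u \<longrightarrow> L2_norm \<Omega> u \<le> C * L2_norm \<Omega> f"
  proof (intro exI[of _ "cmod \<alpha> / (r * (1 - rate z))"] ballI allI impI)
    fix f u :: "'a \<Rightarrow> complex" assume f: "f \<in> L2 \<Omega>" and u: "resolvent_eq \<Omega> lap z f u"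
    have z0: "(\<lambda>x. 0) \<in> L2 \<Omega>" by simp
    have "Phi z f (\<lambda>x. 0) = (\<lambda>x. \<alpha> * Res r f x)" unfolding Phi_def \<alpha>_def r_def by simp
    then have "(1 - rate z) * L2_norm \<Omega> u \<le> cmod \<alpha> * L2_norm \<Omega> (Res r f)"
      using fixed_point_norm[OF z f u z0] by (simp add: L2_norm_mult_complex)
    also have "\<dots> \<le> cmod \<alpha> * (L2_norm \<Omega> f / r)"
      using csolves_norm[OF csolves_Res[OF r f] r f] r by (intro mult_left_mono) (auto simp: field_simps)
    finally show "L2_norm \<Omega> u \<le> cmod \<alpha> / (r * (1 - rate z)) * L2_norm \<Omega> f"
      using \<rho> r by (simp add: field_simps)
  qed
qed

lemma resolvent_eq_resolvent:
  assumes "z \<notin> \<real>\<^sub>\<le>\<^sub>0" "f \<in> L2 \<Omega>" shows "resolvent_eq \<Omega> lap z f (resolvent \<Omega> lap z f)"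
  unfolding resolvent_def by (rule someI_ex[OF resolvent_eq_exists[OF assms]])

end

text \<open>A near-minimiser v of the limiting functional is eventually a near-minimiser of the n-th
  one, as both J(v) and the minima converge. So one v is close to all late resolvents and to the
  limiting one. This settles real points; complex points follow from
  \<open>fixed_point_norm\<close>.\<close>

theorem strong_resolvent_convI:
  fixes q :: "nat \<Rightarrow> ('a::euclidean_space \<Rightarrow> real) \<Rightarrow> ('a \<Rightarrow> real) \<Rightarrow> real"
  assumes cn: "\<And>n. closable_form \<Omega> V (q n)" and c: "closable_form \<Omega> V q'"
    and lim: "\<And>v. v \<in> V \<Longrightarrow> (\<lambda>n. q n v v) \<longlonglongrightarrow> q' v v"
    and min: "\<And>r f. r > 0 \<Longrightarrow> f \<in> L2 \<Omega> \<Longrightarrow>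
      (\<lambda>n. quadratic_form.jmin \<Omega> V (q n) r f) \<longlonglongrightarrow> quadratic_form.jmin \<Omega> V q' r f"
  shows "strong_resolvent_conv \<Omega> (\<lambda>n. closable_form.lap \<Omega> V (q n)) (closable_form.lap \<Omega> V q')"
proof -
  interpret N: closable_form \<Omega> V "q n" for n by (rule cn)
  interpret L: closable_form \<Omega> V q' by (rule c)
  have real_conv: "(\<lambda>n. L2_norm \<Omega> (\<lambda>x. w n x - u x)) \<longlonglongrightarrow> 0"
    if r: "r > 0" and f: "f \<in> L2 \<Omega>" and w: "\<And>n. N.solves n r f (w n)" and u: "L.solves r f u" for r f w u
  proof (rule tendstoI)
    fix e :: real assume e: "e > 0"
    \<comment> \<open>For large n the excess of J at v is below 2 d, and
      \<open>solves_near_minimiser\<close> doubles it; r a^2 < 4 d = r (e/2)^2 then gives a <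
      e/2.\<close>
    define d where "d = r * e\<^sup>2 / 16"
    have d: "d > 0" using r e by (simp add: d_def)
    have sq: "a < e / 2" if "r * a\<^sup>2 < 4 * d" for a
    proof (rule power2_less_imp_less)
      have "r * a\<^sup>2 < r * (e / 2)\<^sup>2" using that by (simp add: d_def power2_eq_square mult_ac)
      then show "a\<^sup>2 < (e / 2)\<^sup>2" using r by simp
    qed (use e in simp)
    obtain v where v: "v \<in> V" "L.J r f v < L.jmin r f + d" using L.jmin_approx[OF d] by blast
    have "(\<lambda>n. N.J n r f v - N.jmin n r f) \<longlonglongrightarrow> L.J r f v - L.jmin r f"
      unfolding N.J_def L.J_def by (intro tendsto_diff tendsto_add tendsto_const lim v min r f)
    then have "\<forall>\<^sub>F n in sequentially. N.J n r f v - N.jmin n r f < 2 * d"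
      using v(2) d by (intro order_tendstoD) auto
    then show "\<forall>\<^sub>F n in sequentially. dist (L2_norm \<Omega> (\<lambda>x. w n x - u x)) 0 < e"
    proof eventually_elim
      case (elim n)
      note LL = N.solves_L2[OF w] L.solves_L2[OF u] L.V_in_L2[OF v(1)]
      have "r * (L2_norm \<Omega> (\<lambda>x. v x - w n x))\<^sup>2 < 4 * d"
        by (rule le_less_trans[OF N.solves_near_minimiser[OF r f w v(1)]]) (use elim in simp)
      moreover have "r * (L2_norm \<Omega> (\<lambda>x. v x - u x))\<^sup>2 < 4 * d"
        by (rule le_less_trans[OF L.solves_near_minimiser[OF r f u v(1)]]) (use v(2) d in simp)
      ultimately have "L2_norm \<Omega> (\<lambda>x. v x - w n x) < e / 2" "L2_norm \<Omega> (\<lambda>x. v x - u x) < e / 2"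
        using sq by blast+
      then show ?case
        using L2_norm_triangle3[OF LL(1) LL(3) LL(2), of n] L2_norm_minus_commute[of \<Omega> "w n" v] by simp
    qed
  qed
  have Res_conv: "(\<lambda>n. L2_norm \<Omega> (\<lambda>x. N.Res n r h x - L.Res r h x)) \<longlonglongrightarrow> 0"
    if r: "r > 0" and h: "h \<in> L2 \<Omega>" for r h
  proof -
    note cs = N.csolves_Res[OF r h, unfolded N.csolves_def] L.csolves_Res[OF r h, unfolded L.csolves_def]
    have dL: "(\<lambda>x. N.Res n r h x - L.Res r h x) \<in> L2 \<Omega>" for n
      by (intro L2_diff N.Res_L2 L.Res_L2 r h)
    have "(\<lambda>n. L2_norm \<Omega> (\<lambda>x. Re (N.Res n r h x) - Re (L.Res r h x))
        + L2_norm \<Omega> (\<lambda>x. Im (N.Res n r h x) - Im (L.Res r h x))) \<longlonglongrightarrow> 0 + 0"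
      using cs by (intro tendsto_add real_conv[OF r L2_Re[OF h]] real_conv[OF r L2_Im[OF h]]) auto
    then have l: "(\<lambda>n. L2_norm \<Omega> (\<lambda>x. Re (N.Res n r h x) - Re (L.Res r h x))
        + L2_norm \<Omega> (\<lambda>x. Im (N.Res n r h x) - Im (L.Res r h x))) \<longlonglongrightarrow> 0" by simp
    show ?thesis
      using L2_norm_complex_le[OF dL] by (intro Lim_null_comparison[OF _ l]) simp
  qed
  show ?thesis unfolding strong_resolvent_conv_def
  proof (intro allI impI conjI ballI)
    fix z :: complex assume z: "z \<notin> \<real>\<^sub>\<le>\<^sub>0"
    show "in_resolvent_set \<Omega> (N.lap n) z" for n by (rule N.in_resolvent_set_lap[OF z])
    show "in_resolvent_set \<Omega> L.lap z" by (rule L.in_resolvent_set_lap[OF z])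
    fix f :: "'a \<Rightarrow> complex" assume f: "f \<in> L2 \<Omega>"
    define r where "r = cmod z"
    have r: "r > 0" using z by (auto simp: r_def)
    define \<alpha> where "\<alpha> = (1 + cnj z / of_real r) / 2"
    define u where "u = resolvent \<Omega> L.lap z f"
    define w where "w n = resolvent \<Omega> (N.lap n) z f" for n
    have u: "resolvent_eq \<Omega> L.lap z f u" unfolding u_def by (rule L.resolvent_eq_resolvent[OF z f])
    have w: "resolvent_eq \<Omega> (N.lap n) z f (w n)" for n unfolding w_def by (rule N.resolvent_eq_resolvent[OF z f])
    have uL: "u \<in> L2 \<Omega>" and AE: "AE x in lebesgue_on \<Omega>. u x = L.Phi z f u x"
      using u L.resolvent_eq_iff_fixed_point[OF z f] by auto
    define h where "h x = f x - (z - of_real r) * u x" for x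
    have h: "h \<in> L2 \<Omega>" unfolding h_def by (intro L2_diff L2_mult_complex f uL)
    note \<rho> = L.rate_bounds[OF z]
    \<comment> \<open>The argument h of the real resolvent depends only on the limit solution u, so
      inserting u into the n-th map leaves just the difference of two real resolvents of the same
      h.\<close>
    have eq: "L2_norm \<Omega> (\<lambda>x. N.Phi n z f u x - u x) = cmod \<alpha> * L2_norm \<Omega> (\<lambda>x. N.Res n r h x - L.Res r h x)" for n
    proof -
      have "L2_norm \<Omega> (\<lambda>x. N.Phi n z f u x - u x) = L2_norm \<Omega> (\<lambda>x. N.Phi n z f u x - L.Phi z f u x)"
        by (rule L2_norm_cong_AE[OF L2_measurable[OF L2_diff[OF N.Phi_L2[OF z f uL] uL]]
              L2_measurable[OF L2_diff[OF N.Phi_L2[OF z f uL] L.Phi_L2[OF z f uL]]]])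
           (use AE in \<open>auto elim!: eventually_mono\<close>)
      also have "(\<lambda>x. N.Phi n z f u x - L.Phi z f u x) = (\<lambda>x. \<alpha> * (N.Res n r h x - L.Res r h x))"
        unfolding N.Phi_def L.Phi_def \<alpha>_def h_def r_def by (simp add: right_diff_distrib)
      finally show ?thesis by (simp add: L2_norm_mult_complex)
    qed
    have le: "L2_norm \<Omega> (\<lambda>x. w n x - u x) \<le> cmod \<alpha> / (1 - L.rate z) * L2_norm \<Omega> (\<lambda>x. N.Res n r h x - L.Res r h x)" for n
    proof -
      have "(1 - L.rate z) * L2_norm \<Omega> (\<lambda>x. w n x - u x) \<le> cmod \<alpha> * L2_norm \<Omega> (\<lambda>x. N.Res n r h x - L.Res r h x)"
        using N.fixed_point_norm[OF z f w uL, of n] unfolding eq .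
      then show ?thesis using \<rho> by (simp add: field_simps)
    qed
    have "(\<lambda>n. cmod \<alpha> / (1 - L.rate z) * L2_norm \<Omega> (\<lambda>x. N.Res n r h x - L.Res r h x)) \<longlonglongrightarrow> cmod \<alpha> / (1 - L.rate z) * 0"
      by (intro tendsto_mult tendsto_const Res_conv r h)
    then have l: "(\<lambda>n. cmod \<alpha> / (1 - L.rate z) * L2_norm \<Omega> (\<lambda>x. N.Res n r h x - L.Res r h x)) \<longlonglongrightarrow> 0" by simp
    show "(\<lambda>n. L2_norm \<Omega> (\<lambda>x. resolvent \<Omega> (N.lap n) z f x - resolvent \<Omega> L.lap z f x)) \<longlonglongrightarrow> 0"
      unfolding u_def[symmetric] w_def[symmetric]
      by (rule Lim_null_comparison[OF _ l]) (use le in simp)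
  qed
qed

section \<open>The core of the form\<close>

context bounded_domain
begin

text \<open>On the compact closure of a bounded set compact support is automatic, so only continuity
  is kept from \<open>C_c\<close>.\<close>

definition core :: "('a \<Rightarrow> real) set" where
  "core = {u \<in> H1 \<Omega>. continuous_on (closure \<Omega>) u}"

lemma compact_closure_domain: "compact (closure \<Omega>)"
  using bounded_domain by (simp add: compact_closure)

lemma core_eq: "H1 \<Omega> \<inter> C_c (closure \<Omega>) = core"
  unfolding core_def C_c_def using compact_closure_domain by blast

lemma core_H1: "u \<in> core \<Longrightarrow> u \<in> H1 \<Omega>"
  and core_continuous: "u \<in> core \<Longrightarrow> continuous_on (closure \<Omega>) u"
  by (auto simp: core_def)

lemma core_L2: "u \<in> core \<Longrightarrow> u \<in> L2 \<Omega>"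
  using core_H1 H1_L2 by blast

lemma core_bounded:
  assumes "u \<in> core" obtains M where "M \<ge> 0" "\<And>x. x \<in> closure \<Omega> \<Longrightarrow> \<bar>u x\<bar> \<le> M"
proof -
  have "bounded (u ` closure \<Omega>)"
    using compact_continuous_image[OF core_continuous[OF assms] compact_closure_domain] by (rule compact_imp_bounded)
  then obtain B where B: "\<And>x. x \<in> closure \<Omega> \<Longrightarrow> \<bar>u x\<bar> \<le> B" unfolding bounded_iff real_norm_def by blast
  show thesis by (rule that[of "max 0 B"]) (use B in \<open>auto simp: le_max_iff_disj\<close>)
qed

lemma core_lincomb: "u \<in> core \<Longrightarrow> v \<in> core \<Longrightarrow> (\<lambda>x. c * u x + d * v x) \<in> core"
  unfolding core_def by (auto intro!: H1_lincomb continuous_intros)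

lemma core_diff: "u \<in> core \<Longrightarrow> v \<in> core \<Longrightarrow> (\<lambda>x. u x - v x) \<in> core"
  using core_lincomb[of u v 1 "-1"] by simp

lemma is_weak_gradient_zero: "is_weak_gradient \<Omega> (\<lambda>x. 0) (\<lambda>x. 0)"
  by (simp add: is_weak_gradient_def)

lemma core_zero: "(\<lambda>x. 0) \<in> core"
  unfolding core_def using weak_gradient_eqI(1)[OF _ _ is_weak_gradient_zero] by simp

lemma core_compose:
  fixes F F' :: "real \<Rightarrow> real"
  assumes u: "u \<in> core" and F: "\<And>t. (F has_real_derivative F' t) (at t)" and F': "continuous_on UNIV F'"
  shows "(\<lambda>x. F (u x)) \<in> core"
    and "AE x in lebesgue_on \<Omega>. weak_gradient \<Omega> (\<lambda>x. F (u x)) x = F' (u x) *\<^sub>R weak_gradient \<Omega> u x"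
proof -
  note uH = core_H1[OF u] and uc = core_continuous[OF u]
  have contF: "continuous_on UNIV F"
    using DERIV_isCont[OF F] by (simp add: continuous_on_eq_continuous_at)
  have Fc: "continuous_on (closure \<Omega>) (\<lambda>x. F (u x))" and F'c: "continuous_on (closure \<Omega>) (\<lambda>x. F' (u x))"
    by (auto intro!: continuous_on_compose2[OF contF uc] continuous_on_compose2[OF F' uc])
  have bdd: "\<exists>C. \<forall>x\<in>\<Omega>. \<bar>G x\<bar> \<le> C" if "continuous_on (closure \<Omega>) G" for G :: "'a \<Rightarrow> real"
  proof -
    have "bounded (G ` closure \<Omega>)"
      using compact_continuous_image[OF that compact_closure_domain] by (rule compact_imp_bounded)
    then show ?thesis using closure_subset unfolding bounded_iff real_norm_def by blast
  qed
  have sub: "continuous_on \<Omega> G" if "continuous_on (closure \<Omega>) G" for G :: "'a \<Rightarrow> real"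
    using that closure_subset by (rule continuous_on_subset)
  have FL: "(\<lambda>x. F (u x)) \<in> L2 \<Omega>"
    using bdd[OF Fc] continuous_measurable[OF sub[OF Fc]] L2_bounded(1) by blast
  have F'L: "(\<lambda>x. F' (u x) *\<^sub>R weak_gradient \<Omega> u x) \<in> L2 \<Omega>"
    using bdd[OF F'c] continuous_measurable[OF sub[OF F'c]] L2_mult_bounded(1)[OF weak_gradient_L2[OF uH]] by blast
  note wg = weak_gradient_chain_rule[OF sub[OF uc] H1_L2[OF uH] weak_gradient_L2[OF uH] is_weak_gradient_weak_gradient[OF uH] F F' FL F'L]
  note * = weak_gradient_eqI[OF FL F'L wg]
  show "(\<lambda>x. F (u x)) \<in> core" using *(1) Fc by (simp add: core_def)
  show "AE x in lebesgue_on \<Omega>. weak_gradient \<Omega> (\<lambda>x. F (u x)) x = F' (u x) *\<^sub>R weak_gradient \<Omega> u x" by (rule *(2))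
qed

lemma core_contraction_gradient:
  fixes F F' :: "real \<Rightarrow> real"
  assumes u: "u \<in> core" and F: "\<And>t. (F has_real_derivative F' t) (at t)" and F': "continuous_on UNIV F'"
    and le: "\<And>t. \<bar>F' t\<bar> \<le> 1"
  shows "L2_norm \<Omega> (weak_gradient \<Omega> (\<lambda>x. F (u x))) \<le> L2_norm \<Omega> (weak_gradient \<Omega> u)"
proof (rule L2_norm_mono_AE)
  show "AE x in lebesgue_on \<Omega>. norm (weak_gradient \<Omega> (\<lambda>x. F (u x)) x) \<le> norm (weak_gradient \<Omega> u x)"
    using core_compose(2)[OF u F F']
  proof eventually_elim
    case (elim x)
    then show ?case using mult_right_mono[OF le[of "u x"], of "norm (weak_gradient \<Omega> u x)"] by simp
  qed
qed (use core_H1[OF u] core_H1[OF core_compose(1)[OF u F F']] in auto)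

text \<open>Dominates \<open>H1_norm\<close>; being a sum of two seminorms it inherits the triangle
  inequality term by term.\<close>

definition N1 :: "('a \<Rightarrow> real) \<Rightarrow> real" where
  "N1 u = L2_norm \<Omega> u + L2_norm \<Omega> (weak_gradient \<Omega> u)"

lemma N1_nonneg [simp]: "0 \<le> N1 u"
  by (simp add: N1_def)

lemma H1_norm_le_N1: "H1_norm \<Omega> u \<le> N1 u"
  unfolding H1_norm_def N1_def by (rule sqrt_sum_squares_le_sum) simp_all

lemma N1_lincomb_le:
  assumes "u \<in> H1 \<Omega>" "v \<in> H1 \<Omega>"
  shows "N1 (\<lambda>x. c * u x + d * v x) \<le> \<bar>c\<bar> * N1 u + \<bar>d\<bar> * N1 v"
proof -
  have "L2_norm \<Omega> (\<lambda>x. c * u x + d * v x) \<le> \<bar>c\<bar> * L2_norm \<Omega> u + \<bar>d\<bar> * L2_norm \<Omega> v"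
    using L2_norm_add_le[of "\<lambda>x. c * u x" \<Omega> "\<lambda>x. d * v x"] assms by (simp add: L2_norm_cmult)
  moreover have "L2_norm \<Omega> (weak_gradient \<Omega> (\<lambda>x. c * u x + d * v x))
      = L2_norm \<Omega> (\<lambda>x. c *\<^sub>R weak_gradient \<Omega> u x + d *\<^sub>R weak_gradient \<Omega> v x)"
    by (rule L2_norm_cong_AE[OF _ _ weak_gradient_lincomb[OF assms]])
       (use assms H1_lincomb[OF assms, of c d] in \<open>auto intro!: L2_measurable\<close>)
  moreover have "\<dots> \<le> \<bar>c\<bar> * L2_norm \<Omega> (weak_gradient \<Omega> u) + \<bar>d\<bar> * L2_norm \<Omega> (weak_gradient \<Omega> v)"
    using L2_norm_add_le[OF L2_scaleR[of "weak_gradient \<Omega> u" \<Omega> c] L2_scaleR[of "weak_gradient \<Omega> v" \<Omega> d]] assms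
    by (simp add: L2_norm_scaleR)
  ultimately show ?thesis by (simp add: N1_def algebra_simps)
qed

section \<open>Convergence quasi-everywhere\<close>

text \<open>|u| is not a C1 function of u, but t -> sqrt(t^2 + e^2) is C1, exceeds |t| by at most e
  and has slope at most 1. So the gradient norm does not grow and the L2 norm grows by at most e *
  vol.\<close>

lemma core_majorant:
  assumes u: "u \<in> core" and e: "e > 0"
  obtains v where "v \<in> core" "\<And>x. \<bar>u x\<bar> \<le> v x" "\<And>x. 0 \<le> v x" "N1 v \<le> N1 u + e * vol"
proof -
  define F where "F t = sqrt (t\<^sup>2 + e\<^sup>2)" for t
  define F' where "F' t = t / sqrt (t\<^sup>2 + e\<^sup>2)" for t
  have pos: "t\<^sup>2 + e\<^sup>2 > 0" for t using e by (simp add: add_nonneg_pos)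
  have D: "(F has_real_derivative F' t) (at t)" for t
    unfolding F_def F'_def using pos[of t] by (auto intro!: derivative_eq_intros simp: field_simps)
  have C: "continuous_on UNIV F'"
    unfolding F'_def using pos by (intro continuous_intros) (auto simp: less_imp_neq[symmetric])
  have le: "\<bar>F' t\<bar> \<le> 1" for t
    using pos[of t] e by (simp add: F'_def abs_divide divide_le_eq real_le_rsqrt)
  have F1: "\<bar>t\<bar> \<le> F t" "0 \<le> F t" "F t \<le> \<bar>t\<bar> + e" for t
    using e sqrt_sum_squares_le_sum_abs[of t e] by (auto simp: F_def intro!: real_le_rsqrt)
  note vc = core_compose(1)[OF u D C]
  note um = L2_measurable[OF core_L2[OF u]]
  have absL: "(\<lambda>x. \<bar>u x\<bar>) \<in> L2 \<Omega>"
    by (rule L2_bound[OF core_L2[OF u]]) (use um in auto)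
  have "L2_norm \<Omega> (\<lambda>x. F (u x)) \<le> L2_norm \<Omega> (\<lambda>x. \<bar>u x\<bar> + e)"
  proof (rule L2_norm_mono_AE[OF core_L2[OF vc] L2_add[OF absL L2_const]])
    show "AE x in lebesgue_on \<Omega>. norm (F (u x)) \<le> norm (\<bar>u x\<bar> + e)"
      using F1 e by (intro always_eventually allI) simp
  qed
  also have "\<dots> \<le> L2_norm \<Omega> (\<lambda>x. \<bar>u x\<bar>) + L2_norm \<Omega> (\<lambda>x. e)"
    by (rule L2_norm_add_le[OF absL L2_const])
  also have "\<dots> = L2_norm \<Omega> u + e * vol" using e by (simp add: L2_norm_const) (simp add: L2_norm_def)
  finally have "N1 (\<lambda>x. F (u x)) \<le> N1 u + e * vol"
    using core_contraction_gradient[OF u D C le] by (simp add: N1_def)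
  with vc F1 show thesis by (intro that[of "\<lambda>x. F (u x)"])
qed

text \<open>The positive part of a - w is dominated by |s k - w| for k >= j, whose norm tends to
  0.\<close>

lemma L2_limit_ge:
  fixes s :: "nat \<Rightarrow> 'a \<Rightarrow> real"
  assumes s: "\<And>k. s k \<in> L2 \<Omega>" and w: "w \<in> L2 \<Omega>" and a: "a \<in> L2 \<Omega>"
    and lim: "(\<lambda>k. L2_norm \<Omega> (\<lambda>x. s k x - w x)) \<longlonglongrightarrow> 0" and ge: "\<And>k x. k \<ge> j \<Longrightarrow> a x \<le> s k x"
  shows "AE x in lebesgue_on \<Omega>. a x \<le> w x"
proof -
  define g where "g x = max (a x - w x) 0" for x
  have g: "g \<in> L2 \<Omega>" unfolding g_def
    by (rule L2_bound[OF L2_diff[OF a w]]) (use L2_measurable[OF a] L2_measurable[OF w] in auto)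
  have "L2_norm \<Omega> g \<le> L2_norm \<Omega> (\<lambda>x. s k x - w x)" if "k \<ge> j" for k
  proof (rule L2_norm_mono_AE[OF g L2_diff[OF s w]])
    have "\<bar>g x\<bar> \<le> \<bar>s k x - w x\<bar>" for x using ge[OF that, of x] by (auto simp: g_def)
    then show "AE x in lebesgue_on \<Omega>. norm (g x) \<le> norm (s k x - w x)" by simp
  qed
  then have "L2_norm \<Omega> g \<le> 0"
    by (intro LIMSEQ_le_const[OF lim]) blast
  then have "L2_norm \<Omega> g = 0" using L2_norm_nonneg[of \<Omega> g] by linarith
  then have "AE x in lebesgue_on \<Omega>. g x = 0" using L2_norm_eq_0_iff[OF g] by simp
  then show ?thesis by eventually_elim (auto simp: g_def max_def split: if_splits)
qed

text \<open>The competitor w is the sum over k >= m of 2^k v k, with v k a majorant of |u k| of norm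
  at most 2 (1/4)^k, so that w has norm at most 4 (1/2)^m. Where |u k| > (1/2)^k for some k >= m, an
  open condition in the closure, w is at least 1; elsewhere |u k| <= (1/2)^k for all k >= m and the
  sequence tends to 0.\<close>

lemma Cap_nonconvergence_le:
  assumes u: "\<And>k. u k \<in> core" and small: "\<And>k. N1 (u k) \<le> (1/4) ^ k"
  shows "Cap \<Omega> {x \<in> frontier \<Omega>. \<not> (\<lambda>k. u k x) \<longlonglongrightarrow> 0} \<le> ennreal (4 * (1/2) ^ m)"
proof -
  \<comment> \<open>The smoothing cost e k * vol should be at most (1/4)^k; vol + 1 is used since
    vol may be 0.\<close>
  define e where "e k = (1/4) ^ k / (vol + 1)" for k :: nat
  have e: "e k > 0" "e k * vol \<le> (1/4) ^ k" for k
  proof -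
    have "0 < vol + 1" using vol_nonneg by linarith
    then show "e k > 0" by (simp add: e_def)
    have "vol / (vol + 1) \<le> 1" using \<open>0 < vol + 1\<close> by (simp add: divide_le_eq)
    then have "(1/4) ^ k * (vol / (vol + 1)) \<le> (1/4) ^ k * (1::real)" by (intro mult_left_mono) auto
    then show "e k * vol \<le> (1/4) ^ k" by (simp add: e_def)
  qed
  have "\<forall>k. \<exists>v. v \<in> core \<and> (\<forall>x. \<bar>u k x\<bar> \<le> v x) \<and> (\<forall>x. 0 \<le> v x) \<and> N1 v \<le> N1 (u k) + e k * vol"
    using core_majorant[OF u e(1)] by metis
  then obtain v where v: "\<And>k. v k \<in> core" "\<And>k x. \<bar>u k x\<bar> \<le> v k x" "\<And>k x. 0 \<le> v k x"
    and "\<And>k. N1 (v k) \<le> N1 (u k) + e k * vol" by metis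
  then have vN: "N1 (v k) \<le> 2 * (1/4) ^ k" for k using small[of k] e(2)[of k] by (smt (verit))
  define P where "P j x = (\<Sum>i<j. 2 ^ (m + i) * v (m + i) x)" for j x
  have P_Suc: "P (Suc j) = (\<lambda>x. 1 * P j x + 2 ^ (m + j) * v (m + j) x)" for j
    by (simp add: P_def fun_eq_iff)
  have P_0: "P 0 = (\<lambda>x. 0)" by (simp add: P_def fun_eq_iff)
  have Pc: "P j \<in> core" for j
  proof (induction j)
    case (Suc j)
    then show ?case unfolding P_Suc by (intro core_lincomb v)
  qed (simp add: P_0 core_zero)
  note PH = core_H1[OF Pc]
  have P_mono: "P i x \<le> P j x" if "i \<le> j" for i j x
    unfolding P_def using that v(3) by (intro sum_mono2) auto
  \<comment> \<open>The right hand side is the exact sum of the increments 2 (1/2)^a for a from m +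
    i to m + i + l - 1, which makes the induction close.\<close>
  have P_diff: "N1 (\<lambda>x. P (i + l) x - P i x) \<le> 4 * (1/2) ^ (m + i) - 4 * (1/2) ^ (m + i + l)" for i l
  proof (induction l)
    case 0
    \<comment> \<open>The chosen gradient of the zero function vanishes only almost everywhere, so
      its norm is bounded through a combination with zero coefficients.\<close>
    have "N1 (\<lambda>x. 0 * u 0 x + 0 * u 0 x) \<le> 0"
      using N1_lincomb_le[OF core_H1[OF u] core_H1[OF u], of 0 0 0 0] by simp
    then show ?case by simp
  next
    case (Suc l)
    let ?a = "m + i + l"
    have "N1 (\<lambda>x. P (i + Suc l) x - P i x) = N1 (\<lambda>x. 1 * (P (i + l) x - P i x) + 2 ^ ?a * v ?a x)"
      by (simp add: P_Suc add.assoc algebra_simps)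
    also have "\<dots> \<le> \<bar>1\<bar> * N1 (\<lambda>x. P (i + l) x - P i x) + \<bar>2 ^ ?a\<bar> * N1 (v ?a)"
      by (intro N1_lincomb_le H1_diff PH core_H1 v)
    also have "\<dots> \<le> (4 * (1/2) ^ (m + i) - 4 * (1/2) ^ ?a) + 2 ^ ?a * (2 * (1/4) ^ ?a)"
      using Suc vN by (intro add_mono mult_mono) auto
    also have "2 ^ ?a * (2 * (1/4) ^ ?a) = 2 * (1/2 :: real) ^ ?a"
      by (simp add: power_mult_distrib[symmetric])
    finally show ?case by simp
  qed
  have P_diff': "N1 (\<lambda>x. P j x - P i x) \<le> 4 * (1/2) ^ (m + i)" if "i \<le> j" for i j
    using P_diff[of i "j - i"] that order_trans[OF _ diff_left_mono[of 0 "4 * (1/2) ^ (m + j)" "4 * (1/2::real) ^ (m + i)"]]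
    by simp
  have N1_comm: "N1 (\<lambda>x. f x - g x) \<le> N1 (\<lambda>x. g x - f x)" if "f \<in> H1 \<Omega>" "g \<in> H1 \<Omega>" for f g
    using N1_lincomb_le[OF H1_diff[OF that(2,1)] H1_diff[OF that(2,1)], of "-1" 0] by simp
  have cauchy: "\<exists>M. \<forall>i\<ge>M. \<forall>j\<ge>M. N1 (\<lambda>x. P i x - P j x) < r" if r: "r > 0" for r
  proof -
    have "(\<lambda>i. 4 * (1/2) ^ (m + i) :: real) \<longlonglongrightarrow> 4 * 0"
      by (intro tendsto_mult tendsto_const LIMSEQ_ignore_initial_segment[OF LIMSEQ_power_zero, of _ m, unfolded add.commute[of _ m]]) simp
    then have "\<forall>\<^sub>F i in sequentially. 4 * (1/2) ^ (m + i) < r" using r by (intro order_tendstoD) auto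
    then obtain M where M: "\<And>i. i \<ge> M \<Longrightarrow> 4 * (1/2) ^ (m + i) < r" by (auto simp: eventually_sequentially)
    have "N1 (\<lambda>x. P i x - P j x) < r" if "i \<ge> M" "j \<ge> M" for i j
    proof (cases "i \<le> j")
      case True
      then show ?thesis using N1_comm[OF PH PH, of i j] P_diff'[OF True] M[OF that(1)] by linarith
    next
      case False
      then show ?thesis using P_diff'[of j i] M[OF that(2)] by linarith
    qed
    then show ?thesis by blast
  qed
  have cauchy2: "\<exists>M. \<forall>i\<ge>M. \<forall>j\<ge>M. L2_norm \<Omega> (\<lambda>x. P i x - P j x) < r"
    "\<exists>M. \<forall>i\<ge>M. \<forall>j\<ge>M. L2_norm \<Omega> (weak_gradient \<Omega> (\<lambda>x. P i x - P j x)) < r" if r: "r > 0" for r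
    using cauchy[OF r] unfolding N1_def
    by (meson L2_norm_nonneg add_increasing add_increasing2 le_less_trans order_refl)+
  obtain w where w: "w \<in> H1 \<Omega>" "(\<lambda>k. L2_norm \<Omega> (\<lambda>x. P k x - w x)) \<longlonglongrightarrow> 0"
    "(\<lambda>k. L2_norm \<Omega> (weak_gradient \<Omega> (\<lambda>x. P k x - w x))) \<longlonglongrightarrow> 0"
    using H1_complete[OF PH cauchy2] by blast
  have limN: "(\<lambda>k. N1 (\<lambda>x. P k x - w x)) \<longlonglongrightarrow> 0"
    unfolding N1_def using tendsto_add[OF w(2,3)] by simp
  have w_tilde: "w \<in> H1_tilde \<Omega>"
    unfolding H1_tilde_def core_eq
  proof (intro CollectI conjI allI impI w(1))
    fix r :: real assume r: "r > 0"
    then obtain k where "N1 (\<lambda>x. P k x - w x) < r"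
      using order_tendstoD(2)[OF limN r] by (auto simp: eventually_sequentially)
    then have "H1_norm \<Omega> (\<lambda>x. w x - P k x) < r"
      using H1_norm_le_N1[of "\<lambda>x. w x - P k x"] N1_comm[OF w(1) PH, of k] by linarith
    then show "\<exists>v\<in>core. H1_norm \<Omega> (\<lambda>x. w x - v x) < r" using Pc by blast
  qed
  have wN: "N1 w \<le> 4 * (1/2) ^ m"
  proof -
    have "N1 w \<le> 4 * (1/2) ^ m + N1 (\<lambda>x. P k x - w x)" for k
    proof -
      have "N1 w \<le> N1 (P k) + N1 (\<lambda>x. P k x - w x)"
        using N1_lincomb_le[OF PH H1_diff[OF PH w(1)], of 1 k "-1" k] by simp
      then show ?thesis using P_diff'[of 0 k] by (simp add: P_0)
    qed
    moreover have "(\<lambda>k. 4 * (1/2) ^ m + N1 (\<lambda>x. P k x - w x)) \<longlonglongrightarrow> 4 * (1/2) ^ m + 0"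
      by (intro tendsto_add tendsto_const limN)
    ultimately have "N1 w \<le> 4 * (1/2) ^ m + 0" by (intro LIMSEQ_le_const) blast+
    then show ?thesis by simp
  qed
  have ge: "AE x in lebesgue_on \<Omega>. \<forall>j. P j x \<le> w x"
    unfolding AE_all_countable
    by (intro allI L2_limit_ge[OF core_L2[OF Pc] H1_L2[OF w(1)] core_L2[OF Pc] w(2)] P_mono)
  \<comment> \<open>\<open>Cap\<close> asks for open sets of the whole space, whereas u k is
    continuous only on the closure; a relatively open set is the trace of an open one.\<close>
  have "\<forall>k. \<exists>U. open U \<and> U \<inter> closure \<Omega> = {x \<in> closure \<Omega>. (1/2) ^ k < \<bar>u k x\<bar>}"
  proof
    fix k
    have "continuous_on (closure \<Omega>) (\<lambda>x. \<bar>u k x\<bar>)" using core_continuous[OF u] by (intro continuous_intros)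
    then obtain U where "open U" "U \<inter> closure \<Omega> = (\<lambda>x. \<bar>u k x\<bar>) -` {(1/2) ^ k <..} \<inter> closure \<Omega>"
      unfolding continuous_on_open_invariant using open_greaterThan by metis
    then show "\<exists>U. open U \<and> U \<inter> closure \<Omega> = {x \<in> closure \<Omega>. (1/2) ^ k < \<bar>u k x\<bar>}" by (intro exI[of _ U]) auto
  qed
  then obtain U where U: "\<And>k. open (U k)" "\<And>k. U k \<inter> closure \<Omega> = {x \<in> closure \<Omega>. (1/2) ^ k < \<bar>u k x\<bar>}" by metis
  define S where "S = (\<Union>k\<in>{m..}. U k)"
  have "open S" unfolding S_def using U(1) by blast
  moreover have "{x \<in> frontier \<Omega>. \<not> (\<lambda>k. u k x) \<longlonglongrightarrow> 0} \<subseteq> S"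
  proof
    fix x assume x: "x \<in> {x \<in> frontier \<Omega>. \<not> (\<lambda>k. u k x) \<longlonglongrightarrow> 0}"
    have "\<exists>k\<ge>m. (1/2) ^ k < \<bar>u k x\<bar>"
    proof (rule ccontr)
      assume "\<not> ?thesis"
      then have "\<forall>\<^sub>F k in sequentially. norm (u k x) \<le> (1/2) ^ k"
        by (intro eventually_sequentiallyI[of m]) (auto simp: not_less)
      then have "(\<lambda>k. u k x) \<longlonglongrightarrow> 0" by (rule Lim_null_comparison) (simp add: LIMSEQ_power_zero)
      then show False using x by simp
    qed
    then obtain k where k: "k \<ge> m" "(1/2) ^ k < \<bar>u k x\<bar>" by blast
    have "x \<in> closure \<Omega>" using x by (simp add: frontier_def)
    then have "x \<in> U k" using U(2)[of k] k(2) by blast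
    then show "x \<in> S" using k(1) by (auto simp: S_def)
  qed
  moreover have "AE x in lebesgue_on (\<Omega> \<inter> S). 1 \<le> w x"
  proof -
    have [measurable]: "\<Omega> \<inter> S \<in> sets lebesgue" using \<open>open S\<close> by (auto intro!: sets.Int)
    have "AE x in lebesgue. x \<in> \<Omega> \<longrightarrow> (\<forall>j. P j x \<le> w x)"
      using ge by (simp add: AE_restrict_space_iff)
    then have "AE x in lebesgue. x \<in> \<Omega> \<inter> S \<longrightarrow> 1 \<le> w x"
    proof eventually_elim
      case (elim x)
      show ?case
      proof
        assume x: "x \<in> \<Omega> \<inter> S"
        then obtain k where k: "k \<ge> m" "x \<in> U k" by (auto simp: S_def)
        have "(1/2) ^ k < \<bar>u k x\<bar>" using U(2)[of k] k(2) x closure_subset by blast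
        then have "2 ^ k * (1/2) ^ k \<le> 2 ^ k * v k x" using v(2)[of k x] by (intro mult_left_mono) auto
        then have "1 \<le> 2 ^ k * v k x" by (simp add: power_mult_distrib[symmetric])
        also have "\<dots> = 2 ^ (m + (k - m)) * v (m + (k - m)) x" using k(1) by simp
        also have "\<dots> \<le> P (Suc (k - m)) x"
          unfolding P_def using v(3) by (intro member_le_sum) auto
        also have "\<dots> \<le> w x" using elim x by blast
        finally show "1 \<le> w x" .
      qed
    qed
    then show ?thesis by (simp add: AE_restrict_space_iff)
  qed
  ultimately have "Cap \<Omega> {x \<in> frontier \<Omega>. \<not> (\<lambda>k. u k x) \<longlonglongrightarrow> 0} \<le> ennreal (H1_norm \<Omega> w)"
    unfolding Cap_def using w_tilde by (intro Inf_lower) blast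
  also have "\<dots> \<le> ennreal (4 * (1/2) ^ m)"
    using H1_norm_le_N1[of w] wN by (intro ennreal_leI) linarith
  finally show ?thesis .
qed

lemma Cap_nonconvergence:
  assumes u: "\<And>k. u k \<in> core" and small: "\<And>k. N1 (u k) \<le> (1/4) ^ k"
  shows "Cap \<Omega> {x \<in> frontier \<Omega>. \<not> (\<lambda>k. u k x) \<longlonglongrightarrow> 0} = 0" (is "?c = 0")
proof -
  have "(\<lambda>m. 4 * (1/2) ^ m :: real) \<longlonglongrightarrow> 4 * 0"
    by (intro tendsto_mult tendsto_const LIMSEQ_power_zero) simp
  then have "(\<lambda>m. ennreal (4 * (1/2) ^ m)) \<longlonglongrightarrow> ennreal (4 * 0)" by (rule tendsto_ennrealI)
  then have "?c \<le> ennreal (4 * 0)"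
    by (rule LIMSEQ_le_const) (use Cap_nonconvergence_le[OF assms] in blast)
  then show ?thesis by simp
qed

end

section \<open>Closability\<close>

lemma borel_measure_on_continuous:
  fixes f :: "'b::topological_space \<Rightarrow> real"
  assumes \<mu>: "borel_measure_on X \<mu>" and f: "continuous_on X f"
  shows "f \<in> borel_measurable \<mu>"
proof -
  have "f \<in> borel_measurable (restrict_space borel X)"
    using f by (rule borel_measurable_continuous_on_restrict)
  then show ?thesis using \<mu> by (simp add: borel_measure_on_def cong: measurable_cong_sets)
qed

lemma borel_measure_on_integrable:
  fixes f :: "'b::topological_space \<Rightarrow> real"
  assumes \<mu>: "borel_measure_on X \<mu>" "finite_measure \<mu>" and f: "continuous_on X f" "\<And>x. x \<in> X \<Longrightarrow> \<bar>f x\<bar> \<le> C"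
  shows "integrable \<mu> f"
proof (rule finite_measure.integrable_const_bound[OF \<mu>(2)])
  show "AE x in \<mu>. norm (f x) \<le> C"
    using f(2) \<mu>(1) by (intro AE_I2) (simp add: borel_measure_on_def)
qed (rule borel_measure_on_continuous[OF \<mu>(1) f(1)])

text \<open>Fatou in n: f m is the limit of f m - f n almost everywhere, so a bound for the
  differences passes to f m.\<close>

lemma square_integral_le_of_Cauchy:
  fixes f :: "nat \<Rightarrow> 'b \<Rightarrow> real"
  assumes f: "\<And>k. f k \<in> borel_measurable M" and int: "\<And>m n. integrable M (\<lambda>x. (f m x - f n x)\<^sup>2)" "\<And>m. integrable M (\<lambda>x. (f m x)\<^sup>2)"
    and lim: "AE x in M. (\<lambda>k. f k x) \<longlonglongrightarrow> 0" and le: "\<And>n. n \<ge> K \<Longrightarrow> (LINT x|M. (f m x - f n x)\<^sup>2) \<le> e" and e: "e \<ge> 0"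
  shows "(LINT x|M. (f m x)\<^sup>2) \<le> e"
proof -
  note [measurable] = f
  have "ennreal (LINT x|M. (f m x)\<^sup>2) = (\<integral>\<^sup>+x. ennreal ((f m x)\<^sup>2) \<partial>M)"
    by (rule nn_integral_eq_integral[symmetric]) (use int in auto)
  also have "\<dots> = (\<integral>\<^sup>+x. liminf (\<lambda>n. ennreal ((f m x - f n x)\<^sup>2)) \<partial>M)"
  proof (rule nn_integral_cong_AE)
    show "AE x in M. ennreal ((f m x)\<^sup>2) = liminf (\<lambda>n. ennreal ((f m x - f n x)\<^sup>2))"
      using lim
    proof eventually_elim
      case (elim x)
      have "(\<lambda>n. (f m x - f n x)\<^sup>2) \<longlonglongrightarrow> (f m x - 0)\<^sup>2"
        by (intro tendsto_power tendsto_diff tendsto_const elim)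
      then have "(\<lambda>n. ennreal ((f m x - f n x)\<^sup>2)) \<longlonglongrightarrow> ennreal ((f m x - 0)\<^sup>2)" by (rule tendsto_ennrealI)
      then show ?case using lim_imp_Liminf[OF sequentially_bot] by fastforce
    qed
  qed
  also have "\<dots> \<le> liminf (\<lambda>n. \<integral>\<^sup>+x. ennreal ((f m x - f n x)\<^sup>2) \<partial>M)"
    by (rule nn_integral_liminf) measurable
  also have "\<dots> \<le> ennreal e"
  proof (rule Liminf_le)
    show "\<forall>\<^sub>F n in sequentially. (\<integral>\<^sup>+x. ennreal ((f m x - f n x)\<^sup>2) \<partial>M) \<le> ennreal e"
    proof (rule eventually_sequentiallyI[of K])
      fix n assume "K \<le> n"
      have "(\<integral>\<^sup>+x. ennreal ((f m x - f n x)\<^sup>2) \<partial>M) = ennreal (LINT x|M. (f m x - f n x)\<^sup>2)"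
        by (rule nn_integral_eq_integral) (use int in auto)
      then show "(\<integral>\<^sup>+x. ennreal ((f m x - f n x)\<^sup>2) \<partial>M) \<le> ennreal e" using le[OF \<open>K \<le> n\<close>] by (simp add: ennreal_leI)
    qed
  qed simp
  finally show ?thesis using e by (simp add: ennreal_le_iff)
qed

lemma rapid_subsequence:
  fixes X :: "nat \<Rightarrow> real"
  assumes "X \<longlonglongrightarrow> 0"
  obtains r :: "nat \<Rightarrow> nat" where "strict_mono r" "\<And>k. X (r k) \<le> (1/4) ^ k"
proof -
  have "\<exists>N. \<forall>n\<ge>N. X n < (1/4) ^ k" for k :: nat
    using order_tendstoD(2)[OF assms, of "(1/4) ^ k"] by (auto simp: eventually_sequentially)
  then obtain N where N: "\<And>k n. n \<ge> N k \<Longrightarrow> X n < (1/4) ^ k" by metis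
  \<comment> \<open>The summand k and the growing sum give strict monotonicity; the sum contains N
    k, so the threshold for k is passed.\<close>
  define r where "r k = k + (\<Sum>i\<le>k. N i)" for k
  have "strict_mono r" by (auto simp: strict_mono_Suc_iff r_def)
  moreover have "X (r k) \<le> (1/4) ^ k" for k
  proof -
    have "N k \<le> (\<Sum>i\<le>k. N i)" by (rule member_le_sum) auto
    then show ?thesis using N[of k "r k"] by (simp add: r_def)
  qed
  ultimately show thesis by (rule that)
qed

section \<open>The form of a pair of finite boundary measures\<close>

locale boundary_measures = bounded_domain \<Omega> for \<Omega> :: "'a::euclidean_space set" +
  fixes \<kappa> :: "'a measure" and \<theta> :: "('a \<times> 'a) measure"
  assumes kappa: "borel_measure_on (frontier \<Omega>) \<kappa>" "finite_measure \<kappa>"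
    and theta: "borel_measure_on (offdiag \<Omega>) \<theta>" "finite_measure \<theta>" "symmetric_measure \<theta>"
begin

abbreviation diff2 :: "('a \<Rightarrow> real) \<Rightarrow> 'a \<times> 'a \<Rightarrow> real" where
  "diff2 u \<equiv> \<lambda>p. u (fst p) - u (snd p)"

lemma space_kappa: "space \<kappa> = frontier \<Omega>" and space_theta: "space \<theta> = offdiag \<Omega>"
  using kappa theta by (auto simp: borel_measure_on_def)

lemma core_frontier: "u \<in> core \<Longrightarrow> continuous_on (frontier \<Omega>) u"
  using core_continuous by (rule continuous_on_subset) (auto simp: frontier_def)

lemma offdiag_closure: "p \<in> offdiag \<Omega> \<Longrightarrow> fst p \<in> closure \<Omega> \<and> snd p \<in> closure \<Omega>"
  by (auto simp: offdiag_def frontier_def)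

lemma core_offdiag: "u \<in> core \<Longrightarrow> continuous_on (offdiag \<Omega>) (diff2 u)"
  using offdiag_closure
  by (intro continuous_on_diff continuous_on_compose2[OF core_continuous]) (auto intro!: continuous_intros)

lemma core_kappa_measurable: "u \<in> core \<Longrightarrow> u \<in> borel_measurable \<kappa>"
  by (rule borel_measure_on_continuous[OF kappa(1) core_frontier])

lemma core_theta_measurable: "u \<in> core \<Longrightarrow> diff2 u \<in> borel_measurable \<theta>"
  by (rule borel_measure_on_continuous[OF theta(1) core_offdiag])

lemma core_kappa_integrable:
  assumes "u \<in> core" "v \<in> core" shows "integrable \<kappa> (\<lambda>x. u x * v x)"
proof -
  obtain A where A: "A \<ge> 0" "\<And>x. x \<in> closure \<Omega> \<Longrightarrow> \<bar>u x\<bar> \<le> A" using core_bounded[OF assms(1)] by blast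
  obtain B where B: "B \<ge> 0" "\<And>x. x \<in> closure \<Omega> \<Longrightarrow> \<bar>v x\<bar> \<le> B" using core_bounded[OF assms(2)] by blast
  show ?thesis
  proof (rule borel_measure_on_integrable[OF kappa])
    show "continuous_on (frontier \<Omega>) (\<lambda>x. u x * v x)" by (intro continuous_on_mult core_frontier assms)
    fix x assume "x \<in> frontier \<Omega>"
    then have "x \<in> closure \<Omega>" by (simp add: frontier_def)
    then show "\<bar>u x * v x\<bar> \<le> A * B" unfolding abs_mult using A B by (intro mult_mono) auto
  qed
qed

lemma core_theta_integrable:
  assumes "u \<in> core" "v \<in> core" shows "integrable \<theta> (\<lambda>p. diff2 u p * diff2 v p)"
proof -
  obtain A where A: "A \<ge> 0" "\<And>x. x \<in> closure \<Omega> \<Longrightarrow> \<bar>u x\<bar> \<le> A" using core_bounded[OF assms(1)] by blast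
  obtain B where B: "B \<ge> 0" "\<And>x. x \<in> closure \<Omega> \<Longrightarrow> \<bar>v x\<bar> \<le> B" using core_bounded[OF assms(2)] by blast
  show ?thesis
  proof (rule borel_measure_on_integrable[OF theta(1,2)])
    show "continuous_on (offdiag \<Omega>) (\<lambda>p. diff2 u p * diff2 v p)" by (intro continuous_on_mult core_offdiag assms)
    fix p assume "p \<in> offdiag \<Omega>"
    then have "fst p \<in> closure \<Omega>" "snd p \<in> closure \<Omega>" using offdiag_closure by blast+
    then have "\<bar>diff2 u p\<bar> \<le> 2 * A" "\<bar>diff2 v p\<bar> \<le> 2 * B"
      using A(2)[of "fst p"] A(2)[of "snd p"] B(2)[of "fst p"] B(2)[of "snd p"] by linarith+
    then show "\<bar>diff2 u p * diff2 v p\<bar> \<le> (2 * A) * (2 * B)" unfolding abs_mult using A by (intro mult_mono) auto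
  qed
qed

text \<open>Core functions are bounded and the measures finite, so the finiteness condition always
  holds. This gives all forms of the sequence and the limit the same domain.\<close>

lemma form_dom_eq: "form_dom \<Omega> \<kappa> \<theta> = core"
proof -
  have "(\<integral>\<^sup>+ x. ennreal (\<bar>u x\<bar>\<^sup>2) \<partial>\<kappa>) + (\<integral>\<^sup>+ p. ennreal ((diff2 u p)\<^sup>2) \<partial>\<theta>) < \<infinity>" if "u \<in> core" for u
    using nn_integral_eq_integral[OF core_kappa_integrable[OF that that]]
      nn_integral_eq_integral[OF core_theta_integrable[OF that that]]
    by (simp add: power2_eq_square)
  then show ?thesis unfolding form_dom_def core_eq by auto
qed

abbreviation E :: "('a \<Rightarrow> real) \<Rightarrow> ('a \<Rightarrow> real) \<Rightarrow> real" where "E \<equiv> form \<Omega> \<kappa> \<theta>"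

lemma form_self:
  "E u u = (L2_norm \<Omega> (weak_gradient \<Omega> u))\<^sup>2 + (LINT x|\<kappa>. (u x)\<^sup>2) + (LINT p|\<theta>. (diff2 u p)\<^sup>2)"
  unfolding form_def L2_norm_sq by (simp add: power2_eq_square)

lemma form_lincomb:
  assumes u: "u \<in> core" and v: "v \<in> core" and w: "w \<in> core"
  shows "E (\<lambda>x. c * u x + d * v x) w = c * E u w + d * E v w"
proof -
  note H = core_H1[OF u] core_H1[OF v] core_H1[OF w] core_H1[OF core_lincomb[OF u v]]
  have "L2_inner \<Omega> (weak_gradient \<Omega> (\<lambda>x. c * u x + d * v x)) (weak_gradient \<Omega> w)
      = L2_inner \<Omega> (\<lambda>x. c *\<^sub>R weak_gradient \<Omega> u x + d *\<^sub>R weak_gradient \<Omega> v x) (weak_gradient \<Omega> w)"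
    by (rule L2_inner_cong_AE[OF _ _ _ _ weak_gradient_lincomb[OF H(1,2)]]) (use H in auto)
  also have "\<dots> = c * L2_inner \<Omega> (weak_gradient \<Omega> u) (weak_gradient \<Omega> w) + d * L2_inner \<Omega> (weak_gradient \<Omega> v) (weak_gradient \<Omega> w)"
    using H by (simp add: L2_inner_simps)
  finally have 1: "L2_inner \<Omega> (weak_gradient \<Omega> (\<lambda>x. c * u x + d * v x)) (weak_gradient \<Omega> w) = \<dots>" .
  have "(LINT x|\<kappa>. (c * u x + d * v x) * w x) = (LINT x|\<kappa>. c * (u x * w x) + d * (v x * w x))"
    by (simp add: algebra_simps)
  also have "\<dots> = c * (LINT x|\<kappa>. u x * w x) + d * (LINT x|\<kappa>. v x * w x)"
    using core_kappa_integrable[OF u w] core_kappa_integrable[OF v w] by simp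
  finally have 2: "(LINT x|\<kappa>. (c * u x + d * v x) * w x) = \<dots>" .
  have "(LINT p|\<theta>. ((c * u (fst p) + d * v (fst p)) - (c * u (snd p) + d * v (snd p))) * diff2 w p)
      = (LINT p|\<theta>. c * (diff2 u p * diff2 w p) + d * (diff2 v p * diff2 w p))"
    by (simp add: algebra_simps)
  also have "\<dots> = c * (LINT p|\<theta>. diff2 u p * diff2 w p) + d * (LINT p|\<theta>. diff2 v p * diff2 w p)"
    using core_theta_integrable[OF u w] core_theta_integrable[OF v w] by simp
  finally have 3: "(LINT p|\<theta>. ((c * u (fst p) + d * v (fst p)) - (c * u (snd p) + d * v (snd p))) * diff2 w p) = \<dots>" .
  show ?thesis unfolding form_def 1 2 3 by (simp add: algebra_simps)
qed

lemma quadratic_form_core: "quadratic_form \<Omega> core E"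
proof
  show "core \<subseteq> L2 \<Omega>" using core_L2 by blast
  show "(\<lambda>x. 0) \<in> core" by (rule core_zero)
  show "(\<lambda>x. c * u x + d * v x) \<in> core" if "u \<in> core" "v \<in> core" for u v c d
    using that by (rule core_lincomb)
  show "E (\<lambda>x. c * u x + d * v x) w = c * E u w + d * E v w" if "u \<in> core" "v \<in> core" "w \<in> core" for u v w c d
    using that by (rule form_lincomb)
  show "E u v = E v u" for u v
    unfolding form_def by (simp add: L2_inner_commute mult.commute)
  show "0 \<le> E u u" for u unfolding form_self by simp
qed

sublocale QF: quadratic_form \<Omega> core E
  by (rule quadratic_form_core)

lemma finite_theta_hat: "finite_measure (theta_hat \<Omega> \<theta>)"
  and measurable_fst_theta: "fst \<in> \<theta> \<rightarrow>\<^sub>M restrict_space borel (frontier \<Omega>)"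
proof -
  have "fst \<in> restrict_space borel (offdiag \<Omega>) \<rightarrow>\<^sub>M restrict_space borel (frontier \<Omega>)"
    by (rule measurable_restrict_space2)
       (auto simp: space_restrict_space offdiag_def intro!: measurable_restrict_space1 borel_measurable_continuous_onI continuous_intros)
  then show m: "fst \<in> \<theta> \<rightarrow>\<^sub>M restrict_space borel (frontier \<Omega>)"
    using theta(1) by (simp add: borel_measure_on_def cong: measurable_cong_sets)
  show "finite_measure (theta_hat \<Omega> \<theta>)"
    unfolding theta_hat_def by (rule finite_measure.finite_measure_distr[OF theta(2) m])
qed

lemma measurable_snd_theta: "snd \<in> \<theta> \<rightarrow>\<^sub>M restrict_space borel (frontier \<Omega>)"
proof -
  have "snd \<in> restrict_space borel (offdiag \<Omega>) \<rightarrow>\<^sub>M restrict_space borel (frontier \<Omega>)"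
    by (rule measurable_restrict_space2)
       (auto simp: space_restrict_space offdiag_def intro!: measurable_restrict_space1 borel_measurable_continuous_onI continuous_intros)
  then show ?thesis
    using theta(1) by (simp add: borel_measure_on_def cong: measurable_cong_sets)
qed

text \<open>With finite measures every radius works, so admissibility speaks of all Borel subsets of
  the boundary.\<close>

lemma Gamma_set_eq: "Gamma_set \<Omega> \<kappa> \<theta> = frontier \<Omega>"
proof -
  have "emeasure \<kappa> A + emeasure (theta_hat \<Omega> \<theta>) A < \<infinity>" for A
    using finite_measure.emeasure_finite[OF kappa(2), of A] finite_measure.emeasure_finite[OF finite_theta_hat, of A]
    by (simp add: less_top[symmetric])
  then show ?thesis unfolding Gamma_set_def by (auto intro: exI[of _ 1])
qed

end

section \<open>Closability from admissibility\<close>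

locale admissible_measures = boundary_measures +
  assumes admissible: "admissible \<Omega> \<kappa> \<theta>"
begin

text \<open>\<open>theta_hat\<close> sees only the first coordinate of a pair; symmetry of \<theta>
  transfers the null set to the second one.\<close>

lemma AE_of_Cap_zero:
  assumes N: "N \<in> sets borel" "N \<subseteq> frontier \<Omega>" and cap: "Cap \<Omega> N = 0"
  shows "AE x in \<kappa>. x \<notin> N" "AE p in \<theta>. fst p \<notin> N \<and> snd p \<notin> N"
proof -
  have zero: "emeasure \<kappa> N = 0" "emeasure (theta_hat \<Omega> \<theta>) N = 0"
    using admissible N cap unfolding admissible_def Gamma_set_eq by auto
  have Ns: "N \<in> sets (restrict_space borel (frontier \<Omega>))"
    using N by (auto simp: sets_restrict_space_iff)
  have "N \<in> null_sets \<kappa>" using zero(1) Ns kappa(1) by (auto simp: null_sets_def borel_measure_on_def)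
  then show "AE x in \<kappa>. x \<notin> N" by (rule AE_not_in)
  define B where "B = fst -` N \<inter> space \<theta>"
  have B: "B \<in> sets \<theta>" unfolding B_def by (rule measurable_sets[OF measurable_fst_theta Ns])
  have B0: "emeasure \<theta> B = 0"
    using zero(2) emeasure_distr[OF measurable_fst_theta Ns] by (simp add: theta_hat_def B_def)
  have swap: "prod.swap p \<in> offdiag \<Omega> \<longleftrightarrow> p \<in> offdiag \<Omega>" for p
    by (cases p) (auto simp: offdiag_def)
  have swapB: "prod.swap ` B = snd -` N \<inter> space \<theta>"
  proof (intro set_eqI iffI)
    fix p assume "p \<in> prod.swap ` B"
    then show "p \<in> snd -` N \<inter> space \<theta>" unfolding B_def space_theta using swap by auto
  next
    fix p assume "p \<in> snd -` N \<inter> space \<theta>"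
    then have "prod.swap p \<in> B" unfolding B_def space_theta using swap by auto
    then show "p \<in> prod.swap ` B" by (metis imageI swap_swap)
  qed
  have B': "snd -` N \<inter> space \<theta> \<in> sets \<theta>" by (rule measurable_sets[OF measurable_snd_theta Ns])
  have B'0: "emeasure \<theta> (snd -` N \<inter> space \<theta>) = 0"
    using theta(3) B B0 swapB unfolding symmetric_measure_def by metis
  have "AE p in \<theta>. p \<notin> B" by (rule AE_not_in) (use B B0 in \<open>simp add: null_sets_def\<close>)
  moreover have "AE p in \<theta>. p \<notin> snd -` N \<inter> space \<theta>" by (rule AE_not_in) (use B' B'0 in \<open>simp add: null_sets_def\<close>)
  ultimately show "AE p in \<theta>. fst p \<notin> N \<and> snd p \<notin> N"
    using AE_space[of \<theta>] by eventually_elim (auto simp: B_def)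
qed

text \<open>Admissibility is restricted to Borel sets; convergence is expressed by countably many
  conditions so that the exceptional set qualifies.\<close>

lemma nonconvergence_set_borel:
  assumes u: "\<And>k. u k \<in> core"
  shows "{x \<in> frontier \<Omega>. \<not> (\<lambda>k. u k x) \<longlonglongrightarrow> 0} \<in> sets borel"
proof -
  let ?M = "restrict_space borel (frontier \<Omega>)"
  have [measurable]: "u k \<in> borel_measurable ?M" for k
    by (rule borel_measurable_continuous_on_restrict[OF core_frontier[OF u]])
  have "{x \<in> frontier \<Omega>. \<not> (\<lambda>k. u k x) \<longlonglongrightarrow> 0}
      = {x \<in> space ?M. \<not> (\<forall>j::nat. \<exists>n. \<forall>k\<ge>n. \<bar>u k x\<bar> < inverse (real (Suc j)))}"
  proof -
    have "(\<lambda>k. u k x) \<longlonglongrightarrow> 0 \<longleftrightarrow> (\<forall>j::nat. \<exists>n. \<forall>k\<ge>n. \<bar>u k x\<bar> < inverse (real (Suc j)))" (is "?L \<longleftrightarrow> ?R") for x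
    proof
      assume ?L
      then show ?R
        by (intro allI) (drule LIMSEQ_D[where r="inverse (real (Suc j))" for j], auto)
    next
      assume R: ?R
      show ?L
      proof (rule LIMSEQ_I)
        fix e :: real assume "e > 0"
        then obtain j where j: "inverse (real (Suc j)) < e" using reals_Archimedean by blast
        obtain n where "\<forall>k\<ge>n. \<bar>u k x\<bar> < inverse (real (Suc j))" using R by blast
        then have "\<forall>k\<ge>n. norm (u k x - 0) < e" using j by fastforce
        then show "\<exists>n. \<forall>k\<ge>n. norm (u k x - 0) < e" ..
      qed
    qed
    then show ?thesis by (simp add: space_restrict_space)
  qed
  also have "\<dots> \<in> sets ?M" by measurable
  finally show ?thesis by (auto simp: sets_restrict_space_iff frontier_closed borel_closed)
qed

text \<open>The limit of the gradients is a weak gradient of 0, so s tends to 0 in H1. A rapid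
  subsequence tends to 0 outside a set of capacity 0, hence almost everywhere for \<kappa> and
  \<theta>, and Fatou bounds the boundary integrals by the Cauchy bound. The Cauchy property brings
  the result back to the full sequence.\<close>

lemma form_closable:
  assumes s: "approximates \<Omega> core E s (\<lambda>x. 0)"
  shows "(\<lambda>k. E (s k) (s k)) \<longlonglongrightarrow> 0"
proof -
  note sc = QF.approximatesD(1)[OF s]
  note sH = core_H1[OF sc]
  have s0: "(\<lambda>k. L2_norm \<Omega> (s k)) \<longlonglongrightarrow> 0" using QF.approximatesD(2)[OF s] by simp
  have cauchy: "\<exists>M. \<forall>m\<ge>M. \<forall>n\<ge>M. E (\<lambda>x. s m x - s n x) (\<lambda>x. s m x - s n x) < e" if "e > 0" for e
    using s that by (auto simp: approximates_def)
  have grad_cauchy: "\<exists>M. \<forall>m\<ge>M. \<forall>n\<ge>M. L2_norm \<Omega> (\<lambda>x. weak_gradient \<Omega> (s m) x - weak_gradient \<Omega> (s n) x) < e" if e: "e > 0" for e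
  proof -
    obtain M where M: "\<And>m n. m \<ge> M \<Longrightarrow> n \<ge> M \<Longrightarrow> E (\<lambda>x. s m x - s n x) (\<lambda>x. s m x - s n x) < e\<^sup>2"
      using cauchy[of "e\<^sup>2"] e by auto
    have "L2_norm \<Omega> (\<lambda>x. weak_gradient \<Omega> (s m) x - weak_gradient \<Omega> (s n) x) < e" if "m \<ge> M" "n \<ge> M" for m n
    proof (rule power2_less_imp_less)
      have "(L2_norm \<Omega> (weak_gradient \<Omega> (\<lambda>x. s m x - s n x)))\<^sup>2 \<le> E (\<lambda>x. s m x - s n x) (\<lambda>x. s m x - s n x)"
        unfolding form_self by simp
      then show "(L2_norm \<Omega> (\<lambda>x. weak_gradient \<Omega> (s m) x - weak_gradient \<Omega> (s n) x))\<^sup>2 < e\<^sup>2"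
        unfolding L2_norm_weak_gradient_diff[OF sH sH] using M[OF that] by linarith
    qed (use e in simp)
    then show ?thesis by blast
  qed
  obtain g where g: "g \<in> L2 \<Omega>" "(\<lambda>k. L2_norm \<Omega> (\<lambda>x. weak_gradient \<Omega> (s k) x - g x)) \<longlonglongrightarrow> 0"
    using L2_complete[of "\<lambda>k. weak_gradient \<Omega> (s k)" \<Omega>, OF weak_gradient_L2[OF sH] grad_cauchy] by blast
  have "is_weak_gradient \<Omega> (\<lambda>x. 0) g"
    by (rule is_weak_gradient_limit[OF sH _ g(1) _ g(2)]) (use s0 in auto)
  then have "AE x in lebesgue_on \<Omega>. g x = 0"
    by (rule is_weak_gradient_unique[OF g(1) L2_zero _ is_weak_gradient_zero])
  then have "L2_norm \<Omega> g = 0" using L2_norm_eq_0_iff[OF g(1)] by simp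
  then have grad0: "(\<lambda>k. L2_norm \<Omega> (weak_gradient \<Omega> (s k))) \<longlonglongrightarrow> 0"
    using L2_norm_tendsto[OF weak_gradient_L2[OF sH] g] by simp
  have "(\<lambda>k. N1 (s k)) \<longlonglongrightarrow> 0" unfolding N1_def using tendsto_add[OF s0 grad0] by simp
  then obtain r where r: "strict_mono r" "\<And>k. N1 (s (r k)) \<le> (1/4) ^ k" using rapid_subsequence by blast
  define u where "u k = s (r k)" for k
  have uc: "u k \<in> core" for k unfolding u_def by (rule sc)
  have uN: "N1 (u k) \<le> (1/4) ^ k" for k unfolding u_def by (rule r(2))
  let ?N = "{x \<in> frontier \<Omega>. \<not> (\<lambda>k. u k x) \<longlonglongrightarrow> 0}"
  have cap: "Cap \<Omega> ?N = 0" by (rule Cap_nonconvergence[OF uc uN])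
  note AE = AE_of_Cap_zero[OF nonconvergence_set_borel[OF uc] _ cap]
  have AEk: "AE x in \<kappa>. (\<lambda>k. u k x) \<longlonglongrightarrow> 0"
    using AE(1) AE_space[of \<kappa>] by (rule AE_mp[OF _ AE_mp]) (auto simp: space_kappa)
  have "AE p in \<theta>. fst p \<notin> ?N \<and> snd p \<notin> ?N" by (rule AE(2)) auto
  then have AEt: "AE p in \<theta>. (\<lambda>k. diff2 (u k) p) \<longlonglongrightarrow> 0"
    using AE_space[of \<theta>]
  proof eventually_elim
    case (elim p)
    then have "(\<lambda>k. u k (fst p)) \<longlonglongrightarrow> 0" "(\<lambda>k. u k (snd p)) \<longlonglongrightarrow> 0"
      by (auto simp: space_theta offdiag_def)
    then show ?case using tendsto_diff by fastforce
  qed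
  have sub: "\<exists>M. \<forall>m\<ge>M. E (u m) (u m) < e" if e: "e > 0" for e
  proof -
    \<comment> \<open>A quarter of e for each of the gradient, \<kappa> and \<theta> terms keeps
      their sum below e.\<close>
    obtain M where M: "\<And>m n. m \<ge> M \<Longrightarrow> n \<ge> M \<Longrightarrow> E (\<lambda>x. s m x - s n x) (\<lambda>x. s m x - s n x) < e / 4"
      using cauchy[of "e / 4"] e by auto
    have M': "E (\<lambda>x. u m x - u n x) (\<lambda>x. u m x - u n x) < e / 4" if "m \<ge> M" "n \<ge> M" for m n
      unfolding u_def using that strict_mono_imp_increasing[OF r(1), of m] strict_mono_imp_increasing[OF r(1), of n]
      by (intro M) auto
    have uu: "(\<lambda>x. u m x - u n x) \<in> core" for m n by (rule core_diff[OF uc uc])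
    have "\<forall>\<^sub>F k in sequentially. L2_norm \<Omega> (weak_gradient \<Omega> (s k)) < sqrt (e / 4)"
      using e by (intro order_tendstoD[OF grad0]) simp
    then obtain M2 where M2: "\<And>k. k \<ge> M2 \<Longrightarrow> L2_norm \<Omega> (weak_gradient \<Omega> (s k)) < sqrt (e / 4)"
      by (auto simp: eventually_sequentially)
    have "E (u m) (u m) < e" if m: "m \<ge> max M M2" for m
    proof -
      have "(LINT x|\<kappa>. (u m x)\<^sup>2) \<le> e / 4"
      proof (rule square_integral_le_of_Cauchy[OF _ _ _ AEk, where K=M])
        show "u k \<in> borel_measurable \<kappa>" for k by (rule core_kappa_measurable[OF uc])
        show "integrable \<kappa> (\<lambda>x. (u i x - u j x)\<^sup>2)" for i j
          using core_kappa_integrable[OF uu uu] by (simp add: power2_eq_square)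
        show "integrable \<kappa> (\<lambda>x. (u i x)\<^sup>2)" for i
          using core_kappa_integrable[OF uc uc] by (simp add: power2_eq_square)
        show "(LINT x|\<kappa>. (u m x - u n x)\<^sup>2) \<le> e / 4" if "n \<ge> M" for n
        proof -
          have "(LINT x|\<kappa>. (u m x - u n x)\<^sup>2) \<le> E (\<lambda>x. u m x - u n x) (\<lambda>x. u m x - u n x)"
            unfolding form_self by simp
          then show ?thesis using M'[of m n] m that by simp
        qed
      qed (use e in simp)
      moreover have "(LINT p|\<theta>. (diff2 (u m) p)\<^sup>2) \<le> e / 4"
      proof (rule square_integral_le_of_Cauchy[OF _ _ _ AEt, where K=M])
        have eq: "(diff2 (u i) p - diff2 (u j) p)\<^sup>2 = diff2 (\<lambda>x. u i x - u j x) p * diff2 (\<lambda>x. u i x - u j x) p" for i j p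
          by (simp add: power2_eq_square algebra_simps)
        show "diff2 (u k) \<in> borel_measurable \<theta>" for k by (rule core_theta_measurable[OF uc])
        show "integrable \<theta> (\<lambda>p. (diff2 (u i) p - diff2 (u j) p)\<^sup>2)" for i j
          unfolding eq by (rule core_theta_integrable[OF uu uu])
        show "integrable \<theta> (\<lambda>p. (diff2 (u i) p)\<^sup>2)" for i
          using core_theta_integrable[OF uc uc] by (simp add: power2_eq_square)
        show "(LINT p|\<theta>. (diff2 (u m) p - diff2 (u n) p)\<^sup>2) \<le> e / 4" if "n \<ge> M" for n
        proof -
          have "(LINT p|\<theta>. (diff2 (\<lambda>x. u m x - u n x) p)\<^sup>2) \<le> E (\<lambda>x. u m x - u n x) (\<lambda>x. u m x - u n x)"
            unfolding form_self by simp
          moreover have "E (\<lambda>x. u m x - u n x) (\<lambda>x. u m x - u n x) < e / 4" using M'[of m n] m that by simp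
          moreover have eq2: "(\<lambda>p. (diff2 (u m) p - diff2 (u n) p)\<^sup>2) = (\<lambda>p. (diff2 (\<lambda>x. u m x - u n x) p)\<^sup>2)"
            by (intro ext arg_cong[where f="\<lambda>x::real. x\<^sup>2"]) simp
          ultimately show ?thesis unfolding eq2 by linarith
        qed
      qed (use e in simp)
      moreover have "(L2_norm \<Omega> (weak_gradient \<Omega> (u m)))\<^sup>2 < e / 4"
      proof -
        have "r m \<ge> M2" using m strict_mono_imp_increasing[OF r(1), of m] by simp
        then have "(L2_norm \<Omega> (weak_gradient \<Omega> (s (r m))))\<^sup>2 < (sqrt (e / 4))\<^sup>2"
          by (intro power_strict_mono M2) auto
        then show ?thesis using e by (simp add: u_def)
      qed
      ultimately show ?thesis unfolding form_self using e by linarith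
    qed
    then show ?thesis by blast
  qed
  \<comment> \<open>s k is compared with s (r k): both indices are late since r k >= k, and the
    second term belongs to the subsequence already treated.\<close>
  have "(\<lambda>k. QF.qnorm (s k)) \<longlonglongrightarrow> 0"
  proof (rule LIMSEQ_I)
    fix e :: real assume e: "e > 0"
    obtain M where M: "\<And>m n. m \<ge> M \<Longrightarrow> n \<ge> M \<Longrightarrow> QF.qnorm (\<lambda>x. s m x - s n x) < e / 2"
      using QF.approximatesD(3)[OF s, of "e / 2"] e by auto
    obtain M2 where M2: "\<And>m. m \<ge> M2 \<Longrightarrow> E (u m) (u m) < (e / 2)\<^sup>2"
      using sub[of "(e / 2)\<^sup>2"] e by auto
    have "norm (QF.qnorm (s k) - 0) < e" if k: "k \<ge> max M M2" for k
    proof -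
      have "r k \<ge> M" using k strict_mono_imp_increasing[OF r(1), of k] by simp
      then have "QF.qnorm (\<lambda>x. s k x - s (r k) x) < e / 2" using k by (intro M) auto
      moreover have "QF.qnorm (s (r k)) < e / 2"
      proof (rule power2_less_imp_less)
        show "(QF.qnorm (s (r k)))\<^sup>2 < (e / 2)\<^sup>2"
          using M2[of k] k by (simp add: QF.qnorm_sq[OF sc] u_def)
      qed (use e in simp)
      moreover note QF.qnorm_triangle_diff[OF sc sc, of k "r k"] QF.qnorm_nonneg[OF sc, of k]
      ultimately show ?thesis by simp
    qed
    then show "\<exists>no. \<forall>k\<ge>no. norm (QF.qnorm (s k) - 0) < e" by blast
  qed
  then have "(\<lambda>k. (QF.qnorm (s k))\<^sup>2) \<longlonglongrightarrow> 0\<^sup>2" by (rule tendsto_power)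
  then show ?thesis by (simp add: QF.qnorm_sq[OF sc])
qed

lemma closable_form_core: "closable_form \<Omega> core E"
  by (intro closable_form.intro closable_form_axioms.intro quadratic_form_core form_closable)

sublocale CF: closable_form \<Omega> core E
  by (rule closable_form_core)

lemma Laplacian_eq: "Laplacian \<Omega> \<kappa> \<theta> = CF.lap"
proof -
  have "closure_dom \<Omega> \<kappa> \<theta> = QF.cdom"
    unfolding closure_dom_def QF.cdom_def form_dom_eq ..
  moreover have "closure_form \<Omega> \<kappa> \<theta> u v = QF.cform u v" for u v
    unfolding closure_form_def QF.cform_def form_dom_eq ..
  ultimately show ?thesis unfolding Laplacian_def CF.lap_def by simp
qed

end

section \<open>Monotone vague convergence of measures\<close>

lemma integral_mono_setwise:
  fixes f :: "'b \<Rightarrow> real"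
  assumes sets: "sets M = sets N" and le: "\<And>B. B \<in> sets M \<Longrightarrow> emeasure M B \<le> emeasure N B"
    and int: "integrable M f" "integrable N f" and nn: "\<And>x. x \<in> space M \<Longrightarrow> 0 \<le> f x"
  shows "(LINT x|M. f x) \<le> (LINT x|N. f x)"
proof -
  have sp: "space M = space N" using sets by (rule sets_eq_imp_space_eq)
  have "M \<le> N" using le le_measure[OF sets] by simp
  then have "(\<integral>\<^sup>+x. ennreal (f x) \<partial>M) \<le> (\<integral>\<^sup>+x. ennreal (f x) \<partial>N)"
    by (rule nn_integral_mono_measure[OF sets])
  moreover have "(\<integral>\<^sup>+x. ennreal (f x) \<partial>M) = ennreal (LINT x|M. f x)"
    by (rule nn_integral_eq_integral[OF int(1)]) (use nn in auto)
  moreover have "(\<integral>\<^sup>+x. ennreal (f x) \<partial>N) = ennreal (LINT x|N. f x)"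
    by (rule nn_integral_eq_integral[OF int(2)]) (use nn sp in auto)
  moreover have "0 \<le> (LINT x|N. f x)"
    using nn sp by (intro integral_nonneg_AE AE_I2) auto
  ultimately show ?thesis by (simp add: ennreal_le_iff)
qed

lemma integral_const_minus:
  fixes g :: "'b \<Rightarrow> real"
  assumes "finite_measure M" "integrable M g"
  shows "(LINT x|M. c - g x) = c * (LINT x|M. 1) - (LINT x|M. g x)"
  using assms finite_measure.integrable_const[OF assms(1), of c] by (simp add: mult.commute)

text \<open>The cut-offs \<open>\<zeta>\<close> compensate for the possibly non-compact \<open>X\<close>: vague convergence alone
  could lose mass at the diagonal, monotonicity excludes this.\<close>

lemma monotone_vague_convergence:
  fixes f :: "'b::topological_space \<Rightarrow> real"
  assumes \<mu>n: "\<And>n. borel_measure_on X (\<mu>n n)" "\<And>n. finite_measure (\<mu>n n)"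
    and \<mu>: "borel_measure_on X \<mu>" "finite_measure \<mu>"
    and mono: "setwise_increasing \<mu>n \<or> setwise_decreasing \<mu>n"
    and vague: "vague_conv X \<mu>n \<mu>"
    and \<zeta>: "\<And>j. \<zeta> j \<in> C_c X" "\<And>j. \<forall>x\<in>X. 0 \<le> \<zeta> j x \<and> \<zeta> j x \<le> 1" "\<forall>x\<in>X. (\<lambda>j. \<zeta> j x) \<longlonglongrightarrow> 1"
    and f: "continuous_on X f" "\<forall>x\<in>X. 0 \<le> f x \<and> f x \<le> C"
  shows "(\<lambda>n. LINT x|\<mu>n n. f x) \<longlonglongrightarrow> (LINT x|\<mu>. f x)"
    and "setwise_increasing \<mu>n \<Longrightarrow> incseq (\<lambda>n. LINT x|\<mu>n n. f x)"
    and "setwise_decreasing \<mu>n \<Longrightarrow> decseq (\<lambda>n. LINT x|\<mu>n n. f x)"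
proof -
  have f2: "0 \<le> f x \<and> f x \<le> C" if "x \<in> X" for x using f(2) that by blast
  have \<zeta>2: "0 \<le> \<zeta> j x \<and> \<zeta> j x \<le> 1" if "x \<in> X" for j x using \<zeta>(2) that by blast
  have \<zeta>3: "(\<lambda>j. \<zeta> j x) \<longlonglongrightarrow> 1" if "x \<in> X" for x using \<zeta>(3) that by blast
  have space: "space (\<mu>n n) = X" "space \<mu> = X" and sets: "sets (\<mu>n n) = sets (\<mu>n m)" for n m
    using \<mu>n(1) \<mu>(1) by (auto simp: borel_measure_on_def)
  have \<zeta>c: "continuous_on X (\<zeta> j)" for j using \<zeta>(1) by (simp add: C_c_def)
  have gc: "continuous_on X (\<lambda>x. f x * \<zeta> j x)" and hc: "continuous_on X (\<lambda>x. f x * (1 - \<zeta> j x))" for j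
    by (intro continuous_intros f(1) \<zeta>c)+
  have gb: "0 \<le> f x * \<zeta> j x" "f x * \<zeta> j x \<le> f x" "0 \<le> f x * (1 - \<zeta> j x)" "f x * (1 - \<zeta> j x) \<le> f x" if "x \<in> X" for x j
    using f2[OF that] \<zeta>2[OF that, of j] by (auto intro: mult_left_le)
  have fC: "\<bar>f x\<bar> \<le> C" if "x \<in> X" for x using f2[OF that] by simp
  have gC: "\<bar>f x * \<zeta> j x\<bar> \<le> C" "\<bar>f x * (1 - \<zeta> j x)\<bar> \<le> C" if "x \<in> X" for x j
    using f2[OF that] gb[OF that, of j] by simp_all
  have int: "integrable \<nu> f" "integrable \<nu> (\<lambda>x. f x * \<zeta> j x)" "integrable \<nu> (\<lambda>x. f x * (1 - \<zeta> j x))"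
    if "borel_measure_on X \<nu>" "finite_measure \<nu>" for \<nu> j
    by (rule borel_measure_on_integrable[OF that f(1) fC] borel_measure_on_integrable[OF that gc gC(1)]
        borel_measure_on_integrable[OF that hc gC(2)]; assumption)+
  note intn = int[OF \<mu>n(1) \<mu>n(2)] and int\<mu> = int[OF \<mu>]
  show inc: "incseq (\<lambda>n. LINT x|\<mu>n n. f x)" if "setwise_increasing \<mu>n"
    using that f2 space unfolding incseq_def setwise_increasing_def
    by (intro allI impI integral_mono_setwise[OF sets _ intn(1) intn(1)]) auto
  show "decseq (\<lambda>n. LINT x|\<mu>n n. f x)" if "setwise_decreasing \<mu>n"
    using that f2 space sets unfolding decseq_def setwise_decreasing_def
    by (intro allI impI integral_mono_setwise[OF sets _ intn(1) intn(1)]) blast+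
  have g_Cc: "(\<lambda>x. f x * \<zeta> j x) \<in> C_c X" for j
  proof -
    obtain K where "compact K" "K \<subseteq> X" "\<forall>x\<in>X - K. \<zeta> j x = 0" using \<zeta>(1)[of j] by (auto simp: C_c_def)
    then show ?thesis using gc[of j] unfolding C_c_def by (intro CollectI conjI exI[of _ K]) auto
  qed
  have lim_n: "(\<lambda>n. LINT x|\<mu>n n. f x * \<zeta> j x) \<longlonglongrightarrow> (LINT x|\<mu>. f x * \<zeta> j x)" for j
    using vague g_Cc unfolding vague_conv_def by blast
  have lim_j: "(\<lambda>j. LINT x|\<nu>. f x * \<zeta> j x) \<longlonglongrightarrow> (LINT x|\<nu>. f x)"
    if \<nu>: "borel_measure_on X \<nu>" "finite_measure \<nu>" for \<nu>
  proof (rule integral_dominated_convergence[where w="\<lambda>x. C"])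
    have sp: "space \<nu> = X" using \<nu>(1) by (simp add: borel_measure_on_def)
    show "AE x in \<nu>. (\<lambda>j. f x * \<zeta> j x) \<longlonglongrightarrow> f x"
    proof (rule AE_I2)
      fix x assume "x \<in> space \<nu>"
      then have "(\<lambda>j. f x * \<zeta> j x) \<longlonglongrightarrow> f x * 1" using sp by (intro tendsto_mult tendsto_const \<zeta>3) simp
      then show "(\<lambda>j. f x * \<zeta> j x) \<longlonglongrightarrow> f x" by simp
    qed
    show "AE x in \<nu>. norm (f x * \<zeta> j x) \<le> C" for j
      using gC(1) sp by (intro AE_I2) simp
  qed (use int[OF \<nu>] finite_measure.integrable_const[OF \<nu>(2)] in auto)
  have lower: "(LINT x|\<nu>. f x * \<zeta> j x) \<le> (LINT x|\<nu>. f x)" if \<nu>: "borel_measure_on X \<nu>" "finite_measure \<nu>" for \<nu> j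
    using gb(2) \<nu>(1) by (intro integral_mono int[OF \<nu>]) (simp add: borel_measure_on_def)
  let ?I = "LINT x|\<mu>. f x"
  \<comment> \<open>Lower semicontinuity: f * \<zeta> j is compactly supported, lies below f and
    recovers the integral of f as j grows.\<close>
  have ev_lower: "\<forall>\<^sub>F n in sequentially. a < (LINT x|\<mu>n n. f x)" if a: "a < ?I" for a
  proof -
    obtain j where "a < (LINT x|\<mu>. f x * \<zeta> j x)"
      using order_tendstoD(1)[OF lim_j[OF \<mu>] a] by (auto simp: eventually_sequentially)
    then have "\<forall>\<^sub>F n in sequentially. a < (LINT x|\<mu>n n. f x * \<zeta> j x)" by (rule order_tendstoD(1)[OF lim_n])
    then show ?thesis
      by eventually_elim (rule less_le_trans[OF _ lower[OF \<mu>n(1) \<mu>n(2)]])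
  qed
  have ev_upper: "\<forall>\<^sub>F n in sequentially. (LINT x|\<mu>n n. f x) < a" if a: "?I < a" for a
    using mono
  proof
    assume m: "setwise_increasing \<mu>n"
    \<comment> \<open>For increasing measures the n-th integral of f * \<zeta> j lies below its
      limit for every j; letting j grow with n fixed removes the cut-off.\<close>
    have "(LINT x|\<mu>n n. f x) \<le> ?I" for n
    proof (rule LIMSEQ_le_const2[OF lim_j[OF \<mu>n(1) \<mu>n(2)]], intro exI allI impI)
      fix j
      have "incseq (\<lambda>n. LINT x|\<mu>n n. f x * \<zeta> j x)"
        using m gb(1) space unfolding incseq_def setwise_increasing_def
        by (intro allI impI integral_mono_setwise[OF sets _ intn(2) intn(2)]) auto
      then have "(LINT x|\<mu>n n. f x * \<zeta> j x) \<le> (LINT x|\<mu>. f x * \<zeta> j x)"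
        by (rule incseq_le[OF _ lim_n])
      also have "\<dots> \<le> ?I" by (rule lower[OF \<mu>])
      finally show "(LINT x|\<mu>n n. f x * \<zeta> j x) \<le> ?I" .
    qed
    then show ?thesis using a by (intro always_eventually allI) (rule le_less_trans)
  next
    assume m: "setwise_decreasing \<mu>n"
    have split: "(LINT x|\<nu>. f x) = (LINT x|\<nu>. f x * \<zeta> j x) + (LINT x|\<nu>. f x * (1 - \<zeta> j x))"
      if \<nu>: "borel_measure_on X \<nu>" "finite_measure \<nu>" for \<nu> j
      by (subst Bochner_Integration.integral_add[symmetric, OF int(2,3)[OF \<nu>]]) (simp add: algebra_simps)
    \<comment> \<open>For decreasing measures the mass cut off by \<zeta> j is controlled for all n
      by that of the initial measure, which is finite: uniform tightness.\<close>
    have "(\<lambda>j. LINT x|\<mu>n 0. f x * (1 - \<zeta> j x)) \<longlonglongrightarrow> 0"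
    proof -
      have "(\<lambda>j. (LINT x|\<mu>n 0. f x) - (LINT x|\<mu>n 0. f x * \<zeta> j x)) \<longlonglongrightarrow> (LINT x|\<mu>n 0. f x) - (LINT x|\<mu>n 0. f x)"
        by (intro tendsto_diff tendsto_const lim_j[OF \<mu>n(1) \<mu>n(2)])
      moreover have "(LINT x|\<mu>n 0. f x) - (LINT x|\<mu>n 0. f x * \<zeta> j x) = (LINT x|\<mu>n 0. f x * (1 - \<zeta> j x))" for j
        using split[OF \<mu>n(1) \<mu>n(2), of 0 j] by simp
      ultimately show ?thesis by simp
    qed
    then obtain j where j: "(LINT x|\<mu>n 0. f x * (1 - \<zeta> j x)) < (a - ?I) / 2"
      using order_tendstoD(2)[of _ 0 sequentially "(a - ?I) / 2"] a by (auto simp: eventually_sequentially)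
    have "(LINT x|\<mu>. f x * \<zeta> j x) < ?I + (a - ?I) / 2"
      by (rule le_less_trans[OF lower[OF \<mu>]]) (use a in simp)
    then have "\<forall>\<^sub>F n in sequentially. (LINT x|\<mu>n n. f x * \<zeta> j x) < ?I + (a - ?I) / 2"
      by (rule order_tendstoD(2)[OF lim_n])
    then show ?thesis
    proof eventually_elim
      case (elim n)
      have "(LINT x|\<mu>n n. f x * (1 - \<zeta> j x)) \<le> (LINT x|\<mu>n 0. f x * (1 - \<zeta> j x))"
        using m gb(3) space sets[of n 0] unfolding setwise_decreasing_def
        by (intro integral_mono_setwise[OF sets _ intn(3) intn(3)]) blast+
      then show ?case using split[OF \<mu>n(1) \<mu>n(2), of n j] elim j by argo
    qed
  qed
  show "(\<lambda>n. LINT x|\<mu>n n. f x) \<longlonglongrightarrow> ?I"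
    by (rule order_tendstoI[OF ev_lower ev_upper])
qed

section \<open>Convergence of the minima\<close>

locale monotone_measures = bounded_domain \<Omega> for \<Omega> :: "'a::euclidean_space set" +
  fixes \<kappa>n :: "nat \<Rightarrow> 'a measure" and \<theta>n :: "nat \<Rightarrow> ('a \<times> 'a) measure"
    and \<kappa> :: "'a measure" and \<theta> :: "('a \<times> 'a) measure"
  assumes bm_n: "\<And>n. boundary_measures \<Omega> (\<kappa>n n) (\<theta>n n)" and bm: "boundary_measures \<Omega> \<kappa> \<theta>"
    and monotone: "(setwise_increasing \<kappa>n \<and> setwise_increasing \<theta>n) \<or> (setwise_decreasing \<kappa>n \<and> setwise_decreasing \<theta>n)"
    and vague_kappa: "vague_conv (frontier \<Omega>) \<kappa>n \<kappa>" and vague_theta: "vague_conv (offdiag \<Omega>) \<theta>n \<theta>"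
begin

sublocale N: boundary_measures \<Omega> "\<kappa>n n" "\<theta>n n" for n by (rule bm_n)
sublocale L: boundary_measures \<Omega> \<kappa> \<theta> by (rule bm)

lemma frontier_cutoff: "(\<lambda>x. 1) \<in> C_c (frontier \<Omega>)"
proof -
  have "compact (frontier \<Omega>)" using bounded_domain by (rule compact_frontier_bounded)
  then show ?thesis unfolding C_c_def by auto
qed

lemma kappa_convergence:
  fixes f :: "'a \<Rightarrow> real"
  assumes f: "continuous_on (frontier \<Omega>) f" "\<forall>x\<in>frontier \<Omega>. 0 \<le> f x \<and> f x \<le> C"
  shows "(\<lambda>n. LINT x|\<kappa>n n. f x) \<longlonglongrightarrow> (LINT x|\<kappa>. f x)"
    and "setwise_increasing \<kappa>n \<Longrightarrow> incseq (\<lambda>n. LINT x|\<kappa>n n. f x)"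
    and "setwise_decreasing \<kappa>n \<Longrightarrow> decseq (\<lambda>n. LINT x|\<kappa>n n. f x)"
proof -
  have m: "setwise_increasing \<kappa>n \<or> setwise_decreasing \<kappa>n" using monotone by blast
  have c: "\<forall>x\<in>frontier \<Omega>. 0 \<le> (1::real) \<and> (1::real) \<le> 1" by simp
  have l: "\<forall>x\<in>frontier \<Omega>. (\<lambda>j. 1::real) \<longlonglongrightarrow> 1" by simp
  note * = monotone_vague_convergence[where X="frontier \<Omega>" and \<mu>n=\<kappa>n and \<mu>=\<kappa> and \<zeta>="\<lambda>j x. 1" and f=f and C=C, OF N.kappa L.kappa m vague_kappa frontier_cutoff c l f]
  show "(\<lambda>n. LINT x|\<kappa>n n. f x) \<longlonglongrightarrow> (LINT x|\<kappa>. f x)" by (rule *(1))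
  show "incseq (\<lambda>n. LINT x|\<kappa>n n. f x)" if "setwise_increasing \<kappa>n" by (rule *(2)[OF that])
  show "decseq (\<lambda>n. LINT x|\<kappa>n n. f x)" if "setwise_decreasing \<kappa>n" by (rule *(3)[OF that])
qed

text \<open>A ramp that is 0 at distance at most 1/j from the diagonal and 1 from distance 2/j on
  (for j > 0); its support in the boundary pairs is compact and avoids the diagonal.\<close>

definition cutoff :: "nat \<Rightarrow> 'a \<times> 'a \<Rightarrow> real" where
  "cutoff j p = min 1 (max 0 (real j * dist (fst p) (snd p) - 1))"

lemma cutoff_C_c: "cutoff j \<in> C_c (offdiag \<Omega>)"
proof -
  define K where "K = (frontier \<Omega> \<times> frontier \<Omega>) \<inter> {p. 1 \<le> real j * dist (fst p) (snd p)}"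
  have "compact (frontier \<Omega> \<times> frontier \<Omega>)"
    using bounded_domain by (intro compact_Times compact_frontier_bounded)
  moreover have "closed {p :: 'a \<times> 'a. 1 \<le> real j * dist (fst p) (snd p)}"
    by (intro closed_Collect_le continuous_intros)
  ultimately have "compact K" unfolding K_def by (rule compact_Int_closed)
  moreover have "K \<subseteq> offdiag \<Omega>" by (auto simp: K_def offdiag_def)
  moreover have "\<forall>p\<in>offdiag \<Omega> - K. cutoff j p = 0" by (auto simp: K_def offdiag_def cutoff_def)
  moreover have "continuous_on (offdiag \<Omega>) (cutoff j)"
    unfolding cutoff_def by (intro continuous_intros)
  ultimately show ?thesis unfolding C_c_def by blast
qed

lemma cutoff_tendsto:
  assumes "p \<in> offdiag \<Omega>" shows "(\<lambda>j. cutoff j p) \<longlonglongrightarrow> 1"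
proof -
  have d: "dist (fst p) (snd p) > 0" using assms by (auto simp: offdiag_def)
  obtain n :: nat where n: "2 < real n * dist (fst p) (snd p)" using reals_Archimedean3[OF d] by blast
  have "\<forall>\<^sub>F j in sequentially. 1 = cutoff j p"
  proof (rule eventually_sequentiallyI[of n])
    fix j assume "n \<le> j"
    then have "real n * dist (fst p) (snd p) \<le> real j * dist (fst p) (snd p)" using d by (intro mult_right_mono) auto
    then show "1 = cutoff j p" using n by (simp add: cutoff_def)
  qed
  then show ?thesis by (rule Lim_transform_eventually[OF tendsto_const])
qed

lemma theta_convergence:
  fixes f :: "'a \<times> 'a \<Rightarrow> real"
  assumes f: "continuous_on (offdiag \<Omega>) f" "\<forall>x\<in>offdiag \<Omega>. 0 \<le> f x \<and> f x \<le> C"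
  shows "(\<lambda>n. LINT x|\<theta>n n. f x) \<longlonglongrightarrow> (LINT x|\<theta>. f x)"
    and "setwise_increasing \<theta>n \<Longrightarrow> incseq (\<lambda>n. LINT x|\<theta>n n. f x)"
    and "setwise_decreasing \<theta>n \<Longrightarrow> decseq (\<lambda>n. LINT x|\<theta>n n. f x)"
proof -
  have m: "setwise_increasing \<theta>n \<or> setwise_decreasing \<theta>n" using monotone by blast
  have c: "\<forall>x\<in>offdiag \<Omega>. 0 \<le> cutoff j x \<and> cutoff j x \<le> 1" for j by (simp add: cutoff_def)
  have l: "\<forall>x\<in>offdiag \<Omega>. (\<lambda>j. cutoff j x) \<longlonglongrightarrow> 1" using cutoff_tendsto by blast
  note * = monotone_vague_convergence[where X="offdiag \<Omega>" and \<mu>n=\<theta>n and \<mu>=\<theta> and \<zeta>=cutoff and f=f and C=C, OF N.theta(1,2) L.theta(1,2) m vague_theta cutoff_C_c c l f]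
  show "(\<lambda>n. LINT x|\<theta>n n. f x) \<longlonglongrightarrow> (LINT x|\<theta>. f x)" by (rule *(1))
  show "incseq (\<lambda>n. LINT x|\<theta>n n. f x)" if "setwise_increasing \<theta>n" by (rule *(2)[OF that])
  show "decseq (\<lambda>n. LINT x|\<theta>n n. f x)" if "setwise_decreasing \<theta>n" by (rule *(3)[OF that])
qed

lemma core_square_bounds:
  assumes u: "u \<in> core" and B: "\<forall>x\<in>closure \<Omega>. \<bar>u x\<bar> \<le> B"
  shows "\<forall>x\<in>frontier \<Omega>. (u x)\<^sup>2 \<le> B\<^sup>2" "\<forall>p\<in>offdiag \<Omega>. (L.diff2 u p)\<^sup>2 \<le> (2 * B)\<^sup>2"
proof -
  show "\<forall>x\<in>frontier \<Omega>. (u x)\<^sup>2 \<le> B\<^sup>2"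
  proof
    fix x assume "x \<in> frontier \<Omega>"
    then have "\<bar>u x\<bar> \<le> B" using B by (simp add: frontier_def)
    then have "\<bar>u x\<bar>\<^sup>2 \<le> B\<^sup>2" by (intro power_mono) auto
    then show "(u x)\<^sup>2 \<le> B\<^sup>2" by simp
  qed
  show "\<forall>p\<in>offdiag \<Omega>. (L.diff2 u p)\<^sup>2 \<le> (2 * B)\<^sup>2"
  proof
    fix p assume "p \<in> offdiag \<Omega>"
    then have "\<bar>u (fst p)\<bar> \<le> B" "\<bar>u (snd p)\<bar> \<le> B" using L.offdiag_closure B by auto
    then have "\<bar>L.diff2 u p\<bar> \<le> 2 * B" by linarith
    then have "\<bar>L.diff2 u p\<bar>\<^sup>2 \<le> (2 * B)\<^sup>2" by (intro power_mono) auto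
    then show "(L.diff2 u p)\<^sup>2 \<le> (2 * B)\<^sup>2" by simp
  qed
qed

lemma form_convergence:
  assumes u: "u \<in> core"
  shows "(\<lambda>n. N.E n u u) \<longlonglongrightarrow> L.E u u"
    and "setwise_increasing \<kappa>n \<Longrightarrow> setwise_increasing \<theta>n \<Longrightarrow> incseq (\<lambda>n. N.E n u u)"
    and "setwise_decreasing \<kappa>n \<Longrightarrow> setwise_decreasing \<theta>n \<Longrightarrow> decseq (\<lambda>n. N.E n u u)"
proof -
  obtain B where B: "\<forall>x\<in>closure \<Omega>. \<bar>u x\<bar> \<le> B" using core_bounded[OF u] by metis
  have 1: "continuous_on (frontier \<Omega>) (\<lambda>x. (u x)\<^sup>2)" by (intro continuous_intros L.core_frontier u)
  have 2: "continuous_on (offdiag \<Omega>) (\<lambda>p. (L.diff2 u p)\<^sup>2)" by (intro continuous_on_power L.core_offdiag u)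
  have b1: "\<forall>x\<in>frontier \<Omega>. 0 \<le> (u x)\<^sup>2 \<and> (u x)\<^sup>2 \<le> B\<^sup>2"
    using core_square_bounds(1)[OF u B] by simp
  have b2: "\<forall>p\<in>offdiag \<Omega>. 0 \<le> (L.diff2 u p)\<^sup>2 \<and> (L.diff2 u p)\<^sup>2 \<le> (2 * B)\<^sup>2"
    using core_square_bounds(2)[OF u B] by simp
  note K = kappa_convergence[OF 1 b1] and T = theta_convergence[OF 2 b2]
  show "(\<lambda>n. N.E n u u) \<longlonglongrightarrow> L.E u u"
    unfolding N.form_self L.form_self by (intro tendsto_add tendsto_const K(1) T(1))
  show "incseq (\<lambda>n. N.E n u u)" if "setwise_increasing \<kappa>n" "setwise_increasing \<theta>n"
    using K(2)[OF that(1)] T(2)[OF that(2)] unfolding N.form_self incseq_def by (auto intro!: add_mono)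
  show "decseq (\<lambda>n. N.E n u u)" if "setwise_decreasing \<kappa>n" "setwise_decreasing \<theta>n"
    using K(3)[OF that(1)] T(3)[OF that(2)] unfolding N.form_self decseq_def by (auto intro!: add_mono)
qed

text \<open>The forms lie above their limit, so the minima do too; a near-minimiser of the limit
  functional, inserted into the n-th one, gives the upper bound.\<close>

lemma jmin_convergence_decreasing:
  assumes d: "setwise_decreasing \<kappa>n" "setwise_decreasing \<theta>n" and r: "r > 0" and f: "f \<in> L2 \<Omega>"
  shows "(\<lambda>n. N.QF.jmin n r f) \<longlonglongrightarrow> L.QF.jmin r f"
proof (rule order_tendstoI)
  have J: "L.QF.J r f v \<le> N.QF.J n r f v" if "v \<in> core" for v n
    using decseq_ge[OF form_convergence(3)[OF that d] form_convergence(1)[OF that], of n]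
    by (simp add: N.QF.J_def L.QF.J_def)
  fix a assume a: "a < L.QF.jmin r f"
  have "L.QF.jmin r f \<le> N.QF.jmin n r f" for n
    by (rule N.QF.jmin_greatest) (rule order_trans[OF L.QF.jmin_le[OF r f] J])
  then show "\<forall>\<^sub>F n in sequentially. a < N.QF.jmin n r f"
    using a by (intro always_eventually allI) (rule less_le_trans)
next
  fix a assume a: "L.QF.jmin r f < a"
  then obtain v where v: "v \<in> core" "L.QF.J r f v < a"
    using L.QF.jmin_approx[of "a - L.QF.jmin r f" r f] by auto
  have "(\<lambda>n. N.QF.J n r f v) \<longlonglongrightarrow> L.QF.J r f v"
    unfolding N.QF.J_def L.QF.J_def by (intro tendsto_add tendsto_diff tendsto_const form_convergence(1) v(1))
  then have "\<forall>\<^sub>F n in sequentially. N.QF.J n r f v < a" using v(2) by (rule order_tendstoD)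
  then show "\<forall>\<^sub>F n in sequentially. N.QF.jmin n r f < a"
    by eventually_elim (rule le_less_trans[OF N.QF.jmin_le[OF r f v(1)]])
qed

end

section \<open>Truncation and increasing sequences of measures\<close>

lemma arctan_truncation:
  assumes e: "e > 0" and M: "M \<ge> 0"
  obtains F F' :: "real \<Rightarrow> real" and B where "B \<ge> 0"
    "\<And>t. (F has_real_derivative F' t) (at t)" "continuous_on UNIV F'" "\<And>t. \<bar>F' t\<bar> \<le> 1" "F 0 = 0"
    "\<And>t. \<bar>F t\<bar> \<le> B" "\<And>t. \<bar>t\<bar> \<le> M \<Longrightarrow> \<bar>t - F t\<bar> \<le> e"
proof -
  \<comment> \<open>F t = C arctan(t/C) has slope 1/(1 + (t/C)^2), so on [-M, M] it deviates from t
    by at most M^3/C^2. With C >= 1 this is at most M^3/C, and C >= M^3/e makes it at most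
    e.\<close>
  define C where "C = max 1 (M ^ 3 / e)"
  have C: "C \<ge> 1" "M ^ 3 \<le> C * e"
    using e by (auto simp: C_def max_def field_simps)
  define F where "F t = C * arctan (t / C)" for t
  define F' where "F' t = inverse (1 + (t / C)\<^sup>2)" for t
  have pos: "1 + (t / C)\<^sup>2 > 0" for t by (simp add: add_pos_nonneg)
  have D: "(F has_real_derivative F' t) (at t)" for t
    unfolding F_def F'_def using C(1) by (auto intro!: derivative_eq_intros)
  have cont: "continuous_on UNIV F'"
    unfolding F'_def using pos C(1) by (intro continuous_intros) (auto simp: less_imp_neq[symmetric])
  have F'1: "\<bar>F' t\<bar> \<le> 1" for t
    unfolding F'_def using pos[of t] by (simp add: inverse_le_1_iff abs_of_pos)
  have bound: "\<bar>F t\<bar> \<le> C * (pi / 2)" for t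
    using C(1) arctan_bounded[of "t / C"] unfolding F_def abs_mult by (intro mult_mono) auto
  have close: "\<bar>t - F t\<bar> \<le> e" if t: "\<bar>t\<bar> \<le> M" for t
  proof -
    have "norm ((t - F t) - (0 - F 0)) \<le> M\<^sup>2 / C\<^sup>2 * norm (t - 0)"
    proof (rule field_differentiable_bound[of "{-M..M}" "\<lambda>t. t - F t" "\<lambda>t. 1 - F' t"])
      fix s assume s: "s \<in> {-M..M}"
      show "((\<lambda>t. t - F t) has_field_derivative 1 - F' s) (at s within {-M..M})"
        by (rule has_field_derivative_at_within) (auto intro!: derivative_eq_intros D)
      have "1 - F' s = (s / C)\<^sup>2 / (1 + (s / C)\<^sup>2)" using pos[of s] by (simp add: F'_def field_simps)
      also have "\<dots> \<le> (s / C)\<^sup>2 / 1" using pos[of s] by (intro divide_left_mono) auto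
      also have "\<dots> = s\<^sup>2 / C\<^sup>2" by (simp add: power_divide)
      also have "\<dots> \<le> M\<^sup>2 / C\<^sup>2" using s by (intro divide_right_mono) (auto simp: abs_le_square_iff[symmetric])
      finally show "norm (1 - F' s) \<le> M\<^sup>2 / C\<^sup>2" using F'1[of s] by (simp add: abs_le_iff)
    qed (use t M in auto)
    also have "\<dots> \<le> M\<^sup>2 / C\<^sup>2 * M" using t by (intro mult_left_mono) auto
    also have "\<dots> = M ^ 3 / C\<^sup>2" by (simp add: power2_eq_square power3_eq_cube)
    also have "\<dots> \<le> M ^ 3 / C"
      using C(1) M by (intro divide_left_mono) (auto simp: power2_eq_square)
    also have "\<dots> \<le> e" using C by (simp add: divide_le_eq mult.commute)
    finally show ?thesis by (simp add: F_def)
  qed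
  show thesis
    by (rule that[of "C * (pi / 2)" F F', OF _ D cont F'1 _ bound close]) (use C(1) in \<open>auto simp: F_def\<close>)
qed

lemma contraction_lipschitz:
  fixes F F' :: "real \<Rightarrow> real"
  assumes D: "\<And>t. (F has_real_derivative F' t) (at t)" and le: "\<And>t. \<bar>F' t\<bar> \<le> 1"
  shows "\<bar>F s - F t\<bar> \<le> \<bar>s - t\<bar>"
proof -
  have "norm (F s - F t) \<le> 1 * norm (s - t)"
    using le by (intro field_differentiable_bound[of UNIV F F'] has_field_derivative_at_within[OF D]) auto
  then show ?thesis by simp
qed

context monotone_measures
begin

text \<open>F is 1-Lipschitz, which treats the gradient and the differences; together with F 0 = 0
  it gives |F(u)| <= |u| for the integral over \<kappa>.\<close>

lemma form_contraction:
  fixes F F' :: "real \<Rightarrow> real"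
  assumes u: "u \<in> core" and D: "\<And>t. (F has_real_derivative F' t) (at t)" and cont: "continuous_on UNIV F'"
    and le: "\<And>t. \<bar>F' t\<bar> \<le> 1" and F0: "F 0 = 0"
  shows "N.E n (\<lambda>x. F (u x)) (\<lambda>x. F (u x)) \<le> N.E n u u"
proof -
  note Fc = core_compose(1)[OF u D cont]
  note lip = contraction_lipschitz[OF D le]
  have "(L2_norm \<Omega> (weak_gradient \<Omega> (\<lambda>x. F (u x))))\<^sup>2 \<le> (L2_norm \<Omega> (weak_gradient \<Omega> u))\<^sup>2"
    using core_contraction_gradient[OF u D cont le] by (intro power_mono) auto
  moreover have "(LINT x|\<kappa>n n. (F (u x))\<^sup>2) \<le> (LINT x|\<kappa>n n. (u x)\<^sup>2)"
  proof (rule integral_mono)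
    show "(F (u x))\<^sup>2 \<le> (u x)\<^sup>2" for x using lip[of "u x" 0] F0 by (simp add: abs_le_square_iff[symmetric])
  qed (use N.core_kappa_integrable[OF u u] N.core_kappa_integrable[OF Fc Fc] in \<open>simp_all add: power2_eq_square\<close>)
  moreover have "(LINT p|\<theta>n n. (L.diff2 (\<lambda>x. F (u x)) p)\<^sup>2) \<le> (LINT p|\<theta>n n. (L.diff2 u p)\<^sup>2)"
  proof (rule integral_mono)
    show "(L.diff2 (\<lambda>x. F (u x)) p)\<^sup>2 \<le> (L.diff2 u p)\<^sup>2" for p
      using lip by (simp add: abs_le_square_iff[symmetric])
  qed (use N.core_theta_integrable[OF u u] N.core_theta_integrable[OF Fc Fc] in \<open>simp_all add: power2_eq_square\<close>)
  ultimately show ?thesis unfolding N.form_self by linarith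
qed

text \<open>The weights are such that B^2 times this bounds the gap between the forms at a function
  bounded by B: differences of its values are bounded by 2 B, which squares to 4 B^2.\<close>

definition excess :: "nat \<Rightarrow> real" where
  "excess n = ((LINT x|\<kappa>. 1) - (LINT x|\<kappa>n n. 1)) + 4 * ((LINT p|\<theta>. 1) - (LINT p|\<theta>n n. 1))"

lemma excess_tendsto: "excess \<longlonglongrightarrow> 0"
proof -
  have "(\<lambda>n. LINT x|\<kappa>n n. 1::real) \<longlonglongrightarrow> (LINT x|\<kappa>. 1)"
    by (rule kappa_convergence(1)[of "\<lambda>x. 1" 1]) auto
  moreover have "(\<lambda>n. LINT x|\<theta>n n. 1::real) \<longlonglongrightarrow> (LINT x|\<theta>. 1)"
    by (rule theta_convergence(1)[of "\<lambda>x. 1" 1]) auto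
  ultimately have "excess \<longlonglongrightarrow> ((LINT x|\<kappa>. 1) - (LINT x|\<kappa>. 1)) + 4 * ((LINT p|\<theta>. 1) - (LINT p|\<theta>. 1))"
    unfolding excess_def by (intro tendsto_add tendsto_diff tendsto_mult tendsto_const)
  then show ?thesis by simp
qed

text \<open>Monotonicity is used on the nonnegative functions B^2 - u^2 and (2B)^2 - (u(x) - u(y))^2
  rather than on the squares themselves. That reverses the inequality at the price of the missing
  mass.\<close>

lemma form_excess:
  assumes i: "setwise_increasing \<kappa>n" "setwise_increasing \<theta>n"
    and u: "u \<in> core" and B: "\<forall>x\<in>closure \<Omega>. \<bar>u x\<bar> \<le> B"
  shows "L.E u u \<le> N.E n u u + B\<^sup>2 * excess n"
proof -
  note b = core_square_bounds[OF u B]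
  have 1: "continuous_on (frontier \<Omega>) (\<lambda>x. B\<^sup>2 - (u x)\<^sup>2)" by (intro continuous_intros L.core_frontier u)
  have 2: "continuous_on (offdiag \<Omega>) (\<lambda>p. (2 * B)\<^sup>2 - (L.diff2 u p)\<^sup>2)"
    by (intro continuous_on_diff continuous_on_const continuous_on_power L.core_offdiag u)
  have b1: "\<forall>x\<in>frontier \<Omega>. 0 \<le> B\<^sup>2 - (u x)\<^sup>2 \<and> B\<^sup>2 - (u x)\<^sup>2 \<le> B\<^sup>2" using b(1) by simp
  have b2: "\<forall>p\<in>offdiag \<Omega>. 0 \<le> (2 * B)\<^sup>2 - (L.diff2 u p)\<^sup>2 \<and> (2 * B)\<^sup>2 - (L.diff2 u p)\<^sup>2 \<le> (2 * B)\<^sup>2"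
    using b(2) by simp
  have "(LINT x|\<kappa>n n. B\<^sup>2 - (u x)\<^sup>2) \<le> (LINT x|\<kappa>. B\<^sup>2 - (u x)\<^sup>2)"
    by (rule incseq_le[OF kappa_convergence(2)[OF 1 b1 i(1)] kappa_convergence(1)[OF 1 b1]])
  moreover have "(LINT p|\<theta>n n. (2 * B)\<^sup>2 - (L.diff2 u p)\<^sup>2) \<le> (LINT p|\<theta>. (2 * B)\<^sup>2 - (L.diff2 u p)\<^sup>2)"
    by (rule incseq_le[OF theta_convergence(2)[OF 2 b2 i(2)] theta_convergence(1)[OF 2 b2]])
  moreover have "(LINT x|\<kappa>n n. B\<^sup>2 - (u x)\<^sup>2) = B\<^sup>2 * (LINT x|\<kappa>n n. 1) - (LINT x|\<kappa>n n. (u x)\<^sup>2)"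
    by (rule integral_const_minus[OF N.kappa(2)]) (use N.core_kappa_integrable[OF u u] in \<open>simp add: power2_eq_square\<close>)
  moreover have "(LINT x|\<kappa>. B\<^sup>2 - (u x)\<^sup>2) = B\<^sup>2 * (LINT x|\<kappa>. 1) - (LINT x|\<kappa>. (u x)\<^sup>2)"
    by (rule integral_const_minus[OF L.kappa(2)]) (use L.core_kappa_integrable[OF u u] in \<open>simp add: power2_eq_square\<close>)
  moreover have "(LINT p|\<theta>n n. (2 * B)\<^sup>2 - (L.diff2 u p)\<^sup>2) = (2 * B)\<^sup>2 * (LINT x|\<theta>n n. 1) - (LINT p|\<theta>n n. (L.diff2 u p)\<^sup>2)"
    by (rule integral_const_minus[OF N.theta(2)]) (use N.core_theta_integrable[OF u u] in \<open>simp add: power2_eq_square\<close>)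
  moreover have "(LINT p|\<theta>. (2 * B)\<^sup>2 - (L.diff2 u p)\<^sup>2) = (2 * B)\<^sup>2 * (LINT x|\<theta>. 1) - (LINT p|\<theta>. (L.diff2 u p)\<^sup>2)"
    by (rule integral_const_minus[OF L.theta(2)]) (use L.core_theta_integrable[OF u u] in \<open>simp add: power2_eq_square\<close>)
  ultimately show ?thesis
    unfolding L.form_self N.form_self excess_def by (simp add: algebra_simps power_mult_distrib)
qed

text \<open>Truncation lowers the n-th form and the L2 norm, so only the linear term (f, u) has to
  be paid for; the missing mass pays for the passage to the limit form.\<close>

lemma truncated_J_le:
  fixes F F' :: "real \<Rightarrow> real"
  assumes i: "setwise_increasing \<kappa>n" "setwise_increasing \<theta>n" and r: "r > 0" and f: "f \<in> L2 \<Omega>"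
    and u: "u \<in> core" and D: "\<And>t. (F has_real_derivative F' t) (at t)" and cont: "continuous_on UNIV F'"
    and le: "\<And>t. \<bar>F' t\<bar> \<le> 1" and F0: "F 0 = 0" and B: "\<And>t. \<bar>F t\<bar> \<le> B"
  shows "L.QF.J r f (\<lambda>x. F (u x)) \<le> N.QF.J n r f u + 2 * (L2_norm \<Omega> f * L2_norm \<Omega> (\<lambda>x. u x - F (u x))) + B\<^sup>2 * excess n"
proof -
  note Fc = core_compose(1)[OF u D cont]
  note uL = core_L2[OF u] and FL = core_L2[OF Fc]
  have "L.E (\<lambda>x. F (u x)) (\<lambda>x. F (u x)) \<le> N.E n (\<lambda>x. F (u x)) (\<lambda>x. F (u x)) + B\<^sup>2 * excess n"
    using form_excess[OF i Fc] B by blast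
  moreover have "N.E n (\<lambda>x. F (u x)) (\<lambda>x. F (u x)) \<le> N.E n u u"
    by (rule form_contraction[OF u D cont le F0])
  moreover have "L2_inner \<Omega> (\<lambda>x. F (u x)) (\<lambda>x. F (u x)) \<le> L2_inner \<Omega> u u"
  proof -
    have "L2_norm \<Omega> (\<lambda>x. F (u x)) \<le> L2_norm \<Omega> u"
      by (rule L2_norm_mono_AE[OF FL uL]) (use contraction_lipschitz[OF D le, of _ 0] F0 in auto)
    then show ?thesis unfolding L2_norm_sq[symmetric] by (intro power_mono) auto
  qed
  then have "r * L2_inner \<Omega> (\<lambda>x. F (u x)) (\<lambda>x. F (u x)) \<le> r * L2_inner \<Omega> u u"
    using r by (intro mult_left_mono) auto
  moreover have "L2_inner \<Omega> f u - L2_inner \<Omega> f (\<lambda>x. F (u x)) \<le> L2_norm \<Omega> f * L2_norm \<Omega> (\<lambda>x. u x - F (u x))"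
    using L2_Cauchy_Schwarz[OF f L2_diff[OF uL FL]] f uL FL by (simp add: L2_inner_diff_right)
  ultimately show ?thesis unfolding L.QF.J_def N.QF.J_def by linarith
qed

text \<open>Only \<open>L.QF.jmin r f \<le> m\<close> is hard, m being the limit of the minima. A
  truncation F is fitted to one near-minimiser s n, and then F(s p) is inserted into the limit
  functional for all p >= n. Its bound B does not depend on p, so B^2 * excess p vanishes as p
  grows.\<close>

lemma jmin_convergence_increasing:
  assumes i: "setwise_increasing \<kappa>n" "setwise_increasing \<theta>n" and r: "r > 0" and f: "f \<in> L2 \<Omega>"
  shows "(\<lambda>n. N.QF.jmin n r f) \<longlonglongrightarrow> L.QF.jmin r f"
proof -
  let ?m = "\<lambda>n. N.QF.jmin n r f"
  have J_mono: "N.QF.J n r f v \<le> N.QF.J p r f v" if "v \<in> core" "n \<le> p" for v n p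
    using incseqD[OF form_convergence(2)[OF that(1) i] that(2)] by (simp add: N.QF.J_def)
  have J_le: "N.QF.J n r f v \<le> L.QF.J r f v" if "v \<in> core" for v n
    using incseq_le[OF form_convergence(2)[OF that i] form_convergence(1)[OF that], of n]
    by (simp add: N.QF.J_def L.QF.J_def)
  have inc: "incseq ?m" unfolding incseq_def
    by (intro allI impI N.QF.jmin_greatest) (rule order_trans[OF N.QF.jmin_le[OF r f] J_mono])
  have m_le: "?m n \<le> L.QF.jmin r f" for n
    by (rule L.QF.jmin_greatest) (rule order_trans[OF N.QF.jmin_le[OF r f] J_le])
  obtain m where m: "?m \<longlonglongrightarrow> m" "\<And>n. ?m n \<le> m"
    using incseq_convergent[OF inc, of "L.QF.jmin r f"] m_le by blast
  have "m \<le> L.QF.jmin r f" by (rule LIMSEQ_le_const2[OF m(1)]) (use m_le in blast)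
  define \<epsilon> where "\<epsilon> n = inverse (real (Suc n))" for n
  have \<epsilon>: "\<epsilon> n > 0" "\<epsilon> \<longlonglongrightarrow> 0" for n
    using LIMSEQ_inverse_real_of_nat by (auto simp: \<epsilon>_def[abs_def])
  have \<epsilon>_mono: "\<epsilon> p \<le> \<epsilon> n" if "n \<le> p" for n p using that by (simp add: \<epsilon>_def)
  have "\<forall>n. \<exists>v. v \<in> core \<and> N.QF.J n r f v < ?m n + \<epsilon> n"
    using N.QF.jmin_approx[OF \<epsilon>(1)] by blast
  then obtain s where s: "\<And>n. s n \<in> core" "\<And>n. N.QF.J n r f (s n) < ?m n + \<epsilon> n" by metis
  note sL = core_L2[OF s(1)]
  \<comment> \<open>For the n-th functional not only s n but also s p has a value below m +
    \<epsilon> n, because the functionals increase and \<epsilon> decreases.\<close>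
  have close: "r * (L2_norm \<Omega> (\<lambda>x. s n x - s p x))\<^sup>2 \<le> 4 * (m - ?m n) + 4 * \<epsilon> n" if "n \<le> p" for n p
  proof -
    have "r * (L2_norm \<Omega> (\<lambda>x. s n x - s p x))\<^sup>2 \<le> 2 * N.QF.J n r f (s n) + 2 * N.QF.J n r f (s p) - 4 * ?m n"
      using N.QF.J_parallelogram[OF r f s(1) s(1), of n n p] N.QF.q_nonneg[OF core_diff[OF s(1) s(1)], of n n p] by linarith
    also have "\<dots> \<le> 4 * (m - ?m n) + 4 * \<epsilon> n"
      using s(2)[of n] s(2)[of p] J_mono[OF s(1)[of p] that] \<epsilon>_mono[OF that] m(2)[of n] m(2)[of p] by argo
    finally show ?thesis .
  qed
  \<comment> \<open>2 + vol comes from the truncation error \<open>trunc\<close>, and the factor 2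
    from the term 2 (f, v) of \<open>J\<close>.\<close>
  define D where "D = 2 * (L2_norm \<Omega> f * (2 + vol))"
  have D0: "D \<ge> 0" by (simp add: D_def)
  have key: "L.QF.jmin r f \<le> m + D * e" if e: "e > 0" for e
  proof -
    have "(\<lambda>n. 4 * (m - ?m n) + 4 * \<epsilon> n) \<longlonglongrightarrow> 4 * (m - m) + 4 * 0"
      by (intro tendsto_add tendsto_mult tendsto_diff tendsto_const m(1) \<epsilon>(2))
    then have "\<forall>\<^sub>F n in sequentially. 4 * (m - ?m n) + 4 * \<epsilon> n < r * e\<^sup>2"
      using r e by (intro order_tendstoD(2)) auto
    then obtain n where n: "4 * (m - ?m n) + 4 * \<epsilon> n < r * e\<^sup>2" by (auto simp: eventually_sequentially)
    have sp: "L2_norm \<Omega> (\<lambda>x. s n x - s p x) \<le> e" if "p \<ge> n" for p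
    proof (rule power2_le_imp_le)
      have "r * (L2_norm \<Omega> (\<lambda>x. s n x - s p x))\<^sup>2 \<le> r * e\<^sup>2" using close[OF that] n by linarith
      then show "(L2_norm \<Omega> (\<lambda>x. s n x - s p x))\<^sup>2 \<le> e\<^sup>2" using r by simp
    qed (use e in simp)
    obtain M where M: "M \<ge> 0" "\<And>x. x \<in> closure \<Omega> \<Longrightarrow> \<bar>s n x\<bar> \<le> M" using core_bounded[OF s(1)] by blast
    obtain F F' :: "real \<Rightarrow> real" and B where F: "\<And>t. (F has_real_derivative F' t) (at t)" "continuous_on UNIV F'"
      "\<And>t. \<bar>F' t\<bar> \<le> 1" "F 0 = 0" and B: "\<And>t. \<bar>F t\<bar> \<le> B" and Fe: "\<And>t. \<bar>t\<bar> \<le> M \<Longrightarrow> \<bar>t - F t\<bar> \<le> e"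
      using arctan_truncation[OF e M(1)] by metis
    note Fc = core_compose(1)[OF s(1) F(1,2)]
    note FL = core_L2[OF Fc]
    \<comment> \<open>The sup bound M is known for s n only, so the path goes from s p to s n (at
      most e), on to F(s n) (at most e * vol) and back to F(s p) (at most e, as F is a
      contraction).\<close>
    have trunc: "L2_norm \<Omega> (\<lambda>x. s p x - F (s p x)) \<le> (2 + vol) * e" if p: "p \<ge> n" for p
    proof -
      have "L2_norm \<Omega> (\<lambda>x. s p x - F (s p x)) \<le> L2_norm \<Omega> (\<lambda>x. s p x - s n x) + L2_norm \<Omega> (\<lambda>x. s n x - F (s p x))"
        by (rule L2_norm_triangle3[OF sL sL FL])
      moreover have "L2_norm \<Omega> (\<lambda>x. s n x - F (s p x)) \<le> L2_norm \<Omega> (\<lambda>x. s n x - F (s n x)) + L2_norm \<Omega> (\<lambda>x. F (s n x) - F (s p x))"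
        by (rule L2_norm_triangle3[OF sL FL FL])
      moreover have "L2_norm \<Omega> (\<lambda>x. s n x - F (s n x)) \<le> \<bar>e\<bar> * vol"
        by (rule L2_bounded(2)[OF L2_measurable[OF L2_diff[OF sL FL]]])
           (use Fe M(2) closure_subset in blast)
      moreover have "L2_norm \<Omega> (\<lambda>x. F (s n x) - F (s p x)) \<le> L2_norm \<Omega> (\<lambda>x. s n x - s p x)"
        by (rule L2_norm_mono_AE[OF L2_diff[OF FL FL] L2_diff[OF sL sL]])
           (use contraction_lipschitz[OF F(1,3)] in auto)
      ultimately show ?thesis
        using sp[OF p] L2_norm_minus_commute[of \<Omega> "s p" "s n"] e by (simp add: algebra_simps)
    qed
    have "L.QF.jmin r f \<le> m + \<epsilon> p + D * e + B\<^sup>2 * excess p" if p: "p \<ge> n" for p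
    proof -
      have "L.QF.jmin r f \<le> L.QF.J r f (\<lambda>x. F (s p x))" by (rule L.QF.jmin_le[OF r f Fc])
      also have "\<dots> \<le> N.QF.J p r f (s p) + 2 * (L2_norm \<Omega> f * L2_norm \<Omega> (\<lambda>x. s p x - F (s p x))) + B\<^sup>2 * excess p"
        by (rule truncated_J_le[OF i r f s(1) F B])
      also have "\<dots> \<le> (m + \<epsilon> p) + 2 * (L2_norm \<Omega> f * ((2 + vol) * e)) + B\<^sup>2 * excess p"
        using s(2)[of p] m(2)[of p] mult_left_mono[OF trunc[OF p] L2_norm_nonneg[of \<Omega> f]] by linarith
      also have "\<dots> = m + \<epsilon> p + D * e + B\<^sup>2 * excess p" by (simp add: D_def algebra_simps)
      finally show ?thesis .
    qed
    moreover have "(\<lambda>p. m + \<epsilon> p + D * e + B\<^sup>2 * excess p) \<longlonglongrightarrow> m + 0 + D * e + B\<^sup>2 * 0"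
      by (intro tendsto_add tendsto_mult tendsto_const \<epsilon>(2) excess_tendsto)
    ultimately have "L.QF.jmin r f \<le> m + 0 + D * e + B\<^sup>2 * 0" by (intro LIMSEQ_le_const) blast+
    then show ?thesis by simp
  qed
  have "L.QF.jmin r f \<le> m"
  proof (rule field_le_epsilon)
    fix e :: real assume e: "e > 0"
    have "L.QF.jmin r f \<le> m + D * (e / (D + 1))" using e D0 by (intro key) simp
    also have "D * (e / (D + 1)) \<le> e" using e D0 by (simp add: field_simps)
    finally show "L.QF.jmin r f \<le> m + e" by simp
  qed
  then have "m = L.QF.jmin r f" using \<open>m \<le> L.QF.jmin r f\<close> by simp
  then show ?thesis using m(1) by simp
qed

lemma jmin_convergence:
  "r > 0 \<Longrightarrow> f \<in> L2 \<Omega> \<Longrightarrow> (\<lambda>n. N.QF.jmin n r f) \<longlonglongrightarrow> L.QF.jmin r f"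
  using monotone jmin_convergence_increasing jmin_convergence_decreasing by blast

end

theorem proposition6p1:
  fixes \<Omega> :: "'a::euclidean_space set"
    and \<kappa>n :: "nat \<Rightarrow> 'a measure" and \<kappa> :: "'a measure"
    and \<theta>n :: "nat \<Rightarrow> ('a \<times> 'a) measure" and \<theta> :: "('a \<times> 'a) measure"
  assumes "open \<Omega>" and "bounded \<Omega>"
    and "\<And>n. borel_measure_on (frontier \<Omega>) (\<kappa>n n)" and "\<And>n. finite_measure (\<kappa>n n)"
    and "borel_measure_on (frontier \<Omega>) \<kappa>" and "finite_measure \<kappa>"
    and "\<And>n. borel_measure_on (offdiag \<Omega>) (\<theta>n n)" and "\<And>n. finite_measure (\<theta>n n)"
    and "\<And>n. symmetric_measure (\<theta>n n)"
    and "borel_measure_on (offdiag \<Omega>) \<theta>" and "finite_measure \<theta>" and "symmetric_measure \<theta>"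
    and "\<And>n. admissible \<Omega> (\<kappa>n n) (\<theta>n n)" and "admissible \<Omega> \<kappa> \<theta>"
    and "(setwise_increasing \<kappa>n \<and> setwise_increasing \<theta>n)
       \<or> (setwise_decreasing \<kappa>n \<and> setwise_decreasing \<theta>n)"
    and "vague_conv (frontier \<Omega>) \<kappa>n \<kappa>" and "vague_conv (offdiag \<Omega>) \<theta>n \<theta>"
  shows "strong_resolvent_conv \<Omega> (\<lambda>n. Laplacian \<Omega> (\<kappa>n n) (\<theta>n n)) (Laplacian \<Omega> \<kappa> \<theta>)"
proof -
  note intros = admissible_measures.intro boundary_measures.intro bounded_domain.intro
    boundary_measures_axioms.intro admissible_measures_axioms.intro
  interpret A: admissible_measures \<Omega> "\<kappa>n n" "\<theta>n n" for n
    by (intro intros assms)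
  interpret B: admissible_measures \<Omega> \<kappa> \<theta>
    by (intro intros assms)
  interpret M: monotone_measures \<Omega> \<kappa>n \<theta>n \<kappa> \<theta>
    by (intro monotone_measures.intro monotone_measures_axioms.intro intros assms)
  have "strong_resolvent_conv \<Omega> (\<lambda>n. A.CF.lap n) B.CF.lap"
    by (rule strong_resolvent_convI[OF A.closable_form_core B.closable_form_core
          M.form_convergence(1) M.jmin_convergence])
  then show ?thesis unfolding A.Laplacian_eq B.Laplacian_eq .
qed

end
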